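(* Let $\Omega$ be a one-dimensional domain, either a bounded open interval or the circle $\mathbb{R}/\mathbb{Z}$, and let $u$ be the solution of the total variation flow $u_t\in-\partial_{L^2}TV(u)$ on $\Omega$ with initial datum $u_0\in BV(\Omega)$. Then $$|Du(t)|\le|Du_0|\quad\text{as measures on }\Omega\text{ for all }t>0,$$ i.e. $\int_\Omega\varphi\,d|Du(t)|\le\int_\Omega\varphi\,d|Du_0|$ for every nonnegative $\varphi\in C_c(\Omega)$.
   Context: $BV(\Omega)$ is the space of integrable functions whose distributional derivative $Du$ is a finite Radon measure; $|Du|$ denotes its total variation measure and $TV(u)=|Du|(\Omega)$ ($+\infty$ if $u\notin BV$). The solution is $u\in C([0,\infty);L^2(\Omega))$ with $u(0)=u_0$, $u_t\in\bigcap_{\delta>0}L^2((\delta,\infty);L^2(\Omega))$ and $u_t(t)\in-\partial_{L^2}TV(u(t))$ for a.e. $t>0$, where $\partial_{L^2}$ is the convex subdifferential in $L^2(\Omega)$ (for an interval this corresponds to the homogeneous Neumann boundary condition). *)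

theory Defs
  imports "HOL-Analysis.Analysis"
begin

text \<open>One-dimensional domains: a bounded open interval (a,b), or the circle R/Z,
  the latter represented by the fundamental domain [0,1) together with
  1-periodic test functions.\<close>

datatype dom1 = Interval real real | Circle

fun dset :: "dom1 \<Rightarrow> real set" where
  "dset (Interval a b) = {a<..<b}"
| "dset Circle = {0..<1}"

fun valid_dom :: "dom1 \<Rightarrow> bool" where
  "valid_dom (Interval a b) = (a < b)"
| "valid_dom Circle = True"

definition Cc_test :: "dom1 \<Rightarrow> (real \<Rightarrow> real) \<Rightarrow> bool" where
  "Cc_test d \<phi> \<longleftrightarrow> continuous_on UNIV \<phi> \<and>
     (case d of
        Interval a b \<Rightarrow> (\<exists>K. compact K \<and> K \<subseteq> {a<..<b} \<and> (\<forall>x. x \<notin> K \<longrightarrow> \<phi> x = 0))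
      | Circle \<Rightarrow> (\<forall>x. \<phi> (x + 1) = \<phi> x))"

definition C1_test :: "dom1 \<Rightarrow> (real \<Rightarrow> real) \<Rightarrow> (real \<Rightarrow> real) \<Rightarrow> bool" where
  "C1_test d \<phi> \<phi>' \<longleftrightarrow> Cc_test d \<phi> \<and> continuous_on UNIV \<phi>' \<and>
     (\<forall>x. (\<phi> has_real_derivative \<phi>' x) (at x))"

text \<open>nu is the total variation measure |Dw| of w on Omega: w is integrable and
  Dw = sigma nu (polar decomposition) with nu a finite Borel measure on Omega and |sigma| = 1,
  i.e. the integral of w phi' equals minus the integral of phi d(Dw) for all phi in C^1_c(Omega).\<close>
definition is_TV_measure :: "dom1 \<Rightarrow> (real \<Rightarrow> real) \<Rightarrow> real measure \<Rightarrow> bool" where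
  "is_TV_measure d w \<nu> \<longleftrightarrow>
     integrable (lebesgue_on (dset d)) w \<and>
     finite_measure \<nu> \<and> sets \<nu> = sets (restrict_space borel (dset d)) \<and>
     (\<exists>\<sigma> \<in> borel_measurable \<nu>. (\<forall>x \<in> space \<nu>. \<bar>\<sigma> x\<bar> = 1) \<and>
        (\<forall>\<phi> \<phi>'. C1_test d \<phi> \<phi>' \<longrightarrow>
           (\<integral>x. w x * \<phi>' x \<partial>lebesgue_on (dset d)) = - (\<integral>x. \<phi> x * \<sigma> x \<partial>\<nu>)))"

definition is_BV :: "dom1 \<Rightarrow> (real \<Rightarrow> real) \<Rightarrow> bool" where
  "is_BV d w \<longleftrightarrow> (\<exists>\<nu>. is_TV_measure d w \<nu>)"

definition TV :: "dom1 \<Rightarrow> (real \<Rightarrow> real) \<Rightarrow> ereal" where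
  "TV d w = (if is_BV d w then ereal (measure (SOME \<nu>. is_TV_measure d w \<nu>) (dset d)) else \<infinity>)"

definition L2 :: "dom1 \<Rightarrow> (real \<Rightarrow> real) \<Rightarrow> bool" where
  "L2 d w \<longleftrightarrow> w \<in> borel_measurable (lebesgue_on (dset d)) \<and>
     integrable (lebesgue_on (dset d)) (\<lambda>x. (w x)\<^sup>2)"

definition in_subdiff_TV :: "dom1 \<Rightarrow> (real \<Rightarrow> real) \<Rightarrow> (real \<Rightarrow> real) \<Rightarrow> bool" where
  "in_subdiff_TV d w g \<longleftrightarrow> L2 d w \<and> L2 d g \<and> TV d w < \<infinity> \<and>
     (\<forall>z. L2 d z \<longrightarrow>
        TV d w + ereal (\<integral>x. g x * (z x - w x) \<partial>lebesgue_on (dset d)) \<le> TV d z)"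

definition TV_flow_solution :: "dom1 \<Rightarrow> (real \<Rightarrow> real) \<Rightarrow> (real \<Rightarrow> real \<Rightarrow> real) \<Rightarrow> bool" where
  "TV_flow_solution d u0 u \<longleftrightarrow>
     (\<forall>t\<ge>0. L2 d (u t)) \<and>
     (\<forall>t\<ge>0. ((\<lambda>s. \<integral>x. (u s x - u t x)\<^sup>2 \<partial>lebesgue_on (dset d)) \<longlongrightarrow> 0) (at t within {0..})) \<and>
     (AE x in lebesgue_on (dset d). u 0 x = u0 x) \<and>
     (\<exists>v :: real \<Rightarrow> real \<Rightarrow> real.
        (\<lambda>(t, x). v t x) \<in> borel_measurable (lborel \<Otimes>\<^sub>M lebesgue_on (dset d)) \<and>
        (\<forall>\<delta>>0. (\<integral>\<^sup>+ t \<in> {\<delta><..}. (\<integral>\<^sup>+ x. ennreal ((v t x)\<^sup>2) \<partial>lebesgue_on (dset d)) \<partial>lborel) < \<infinity>) \<and>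
        (\<forall>s t. 0 < s \<longrightarrow> s \<le> t \<longrightarrow>
           (AE x in lebesgue_on (dset d). u t x - u s x = (LINT \<tau>:{s..t}|lborel. v \<tau> x))) \<and>
        (AE t in lborel. t > 0 \<longrightarrow> in_subdiff_TV d (u t) (\<lambda>x. - v t x)))"

end

theory Submission
  imports Defs
begin

text \<open>The bound \<open>|Du| \<le> |Du\<^sub>0|\<close> is preserved by the implicit Euler scheme, which becomes elementary
  once space is discretised. On a uniform grid, let \<open>S\<close> be the set of step functions whose jump at each node is at
  most the integral of the hat function of the node against \<open>|Du\<^sub>0|\<close>. The resolvent of the total
  variation maps a step function to a step function; its dual is an obstacle problem for the flux, from
  which one reads off that no jump increases, so \<open>S\<close> is preserved. Comparing the subdifferential inequality of the flow
  on \<open>[s,t]\<close> with that of one resolvent step of size \<open>t - s\<close> gives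
  \<open>dist(u(t),S)\<^sup>2 \<le> dist(u(s),S)\<^sup>2 + 4(t - s)E\<close>, where \<open>E\<close> is the integral of \<open>|u\<^sub>t|\<^sup>2\<close> over \<open>[s,t]\<close>.
  The error terms vanish under refinement in time, so the distance to \<open>S\<close> does not increase. The cell averages of
  \<open>u\<^sub>0\<close> lie in \<open>S\<close> and converge to \<open>u\<^sub>0\<close> as the grid is refined, hence the integral of
  \<open>u(t) \<psi>'\<close> is bounded by that of \<open>|\<psi>|\<close> against \<open>|Du\<^sub>0|\<close> for all test functions \<open>\<psi>\<close>. By
  Radon-Nikodym, this functional has a density of modulus at most 1 with respect to \<open>|Du\<^sub>0|\<close>.\<close>

section \<open>Test functions\<close>

text \<open>The flow enters only through its own subdifferential inequality, tested with step
  functions. This is enough because the grid resolvent is exact in the full space. Integrating u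
  over two neighbouring cells and subtracting is the same as testing Du with a hat function, and the
  hats sum to at most 1; so a flux on the grid bounds |Du| from below for every u in BV, and the
  discrete dual certificate is a genuine subgradient. Space discretisation therefore costs something
  only at the two ends, when u_0 is replaced by its cell averages and when the final step function
  is paired with a test function. The obstacle is that a hat is not C1 and, next to the boundary or
  at the seam of the circle, not compactly supported inside the domain, so each such test is a limit
  of admissible ones. A second constraint is that the velocity is square integrable only away from
  time 0; the comparison starts at a small positive time and invokes L2 continuity at 0
  once.\<close>

type_synonym rfun = "real \<Rightarrow> real"

abbreviation leb :: "dom1 \<Rightarrow> real measure" where "leb d \<equiv> lebesgue_on (dset d)"

abbreviation bor :: "dom1 \<Rightarrow> real measure" where "bor d \<equiv> restrict_space borel (dset d)"

abbreviation ip :: "dom1 \<Rightarrow> rfun \<Rightarrow> rfun \<Rightarrow> real" where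
  "ip d f g \<equiv> (\<integral>x. f x * g x \<partial>leb d)"

abbreviation dist2 :: "dom1 \<Rightarrow> rfun \<Rightarrow> rfun \<Rightarrow> real" where
  "dist2 d f g \<equiv> ip d (\<lambda>x. f x - g x) (\<lambda>x. f x - g x)"

abbreviation nsq :: "'a measure \<Rightarrow> ('a \<Rightarrow> real) \<Rightarrow> ('a \<Rightarrow> real) \<Rightarrow> ennreal" where
  "nsq M f g \<equiv> (\<integral>\<^sup>+x. ennreal ((f x - g x)\<^sup>2) \<partial>M)"

abbreviation L1d :: "'a measure \<Rightarrow> ('a \<Rightarrow> real) \<Rightarrow> ('a \<Rightarrow> real) \<Rightarrow> real" where
  "L1d M f g \<equiv> (\<integral>x. \<bar>f x - g x\<bar> \<partial>M)"

fun lo :: "dom1 \<Rightarrow> real" where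
  "lo (Interval a b) = a"
| "lo Circle = 0"

fun hi :: "dom1 \<Rightarrow> real" where
  "hi (Interval a b) = b"
| "hi Circle = 1"

lemma lo_less_hi: "valid_dom d \<Longrightarrow> lo d < hi d"
  by (cases d) auto

lemma dset_subset: "dset d \<subseteq> {lo d..<hi d}"
  by (cases d) auto

lemma open_subset_dset: "{lo d<..<hi d} \<subseteq> dset d"
  by (cases d) auto

lemma dset_borel [measurable, simp]: "dset d \<in> sets borel"
  by (cases d) auto

lemma Cc_test_mult_const: "Cc_test d \<phi> \<Longrightarrow> Cc_test d (\<lambda>x. c * \<phi> x)"
  unfolding Cc_test_def
  by (cases d; simp; blast intro: continuous_on_mult_left mult_not_zero)

lemma Cc_test_add: 
  assumes "Cc_test d \<phi>" "Cc_test d \<psi>" shows "Cc_test d (\<lambda>x. \<phi> x + \<psi> x)"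
proof (cases d)
  case (Interval a b)
  from assms Interval obtain K K' where K: "compact K" "K \<subseteq> {a<..<b}" "\<forall>x. x \<notin> K \<longrightarrow> \<phi> x = 0"
    and K': "compact K'" "K' \<subseteq> {a<..<b}" "\<forall>x. x \<notin> K' \<longrightarrow> \<psi> x = 0"
    unfolding Cc_test_def by auto
  have "\<exists>K. compact K \<and> K \<subseteq> {a<..<b} \<and> (\<forall>x. x \<notin> K \<longrightarrow> \<phi> x + \<psi> x = 0)"
    by (rule exI[of _ "K \<union> K'"]) (use K K' in auto)
  then show ?thesis using assms Interval
    unfolding Cc_test_def by (auto intro!: continuous_intros)
next
  case Circle
  then show ?thesis using assms
    unfolding Cc_test_def by (auto intro!: continuous_intros)
qed

lemma C1_test_mult_const: "C1_test d \<phi> \<phi>' \<Longrightarrow> C1_test d (\<lambda>x. c * \<phi> x) (\<lambda>x. c * \<phi>' x)"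
  unfolding C1_test_def
  by (auto intro!: Cc_test_mult_const continuous_intros derivative_eq_intros)

lemma C1_test_add: 
  "C1_test d \<phi> \<phi>' \<Longrightarrow> C1_test d \<psi> \<psi>' \<Longrightarrow> C1_test d (\<lambda>x. \<phi> x + \<psi> x) (\<lambda>x. \<phi>' x + \<psi>' x)"
  unfolding C1_test_def
  by (auto intro!: Cc_test_add continuous_intros derivative_eq_intros)

lemma C1_test_diff: 
  assumes "C1_test d \<phi> \<phi>'" "C1_test d \<psi> \<psi>'"
  shows "C1_test d (\<lambda>x. \<phi> x - \<psi> x) (\<lambda>x. \<phi>' x - \<psi>' x)"
  using C1_test_add[OF assms(1) C1_test_mult_const[OF assms(2), of "-1"]] by simp

lemma C1_test_zero: "C1_test d (\<lambda>x. 0) (\<lambda>x. 0)"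
  unfolding C1_test_def Cc_test_def by (cases d) (auto intro!: exI[of _ "{}"])

lemma C1_test_one_Circle: "C1_test Circle (\<lambda>x. 1) (\<lambda>x. 0)"
  unfolding C1_test_def Cc_test_def by auto

lemma Cc_test_lo_hi: "valid_dom d \<Longrightarrow> Cc_test d \<phi> \<Longrightarrow> \<phi> (lo d) = \<phi> (hi d)"
proof (cases d)
  case (Interval a b)
  assume "Cc_test d \<phi>"
  with Interval obtain K where "K \<subseteq> {a<..<b}" "\<forall>x. x \<notin> K \<longrightarrow> \<phi> x = 0"
    unfolding Cc_test_def by auto
  then have "\<phi> a = 0" "\<phi> b = 0" by auto
  with Interval show ?thesis by simp
next
  case Circle
  assume "Cc_test d \<phi>"
  with Circle have "\<phi> (0 + 1) = \<phi> 0" unfolding Cc_test_def by (simp only: dom1.case simp_thms)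
  with Circle show ?thesis by simp
qed

lemma Cc_test_lo_Interval: "Cc_test (Interval a b) \<phi> \<Longrightarrow> \<phi> a = 0"
  unfolding Cc_test_def by auto

text \<open>The jumps of \<open>frac\<close> at integers are harmless because \<open>g\<close>
  vanishes near both ends of the period. The window reaches \<open>e\<close> to the left of the
  floor of x, so it is a neighbourhood of x even when x is an integer, and on it the periodisation
  is a single integer translate of \<open>g\<close>.\<close>

lemma frac_eq_near:
  fixes g :: rfun
  assumes g0: "\<And>x. x \<notin> {e..1-e} \<Longrightarrow> g x = 0" and "0 < e"
  assumes y: "y \<in> {of_int \<lfloor>x\<rfloor> - e<..<of_int \<lfloor>x\<rfloor> + 1}"
  shows "g (frac y) = g (y - of_int \<lfloor>x\<rfloor>)"
proof (cases "y < of_int \<lfloor>x\<rfloor>")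
  case False
  with y have "\<lfloor>y\<rfloor> = \<lfloor>x\<rfloor>" by (intro floor_unique) auto
  then show ?thesis by (simp add: frac_def)
next
  case True
  with y \<open>0 < e\<close> have neg: "g (y - of_int \<lfloor>x\<rfloor>) = 0" by (intro g0) auto
  show ?thesis
  proof (cases "y < of_int \<lfloor>x\<rfloor> - 1")
    case False
    with True have "\<lfloor>y\<rfloor> = \<lfloor>x\<rfloor> - 1" by (intro floor_unique) auto
    then have "frac y = y - of_int \<lfloor>x\<rfloor> + 1" by (simp add: frac_def)
    with y have "frac y > 1 - e" by auto
    then have "g (frac y) = 0" by (intro g0) auto
    with neg show ?thesis by simp
  next
    \<comment> \<open>Here \<open>e\<close> exceeds 1, so \<open>{e..1-e}\<close> is empty and
      \<open>g\<close> is identically 0.\<close>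
    case T: True
    with y have "e > 1" by auto
    then have "g (frac y) = 0" by (intro g0) auto
    with neg show ?thesis by simp
  qed
qed

text \<open>On the circle, \<open>f\<close> is replaced by its 1-periodic extension \<open>f \<circ> frac\<close>.\<close>

lemma C1_test_extend:
  assumes K: "compact K" "K \<subseteq> {lo d<..<hi d}" "\<And>x. x \<notin> K \<Longrightarrow> f x = 0"
    and cont: "continuous_on UNIV f'" and der: "\<And>x. (f has_real_derivative f' x) (at x)"
  obtains \<psi> \<psi>' where "C1_test d \<psi> \<psi>'" "\<And>x. x \<in> {lo d..<hi d} \<Longrightarrow> \<psi> x = f x \<and> \<psi>' x = f' x"
proof (cases d)
  case (Interval a b)
  have "continuous_on UNIV f"
    using der by (meson DERIV_isCont continuous_at_imp_continuous_on)
  then have "C1_test d f f'"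
    using K cont der unfolding C1_test_def Cc_test_def Interval by auto
  then show ?thesis using that by blast
next
  case Circle
  obtain e where e: "0 < e" "K \<subseteq> {e..1-e}"
  proof (cases "K = {}")
    case False
    obtain s where s: "s \<in> K" "\<forall>t\<in>K. s \<le> t" using compact_attains_inf[OF K(1) False] by auto
    obtain r where r: "r \<in> K" "\<forall>t\<in>K. t \<le> r" using compact_attains_sup[OF K(1) False] by auto
    have "0 < s" "r < 1" using s r K(2) Circle by auto
    then show ?thesis using s r by (intro that[of "min s (1-r)"]) (auto simp: min_le_iff_disj le_diff_eq min_def)
  qed (use that[of 1] in auto)
  have f0: "x \<notin> {e..1-e} \<Longrightarrow> f x = 0" for x using K(3) e by blast
  have f'0: "f' x = 0" if "x \<notin> {e..1-e}" for x
  proof -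
    have op: "open (- {e..1-e})" by (simp add: open_Compl)
    have "(f has_real_derivative 0) (at x)"
      by (rule has_field_derivative_transform_within_open[where f="\<lambda>_. 0", OF _ op])
         (use that f0 in auto)
    then show ?thesis using der DERIV_unique by blast
  qed
  let ?U = "\<lambda>x. {of_int \<lfloor>x\<rfloor> - e<..<of_int \<lfloor>x\<rfloor> + 1 :: real}"
  have xU: "x \<in> ?U x" for x :: real using \<open>0 < e\<close> floor_correct[of x] unfolding greaterThanLessThan_iff by linarith
  have d1: "((\<lambda>x. f (frac x)) has_real_derivative f' (frac x)) (at x)" for x
  proof -
    have "((\<lambda>y. f (y - of_int \<lfloor>x\<rfloor>)) has_real_derivative f' (frac x)) (at x)"
      unfolding frac_def
      by (rule DERIV_cong[OF DERIV_chain2[where f=f and g="\<lambda>y. y - of_int \<lfloor>x\<rfloor>", OF der]])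
         (auto intro!: derivative_eq_intros)
    then show ?thesis
      by (rule has_field_derivative_transform_within_open[where S="?U x"])
         (use xU frac_eq_near[of e f _ x, OF f0 \<open>0<e\<close>] in \<open>auto\<close>)
  qed
  have c1: "continuous_on UNIV (\<lambda>x. f' (frac x))"
  proof (rule continuous_at_imp_continuous_on, intro ballI)
    fix x :: real
    have "isCont (\<lambda>y. f' (y - of_int \<lfloor>x\<rfloor>)) x"
      using cont by (intro continuous_intros isCont_o2[where g=f' and f="\<lambda>y. y - of_int \<lfloor>x\<rfloor>"])
        (auto simp: continuous_on_eq_continuous_at)
    moreover have "\<forall>\<^sub>F y in nhds x. f' (y - of_int \<lfloor>x\<rfloor>) = f' (frac y)"
      unfolding eventually_nhds
      by (rule exI[of _ "?U x"]) (use xU[of x] frac_eq_near[of e f' _ x, OF f'0 \<open>0<e\<close>] in \<open>auto\<close>)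
    ultimately show "isCont (\<lambda>x. f' (frac x)) x"
      using isCont_cong by fast
  qed
  have c0: "continuous_on UNIV (\<lambda>x. f (frac x))"
    using d1 by (meson DERIV_isCont continuous_at_imp_continuous_on)
  have "C1_test d (\<lambda>x. f (frac x)) (\<lambda>x. f' (frac x))"
    unfolding C1_test_def Cc_test_def Circle
    using c0 c1 d1 by (auto simp: frac_1_eq)
  moreover have "frac x = x" if "x \<in> {lo d..<hi d}" for x
    using that Circle by (auto simp: frac_eq)
  ultimately show ?thesis using that by metis
qed

section \<open>C1 approximations of indicators of open intervals\<close>

lemma DERIV_max0_sq: "((\<lambda>x. (max 0 x)\<^sup>2) has_real_derivative 2 * max 0 x) (at (x::real))"
proof (cases "x = 0")
  case True
  have "((\<lambda>h. ((max 0 h)\<^sup>2) / h) \<longlongrightarrow> 0) (at (0::real))"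
  proof (rule Lim_null_comparison[where g="\<lambda>h. \<bar>h\<bar>"])
    show "\<forall>\<^sub>F h in at (0::real). norm ((max 0 h)\<^sup>2 / h) \<le> \<bar>h\<bar>"
      by (auto intro!: always_eventually simp: max_def power2_eq_square)
    show "((\<lambda>h. \<bar>h\<bar>) \<longlongrightarrow> 0) (at (0::real))"
      by (rule tendsto_eq_intros refl | simp)+
  qed
  then show ?thesis using True by (simp add: DERIV_def)
next
  case False
  show ?thesis
  proof (cases "x > 0")
    case True
    have "((\<lambda>x. x\<^sup>2) has_real_derivative 2 * x) (at x)" by (auto intro!: derivative_eq_intros)
    then have "((\<lambda>x. (max 0 x)\<^sup>2) has_real_derivative 2 * x) (at x)"
      by (rule has_field_derivative_transform_within_open[where S="{0<..}"]) (use True in auto)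
    then show ?thesis using True by simp
  next
    case F: False
    have "((\<lambda>x. 0) has_real_derivative 0) (at x)" by simp
    then have "((\<lambda>x. (max 0 x)\<^sup>2) has_real_derivative 0) (at x)"
      by (rule has_field_derivative_transform_within_open[where S="{..<0}"]) (use F False in auto)
    then show ?thesis using F False by simp
  qed
qed

text \<open>The product \<open>b k\<close> of two squared hinges is positive exactly inside the
  interval shrunk by 1/(k+1), hence compactly supported in the domain even if the interval fills it.
  The map from y to ky/(1+ky) keeps values in [0,1], fixes 0 and pushes a positive limit to 1, so
  the indicator appears pointwise while differentiability is kept.\<close>

lemma interval_test_sequence:
  assumes "lo d \<le> p" "q \<le> hi d"
  shows "\<exists>\<psi> \<psi>'. \<forall>k::nat. C1_test d (\<psi> k) (\<psi>' k) \<and> (\<forall>x\<in>dset d. 0 \<le> \<psi> k x \<and> \<psi> k x \<le> 1)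
     \<and> (\<forall>x\<in>dset d. (\<lambda>k. \<psi> k x) \<longlonglongrightarrow> indicator {p<..<q} x)"
proof -
  define b where "b k x = (max 0 (x - (p + 1/real (Suc k))))\<^sup>2 * (max 0 ((q - 1/real (Suc k)) - x))\<^sup>2" for k x
  define b' where "b' k x = 2 * max 0 (x - (p + 1/real (Suc k))) * (max 0 ((q - 1/real (Suc k)) - x))\<^sup>2
     - 2 * (max 0 (x - (p + 1/real (Suc k))))\<^sup>2 * max 0 ((q - 1/real (Suc k)) - x)" for k x
  have b0: "b k x \<ge> 0" for k x by (simp add: b_def)
  have bd: "(b k has_real_derivative b' k x) (at x)" for k x
    unfolding b_def[abs_def] b'_def
    by (rule DERIV_cong[OF DERIV_mult[OF DERIV_chain2[OF DERIV_max0_sq] DERIV_chain2[OF DERIV_max0_sq]]])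
       (auto intro!: derivative_eq_intros simp: algebra_simps)
  define f where "f k x = real k * b k x / (1 + real k * b k x)" for k x
  define f' where "f' k x = real k * b' k x / (1 + real k * b k x)\<^sup>2" for k x
  have pos: "1 + real k * b k x > 0" for k x using b0[of k x] by (simp add: add_pos_nonneg)
  have fd: "(f k has_real_derivative f' k x) (at x)" for k x
  proof -
    have nz: "1 + real k * b k x \<noteq> 0" using pos[of k x] by simp
    have 1: "((\<lambda>x. real k * b k x) has_real_derivative real k * b' k x) (at x)"
      by (rule DERIV_cmult[OF bd])
    have 2: "((\<lambda>x. 1 + real k * b k x) has_real_derivative real k * b' k x) (at x)"
      using DERIV_add[OF DERIV_const[of 1] 1] by simp
    show ?thesis unfolding f_def[abs_def] f'_def
      by (rule DERIV_cong[OF DERIV_divide[OF 1 2 nz]]) (auto simp: field_simps power2_eq_square)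
  qed
  have cont: "continuous_on UNIV (f' k)" for k
  proof -
    have "continuous_on UNIV (b k)" "continuous_on UNIV (b' k)"
      unfolding b_def[abs_def] b'_def[abs_def] by (intro continuous_intros)+
    then show ?thesis unfolding f'_def[abs_def]
      using pos by (intro continuous_intros) (auto simp: less_imp_neq[symmetric])
  qed
  have ex: "\<exists>\<psi> \<psi>'. C1_test d \<psi> \<psi>' \<and> (\<forall>x\<in>{lo d..<hi d}. \<psi> x = f k x \<and> \<psi>' x = f' k x)" for k
  proof -
    have "1 / real (Suc k) > 0" by simp
    then have sub: "{p + 1/real (Suc k)..q - 1/real (Suc k)} \<subseteq> {lo d<..<hi d}"
    proof (intro subsetI)
      fix x assume "x \<in> {p + 1/real (Suc k)..q - 1/real (Suc k)}"
      then have "p + 1/real (Suc k) \<le> x" "x \<le> q - 1/real (Suc k)" by auto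
      then have "lo d < x" "x < hi d" using assms \<open>1 / real (Suc k) > 0\<close> by linarith+
      then show "x \<in> {lo d<..<hi d}" by simp
    qed
    have z: "f k x = 0" if "x \<notin> {p + 1/real (Suc k)..q - 1/real (Suc k)}" for x
    proof -
      have "max 0 (x - (p + 1/real (Suc k))) = 0 \<or> max 0 ((q - 1/real (Suc k)) - x) = 0"
        using that by (auto simp: max_def simp del: of_nat_Suc)
      then have "b k x = 0" unfolding b_def by auto
      then show ?thesis by (simp add: f_def)
    qed
    obtain \<psi> \<psi>' where "C1_test d \<psi> \<psi>'" "\<And>x. x \<in> {lo d..<hi d} \<Longrightarrow> \<psi> x = f k x \<and> \<psi>' x = f' k x"
      using C1_test_extend[OF compact_Icc sub z cont fd] by blast
    then show ?thesis by blast
  qed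
  then obtain \<psi> \<psi>' where psi: "\<And>k. C1_test d (\<psi> k) (\<psi>' k)" 
    "\<And>k x. x \<in> {lo d..<hi d} \<Longrightarrow> \<psi> k x = f k x" by metis
  have lim: "(\<lambda>k. f k x) \<longlonglongrightarrow> indicator {p<..<q} x" for x
  proof (cases "x \<in> {p<..<q}")
    case True
    have i0: "(\<lambda>k. 1 / real (Suc k)) \<longlonglongrightarrow> 0" using LIMSEQ_inverse_real_of_nat by (simp add: inverse_eq_divide)
    have bl: "(\<lambda>k. b k x) \<longlonglongrightarrow> (max 0 (x - (p + 0)))\<^sup>2 * (max 0 ((q - 0) - x))\<^sup>2"
      unfolding b_def by (intro tendsto_intros i0)
    define c where "c = (x - p)\<^sup>2 * (q - x)\<^sup>2"
    have c: "c > 0" using True by (auto simp: c_def)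
    have bl: "(\<lambda>k. b k x) \<longlonglongrightarrow> c" using bl True by (auto simp: c_def max_def)
    have kb: "filterlim (\<lambda>k. b k x * real k) at_top sequentially"
      by (rule filterlim_tendsto_pos_mult_at_top[OF bl c filterlim_real_sequentially])
    have "((\<lambda>k. inverse (1 + real k * b k x)) \<longlonglongrightarrow> 0)"
      by (rule tendsto_inverse_0_at_top)
         (rule filterlim_tendsto_add_at_top[OF tendsto_const], use kb in \<open>simp add: mult.commute\<close>)
    then have "(\<lambda>k. 1 - inverse (1 + real k * b k x)) \<longlonglongrightarrow> 1 - 0" by (intro tendsto_intros)
    moreover have "f k x = 1 - inverse (1 + real k * b k x)" for k
      unfolding f_def using pos[of k x] by (simp add: field_simps)
    ultimately show ?thesis using True by simp
  next
    case False
    have "f k x = 0" for k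
    proof -
      have "1 / real (Suc k) > 0" by simp
      then have "max 0 (x - (p + 1/real (Suc k))) = 0 \<or> max 0 ((q - 1/real (Suc k)) - x) = 0"
        using False unfolding greaterThanLessThan_iff max_def by (smt (verit))
      then have "b k x = 0" unfolding b_def by auto
      then show ?thesis by (simp add: f_def)
    qed
    then show ?thesis using False by simp
  qed
  have rng: "0 \<le> f k x \<and> f k x \<le> 1" for k x
    using pos[of k x] b0[of k x] by (simp add: f_def)
  show ?thesis
    by (rule exI[of _ \<psi>], rule exI[of _ \<psi>'])
       (use psi rng lim dset_subset[of d] in \<open>auto simp: subset_iff\<close>)
qed

section \<open>Density of test functions\<close>

text \<open>The whole domain joins the generators because of the circle: the point 0 lies in no
  interval \<open>{p<..<q}\<close> with p at least 0, and is recovered as a complement.\<close>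

lemma sets_restrict_dset:
  assumes A: "A \<in> sets (bor d)"
  shows "A \<in> sigma_sets (dset d) (insert (dset d) {{p<..<q} | p q. lo d \<le> p \<and> q \<le> hi d})"
    (is "_ \<in> sigma_sets _ ?G")
proof -
  interpret sigma_algebra "dset d" "sigma_sets (dset d) ?G"
    by (rule sigma_algebra_sigma_sets) (use open_subset_dset in fastforce)
  have gen: "{p<..<q} \<in> sigma_sets (dset d) ?G" if "lo d \<le> p" "q \<le> hi d" for p q
    using that by (intro sigma_sets.Basic) auto
  have I: "dset d \<inter> {a<..<b} \<in> sigma_sets (dset d) ?G" for a b
  proof (cases "lo d \<in> dset d \<inter> {a<..<b}")
    case True
    \<comment> \<open>Only the circle reaches this case; the second set is then the single point
      0.\<close>
    have "dset d \<inter> {a<..<b} = {max a (lo d)<..<min b (hi d)} \<union> (dset d - {lo d<..<hi d})"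
      using True by (cases d) auto
    moreover have "\<dots> \<in> sigma_sets (dset d) ?G"
      by (intro Un Diff gen top) auto
    ultimately show ?thesis by simp
  next
    case False
    have "dset d \<inter> {a<..<b} = {max a (lo d)<..<min b (hi d)}"
      using False by (cases d) auto
    moreover have "\<dots> \<in> sigma_sets (dset d) ?G" by (rule gen) auto
    ultimately show ?thesis by simp
  qed
  have borel: "sets borel = sigma_sets (UNIV::real set) (range (\<lambda>(a, b). {a <..< b}))"
    by (subst borel_eq_box) (simp add: sets_measure_of case_prod_unfold)
  then have "sets (bor d) = (\<inter>) (dset d) ` sigma_sets UNIV (range (\<lambda>(a, b). {a <..< b}))"
    by (simp add: sets_restrict_space)
  also have "\<dots> = sigma_sets (dset d) ((\<inter>) (dset d) ` (range (\<lambda>(a, b). {a <..< b})))"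
  proof (rule sigma_sets_Int)
    show "dset d \<in> sigma_sets UNIV (range (\<lambda>(a, b). {a<..<b}))"
      using dset_borel[of d] borel by simp
  qed auto
  also have "\<dots> \<subseteq> sigma_sets (dset d) ?G"
    by (rule sigma_sets_mono) (use I in auto)
  finally show ?thesis using A by blast
qed

lemma C1_test_continuous:
  assumes "C1_test d \<psi> \<psi>'"
  shows "continuous_on UNIV \<psi>" "continuous_on UNIV \<psi>'"
  using assms unfolding C1_test_def Cc_test_def by auto

lemma measurable_restrict_dset_continuous:
  fixes f :: rfun
  assumes "sets M = sets (bor d)" "continuous_on UNIV f"
  shows "f \<in> borel_measurable M"
  using assms
  by (metis borel_measurable_continuous_onI measurable_cong_sets measurable_restrict_space1)

lemma continuous_bounded_dset:
  fixes f :: rfun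
  assumes "continuous_on UNIV f"
  obtains C where "C > 0" "\<And>x. x \<in> {lo d..hi d} \<Longrightarrow> \<bar>f x\<bar> \<le> C"
proof -
  have "compact (f ` {lo d..hi d})"
    using assms by (intro compact_continuous_image continuous_on_subset[OF assms]) auto
  then have "bounded (f ` {lo d..hi d})" by (rule compact_imp_bounded)
  then obtain C where "\<forall>y\<in>f ` {lo d..hi d}. \<bar>y\<bar> \<le> C" "C > 0"
    by (auto simp: bounded_pos)
  then show ?thesis using that by auto
qed

lemma dset_subset_Icc: "x \<in> dset d \<Longrightarrow> x \<in> {lo d..hi d}"
  using dset_subset[of d] by auto

lemma nn_integral_sq_triangle:
  fixes f g h :: "'a \<Rightarrow> real"
  assumes [measurable]: "f \<in> borel_measurable M" "g \<in> borel_measurable M" "h \<in> borel_measurable M"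
  shows "(\<integral>\<^sup>+x. ennreal ((f x - h x)\<^sup>2) \<partial>M)
     \<le> 2 * (\<integral>\<^sup>+x. ennreal ((f x - g x)\<^sup>2) \<partial>M) + 2 * (\<integral>\<^sup>+x. ennreal ((g x - h x)\<^sup>2) \<partial>M)"
proof -
  have "(f x - h x)\<^sup>2 \<le> 2 * (f x - g x)\<^sup>2 + 2 * (g x - h x)\<^sup>2" for x
    using sum_squares_bound[of "f x - g x" "g x - h x"] by (simp add: power2_eq_square algebra_simps)
  then have "ennreal ((f x - h x)\<^sup>2) \<le> ennreal (2 * (f x - g x)\<^sup>2 + 2 * (g x - h x)\<^sup>2)" for x
    by (rule ennreal_leI)
  also have "ennreal (2 * (f x - g x)\<^sup>2 + 2 * (g x - h x)\<^sup>2) = 2 * ennreal ((f x - g x)\<^sup>2) + 2 * ennreal ((g x - h x)\<^sup>2)" for x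
    by (simp add: ennreal_plus ennreal_mult)
  finally have "ennreal ((f x - h x)\<^sup>2) \<le> 2 * ennreal ((f x - g x)\<^sup>2) + 2 * ennreal ((g x - h x)\<^sup>2)" for x .
  then have "(\<integral>\<^sup>+x. ennreal ((f x - h x)\<^sup>2) \<partial>M)
     \<le> (\<integral>\<^sup>+x. 2 * ennreal ((f x - g x)\<^sup>2) + 2 * ennreal ((g x - h x)\<^sup>2) \<partial>M)"
    by (intro nn_integral_mono) auto
  also have "\<dots> = 2 * (\<integral>\<^sup>+x. ennreal ((f x - g x)\<^sup>2) \<partial>M) + 2 * (\<integral>\<^sup>+x. ennreal ((g x - h x)\<^sup>2) \<partial>M)"
    by (subst nn_integral_add) (auto simp: nn_integral_cmult)
  finally show ?thesis .
qed

lemma simple_function_real_representation: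
  fixes f :: "'a \<Rightarrow> real"
  assumes f: "simple_function M f" and x: "x \<in> space M"
  shows "(\<Sum>y\<in>f ` space M. y * indicator (f -` {y} \<inter> space M) x) = f x"
proof -
  have "(\<Sum>y\<in>f ` space M. y * indicator (f -` {y} \<inter> space M) x) = (\<Sum>y\<in>f ` space M. if y = f x then y else 0)"
    using x by (intro sum.cong) (auto simp: indicator_def)
  also have "\<dots> = f x" using x f by (subst sum.delta) (auto simp: simple_function_def)
  finally show ?thesis .
qed

lemma sum_indicator_disjoint_UN:
  fixes A :: "nat \<Rightarrow> 'a set"
  assumes "disjoint_family A"
  shows "(\<Sum>i<k. indicator (A i) x) = (indicator (\<Union>i<k. A i) x :: real)"
proof (cases "x \<in> (\<Union>i<k. A i)")
    case True
    then obtain j where j: "j < k" "x \<in> A j" by auto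
    have "(\<Sum>i<k. 1 * indicator (A i) x) = (1::real)"
      by (rule sum_indicator_disjoint_family[where j=j])
         (use j assms in \<open>auto simp: disjoint_family_on_def\<close>)
    then show ?thesis using True by simp
qed simp

text \<open>Two measures at once, since comparing the masses of two measures needs one test function
  that is close to the sign in both. For a single measure take M = N.\<close>

locale two_measures =
  fixes d :: dom1 and M N :: "real measure"
  assumes valid: "valid_dom d"
    and finM: "finite_measure M" and finN: "finite_measure N"
    and setsM: "sets M = sets (bor d)"
    and setsN: "sets N = sets (bor d)"
begin

lemma spaceM: "space M = dset d" and spaceN: "space N = dset d"
  using sets_eq_imp_space_eq[OF setsM] sets_eq_imp_space_eq[OF setsN]
  by (simp_all add: space_restrict_space)

lemma measN: "f \<in> borel_measurable M \<Longrightarrow> f \<in> borel_measurable N"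
  using setsM setsN measurable_cong_sets by blast

text \<open>Extended-real valued, so that approximation arguments carry no integrability side
  conditions.\<close>

definition qd :: "rfun \<Rightarrow> rfun \<Rightarrow> ennreal" where
  "qd f g = (\<integral>\<^sup>+x. ennreal ((f x - g x)\<^sup>2) \<partial>M) + (\<integral>\<^sup>+x. ennreal ((f x - g x)\<^sup>2) \<partial>N)"

definition approximable :: "rfun \<Rightarrow> bool" where
  "approximable f \<longleftrightarrow> f \<in> borel_measurable M \<and> (\<forall>e>0. \<exists>\<psi> \<psi>'. C1_test d \<psi> \<psi>' \<and> qd \<psi> f < ennreal e)"

lemma qd_cong: "(\<And>x. x \<in> dset d \<Longrightarrow> f x = g x) \<Longrightarrow> (\<And>x. x \<in> dset d \<Longrightarrow> f' x = g' x) \<Longrightarrow> qd f f' = qd g g'"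
  unfolding qd_def by (intro arg_cong2[where f="(+)"] nn_integral_cong) (auto simp: spaceM spaceN)

lemma approximable_cong: "approximable f \<Longrightarrow> (\<And>x. x \<in> dset d \<Longrightarrow> f x = g x) \<Longrightarrow> approximable g"
  unfolding approximable_def using qd_cong[of _ _ f g] measurable_cong[of M f g borel] spaceM by metis

lemma test_meas: "C1_test d \<psi> \<psi>' \<Longrightarrow> \<psi> \<in> borel_measurable M"
  using measurable_restrict_dset_continuous[OF setsM] C1_test_continuous by blast

lemma qd_triangle:
  assumes "f \<in> borel_measurable M" "g \<in> borel_measurable M" "h \<in> borel_measurable M"
  shows "qd f h \<le> 2 * qd f g + 2 * qd g h"
  using add_mono[OF nn_integral_sq_triangle[OF assms] nn_integral_sq_triangle[OF measN[OF assms(1)] measN[OF assms(2)] measN[OF assms(3)]]]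
  unfolding qd_def by (simp add: distrib_left ac_simps)

lemma approximable_lim:
  assumes f: "f \<in> borel_measurable M"
    and "\<And>e. e > 0 \<Longrightarrow> \<exists>g. approximable g \<and> qd g f < ennreal e"
  shows "approximable f"
  unfolding approximable_def
proof (intro conjI allI impI f)
  fix e :: real assume "e > 0"
  then have "e / 4 > 0" by simp
  obtain g where g: "approximable g" "qd g f < ennreal (e/4)" using assms(2)[OF \<open>e/4 > 0\<close>] by blast
  then obtain \<psi> \<psi>' where psi: "C1_test d \<psi> \<psi>'" "qd \<psi> g < ennreal (e/4)"
    using \<open>e/4 > 0\<close> unfolding approximable_def by blast
  have "qd \<psi> f \<le> 2 * qd \<psi> g + 2 * qd g f"
    using psi g f test_meas by (intro qd_triangle) (auto simp: approximable_def)
  also have "\<dots> < 2 * ennreal (e/4) + 2 * ennreal (e/4)"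
    using g psi by (intro add_strict_mono ennreal_mult_strict_left_mono) auto
  also have "\<dots> = ennreal e"
    using \<open>e > 0\<close> by (simp add: ennreal_plus[symmetric] ennreal_mult''[symmetric] del: ennreal_plus flip: ennreal_numeral)
  finally show "\<exists>\<psi> \<psi>'. C1_test d \<psi> \<psi>' \<and> qd \<psi> f < ennreal e" using psi by blast
qed

lemma approximable_test: "C1_test d \<psi> \<psi>' \<Longrightarrow> approximable \<psi>"
  unfolding approximable_def using test_meas
  by (intro conjI allI impI, blast, intro exI[of _ \<psi>] exI[of _ \<psi>']) (auto simp: qd_def)

lemma approximable_cmult:
  assumes "approximable f" shows "approximable (\<lambda>x. c * f x)"
proof (cases "c = 0")
  case True
  then show ?thesis using approximable_test[OF C1_test_zero] by simp
next
  case False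
  show ?thesis unfolding approximable_def
  proof (intro conjI allI impI)
    show "(\<lambda>x. c * f x) \<in> borel_measurable M" using assms by (auto simp: approximable_def)
    fix e :: real assume "e > 0"
    then have "e / c\<^sup>2 > 0" using False by simp
    then obtain \<psi> \<psi>' where psi: "C1_test d \<psi> \<psi>'" "qd \<psi> f < ennreal (e/c\<^sup>2)"
      using assms unfolding approximable_def by blast
    have [measurable]: "\<psi> \<in> borel_measurable M" "f \<in> borel_measurable M" "\<psi> \<in> borel_measurable N" "f \<in> borel_measurable N"
      using test_meas[OF psi(1)] assms measN by (auto simp: approximable_def)
    have *: "ennreal ((c * \<psi> x - c * f x)\<^sup>2) = ennreal (c\<^sup>2) * ennreal ((\<psi> x - f x)\<^sup>2)" for x
      by (simp add: ennreal_mult[symmetric] power_mult_distrib[symmetric] algebra_simps)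
    have "qd (\<lambda>x. c * \<psi> x) (\<lambda>x. c * f x) = ennreal (c\<^sup>2) * qd \<psi> f"
      unfolding qd_def * by (subst nn_integral_cmult, measurable)+ (simp add: distrib_left)
    also have "\<dots> < ennreal (c\<^sup>2) * ennreal (e/c\<^sup>2)"
      using psi False by (intro ennreal_mult_strict_left_mono) auto
    also have "\<dots> = ennreal e" using False \<open>e > 0\<close> by (simp add: ennreal_mult[symmetric])
    finally show "\<exists>\<psi> \<psi>'. C1_test d \<psi> \<psi>' \<and> qd \<psi> (\<lambda>x. c * f x) < ennreal e"
      using C1_test_mult_const[OF psi(1), of c] by blast
  qed
qed

lemma approximable_add:
  assumes "approximable f" "approximable g" shows "approximable (\<lambda>x. f x + g x)"
  unfolding approximable_def
proof (intro conjI allI impI)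
  have [measurable]: "f \<in> borel_measurable M" "g \<in> borel_measurable M"
    using assms by (auto simp: approximable_def)
  show "(\<lambda>x. f x + g x) \<in> borel_measurable M" by measurable
  fix e :: real assume "e > 0"
  then have "e / 4 > 0" by simp
  obtain \<psi> \<psi>' where psi: "C1_test d \<psi> \<psi>'" "qd \<psi> f < ennreal (e/4)"
    using assms(1) \<open>e/4 > 0\<close> unfolding approximable_def by blast
  obtain \<phi> \<phi>' where phi: "C1_test d \<phi> \<phi>'" "qd \<phi> g < ennreal (e/4)"
    using assms(2) \<open>e/4 > 0\<close> unfolding approximable_def by blast
  have [measurable]: "\<psi> \<in> borel_measurable M" "\<phi> \<in> borel_measurable M"
    using test_meas psi phi by auto
  have "qd (\<lambda>x. \<psi> x + \<phi> x) (\<lambda>x. f x + g x) \<le>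
     2 * qd (\<lambda>x. \<psi> x + \<phi> x) (\<lambda>x. f x + \<phi> x) + 2 * qd (\<lambda>x. f x + \<phi> x) (\<lambda>x. f x + g x)"
    by (rule qd_triangle) measurable
  also have "\<dots> = 2 * qd \<psi> f + 2 * qd \<phi> g" by (simp add: qd_def)
  also have "\<dots> < 2 * ennreal (e/4) + 2 * ennreal (e/4)"
    using phi psi by (intro add_strict_mono ennreal_mult_strict_left_mono) auto
  also have "\<dots> = ennreal e"
    using \<open>e > 0\<close> by (simp add: ennreal_plus[symmetric] ennreal_mult''[symmetric] del: ennreal_plus flip: ennreal_numeral)
  finally show "\<exists>\<psi> \<psi>'. C1_test d \<psi> \<psi>' \<and> qd \<psi> (\<lambda>x. f x + g x) < ennreal e"
    using C1_test_add[OF psi(1) phi(1)] by blast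
qed

lemma approximable_sum:
  assumes "finite I" "\<And>i. i \<in> I \<Longrightarrow> approximable (f i)"
  shows "approximable (\<lambda>x. \<Sum>i\<in>I. f i x)"
  using assms
proof (induction I rule: finite_induct)
  case empty
  then show ?case using approximable_test[OF C1_test_zero] by simp
next
  case (insert a I)
  then show ?case using approximable_add[of "f a" "\<lambda>x. \<Sum>i\<in>I. f i x"] by simp
qed

text \<open>The one limiting device behind bumps, countable unions and simple functions.\<close>

lemma approximable_dominated:
  assumes s: "\<And>k. approximable (s k)" and f: "f \<in> borel_measurable M"
    and lim: "\<And>x. x \<in> dset d \<Longrightarrow> (\<lambda>k. s k x) \<longlonglongrightarrow> f x"
    and w: "w \<in> borel_measurable M" "\<And>k x. x \<in> dset d \<Longrightarrow> (s k x - f x)\<^sup>2 \<le> w x"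
       "(\<integral>\<^sup>+x. ennreal (w x) \<partial>M) < \<infinity>" "(\<integral>\<^sup>+x. ennreal (w x) \<partial>N) < \<infinity>"
  shows "approximable f"
proof (rule approximable_lim[OF f])
  fix e :: real assume "e > 0"
  have sm [measurable]: "s k \<in> borel_measurable M" "s k \<in> borel_measurable N" for k
    using s[of k] measN by (auto simp: approximable_def)
  have [measurable]: "f \<in> borel_measurable N" "w \<in> borel_measurable N" using f w measN by auto
  note f[measurable] w(1)[measurable]
  have l: "(\<lambda>k. ennreal ((s k x - f x)\<^sup>2)) \<longlonglongrightarrow> 0" if "x \<in> dset d" for x
  proof -
    have "(\<lambda>k. (s k x - f x)\<^sup>2) \<longlonglongrightarrow> (f x - f x)\<^sup>2" by (intro tendsto_intros lim that)
    then have "(\<lambda>k. ennreal ((s k x - f x)\<^sup>2)) \<longlonglongrightarrow> ennreal ((f x - f x)\<^sup>2)" by (rule tendsto_ennrealI)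
    then show ?thesis by simp
  qed
  have 1: "(\<lambda>k. \<integral>\<^sup>+x. ennreal ((s k x - f x)\<^sup>2) \<partial>M) \<longlonglongrightarrow> (\<integral>\<^sup>+x. 0 \<partial>M)"
    by (rule nn_integral_dominated_convergence[where w="\<lambda>x. ennreal (w x)"])
       (use w l spaceM in \<open>auto intro!: AE_I2 ennreal_leI\<close>)
  have 2: "(\<lambda>k. \<integral>\<^sup>+x. ennreal ((s k x - f x)\<^sup>2) \<partial>N) \<longlonglongrightarrow> (\<integral>\<^sup>+x. 0 \<partial>N)"
    by (rule nn_integral_dominated_convergence[where w="\<lambda>x. ennreal (w x)"])
       (use w l spaceN in \<open>auto intro!: AE_I2 ennreal_leI\<close>)
  have "(\<lambda>k. qd (s k) f) \<longlonglongrightarrow> 0"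
    using tendsto_add[OF 1 2] by (simp add: qd_def)
  then have "\<forall>\<^sub>F k in sequentially. qd (s k) f < ennreal e"
    using \<open>e > 0\<close> by (intro order_tendstoD) auto
  then obtain k where "qd (s k) f < ennreal e" by (auto simp: eventually_sequentially)
  then show "\<exists>g. approximable g \<and> qd g f < ennreal e" using s by blast
qed

lemma finite_const: "(\<integral>\<^sup>+x. ennreal c \<partial>M) < \<infinity>" "(\<integral>\<^sup>+x. ennreal c \<partial>N) < \<infinity>"
  using finite_measure.emeasure_finite[OF finM] finite_measure.emeasure_finite[OF finN]
  by (simp_all add: ennreal_mult_less_top less_top)

text \<open>Induction over disjoint unions from an intersection-stable generator: intervals by
  bumps, complements by subtraction from the domain, countable unions as dominated limits of partial
  sums.\<close>

lemma approximable_indicator: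
  assumes "A \<in> sets M"
  shows "approximable (indicator A)"
proof -
  let ?G = "insert (dset d) {{p<..<q} | p q. lo d \<le> p \<and> q \<le> hi d}"
  have Gsub: "?G \<subseteq> Pow (dset d)" using open_subset_dset[of d] by fastforce
  have IS: "Int_stable ?G"
  proof (rule Int_stableI)
    fix a b assume ab: "a \<in> ?G" "b \<in> ?G"
    consider "a = dset d" | "b = dset d"
      | p q p' q' where "a = {p<..<q}" "b = {p'<..<q'}" "lo d \<le> p" "q \<le> hi d"
      using ab by blast
    then show "a \<inter> b \<in> ?G"
    proof cases
      case 1
      then have "a \<inter> b = b" using Gsub ab by blast
      then show ?thesis using ab by simp
    next
      case 2
      then have "a \<inter> b = a" using Gsub ab by blast
      then show ?thesis using ab by simp
    next
      case 3
      then have "a \<inter> b = {max p p'<..<min q q'}" "lo d \<le> max p p'" "min q q' \<le> hi d" by auto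
      then show ?thesis by blast
    qed
  qed
  have sg: "B \<in> sets M" if "B \<in> sigma_sets (dset d) ?G" for B
  proof -
    have "?G \<subseteq> sets M"
    proof
      fix B assume "B \<in> ?G"
      then have "B \<in> sets borel" "B \<subseteq> dset d" using Gsub by auto
      then show "B \<in> sets M" by (simp add: setsM sets_restrict_space_iff)
    qed
    then have "sigma_sets (dset d) ?G \<subseteq> sets M" using sets.sigma_sets_subset[of ?G M] spaceM by simp
    then show ?thesis using that by blast
  qed
  have int: "approximable (indicator {p<..<q})" if pq: "lo d \<le> p" "q \<le> hi d" for p q
  proof -
    obtain \<psi> \<psi>' where psi: "\<And>k::nat. C1_test d (\<psi> k) (\<psi>' k)" "\<And>k x. x \<in> dset d \<Longrightarrow> 0 \<le> \<psi> k x \<and> \<psi> k x \<le> 1"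
     "\<And>x. x \<in> dset d \<Longrightarrow> (\<lambda>k. \<psi> k x) \<longlonglongrightarrow> indicator {p<..<q} x"
      using interval_test_sequence[OF pq] by metis
    have m: "{p<..<q} \<in> sets M"
      by (rule sg, rule sigma_sets.Basic) (use pq in auto)
    show ?thesis
    proof (rule approximable_dominated[where s=\<psi> and w="\<lambda>_. 1"])
      show "approximable (\<psi> k)" for k using approximable_test[OF psi(1)] .
      show "indicator {p<..<q} \<in> borel_measurable M" using m by simp
      show "(\<psi> k x - indicator {p<..<q} x)\<^sup>2 \<le> 1" if "x \<in> dset d" for k x
        using psi(2)[OF that, of k] by (auto simp: abs_square_le_1 indicator_def)
    qed (use psi(3) finite_const[of 1] in auto)
  qed
  \<comment> \<open>The constant 1 is a test function on the circle only; an interval domain is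
    itself one of the open intervals treated above.\<close>
  have approximable_dset: "approximable (indicator (dset d))"
  proof (cases "d = Circle")
    case True
    have "approximable (\<lambda>x. 1)" by (rule approximable_test) (use True C1_test_one_Circle in simp)
    then show ?thesis by (rule approximable_cong) simp
  next
    case False
    then have "dset d = {lo d<..<hi d}" by (cases d) auto
    then show ?thesis using int[of "lo d" "hi d"] by simp
  qed
  have "A \<in> sigma_sets (dset d) ?G" using sets_restrict_dset[of A d] assms setsM by simp
  then show ?thesis
  proof (induction rule: sigma_sets_induct_disjoint[OF IS Gsub, consumes 1, case_names basic empty compl union])
    case (basic A)
    then show ?case using int approximable_dset by auto
  next
    case empty
    show ?case using approximable_test[OF C1_test_zero] by (rule approximable_cong) simp
  next
    case (compl A)
    have "approximable (\<lambda>x. indicator (dset d) x + (-1) * indicator A x)"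
      using compl approximable_dset by (intro approximable_add approximable_cmult)
    then show ?case by (rule approximable_cong) (auto simp: indicator_def)
  next
    case (union A)
    let ?s = "\<lambda>k x. \<Sum>i<k. indicator (A i) x :: real"
    have s_eq: "?s k x = indicator (\<Union>i<k. A i) x" for k x
      by (rule sum_indicator_disjoint_UN[OF union(1)])
    show ?case
    proof (rule approximable_dominated[where s="?s" and w="\<lambda>_. 1"])
      show "approximable (?s k)" for k by (rule approximable_sum) (use union in auto)
      have "(\<Union>i. A i) \<in> sets M" by (rule sets.countable_UN) (use union(2) sg in blast)
      then show "indicator (\<Union>i. A i) \<in> borel_measurable M" by simp
      show "(\<lambda>k. ?s k x) \<longlonglongrightarrow> indicator (\<Union>i. A i) x" for x
        unfolding s_eq by (rule LIMSEQ_indicator_UN)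
      show "(?s k x - indicator (\<Union>i. A i) x)\<^sup>2 \<le> 1" for k x
        unfolding s_eq by (auto simp: indicator_def)
    qed (use finite_const[of 1] in auto)
  qed
qed

theorem approximable_L2:
  assumes f: "f \<in> borel_measurable M"
    and fin: "(\<integral>\<^sup>+x. ennreal ((f x)\<^sup>2) \<partial>M) < \<infinity>" "(\<integral>\<^sup>+x. ennreal ((f x)\<^sup>2) \<partial>N) < \<infinity>"
  shows "approximable f"
proof -
  note f[measurable]
  have [measurable]: "f \<in> borel_measurable N" by (rule measN[OF f])
  obtain s where s: "\<And>i. simple_function M (s i)" "\<And>x. x \<in> space M \<Longrightarrow> (\<lambda>i. s i x) \<longlonglongrightarrow> f x"
    "\<And>i x. x \<in> space M \<Longrightarrow> dist (s i x) 0 \<le> 2 * dist (f x) 0"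
    using borel_measurable_implies_sequence_metric[OF f, of 0] by metis
  have simple: "approximable (s i)" for i
  proof (rule approximable_cong)
    have fin: "finite (s i ` space M)" using s(1) by (simp add: simple_function_def)
    show "approximable (\<lambda>x. \<Sum>y\<in>s i ` space M. y * indicator (s i -` {y} \<inter> space M) x)"
      by (intro approximable_sum approximable_cmult approximable_indicator fin simple_functionD(2)[OF s(1)])
    show "(\<Sum>y\<in>s i ` space M. y * indicator (s i -` {y} \<inter> space M) x) = s i x" if "x \<in> dset d" for x
      by (rule simple_function_real_representation[OF s(1)]) (use that spaceM in simp)
  qed
  \<comment> \<open>The simple functions satisfy |s| \<le> 2|f|, so |s - f| \<le> 3|f|; hence the
    dominating function with factor 9.\<close>
  show ?thesis
  proof (rule approximable_dominated[where s=s and w="\<lambda>x. 9 * (f x)\<^sup>2"])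
    show "(s k x - f x)\<^sup>2 \<le> 9 * (f x)\<^sup>2" if "x \<in> dset d" for k x
    proof -
      have "\<bar>s k x - f x\<bar> \<le> \<bar>3 * f x\<bar>" using s(3)[of x k] that by (simp add: spaceM)
      then have "\<bar>s k x - f x\<bar>\<^sup>2 \<le> \<bar>3 * f x\<bar>\<^sup>2" by (rule power_mono) simp
      then show ?thesis by (simp add: power_mult_distrib)
    qed
    have *: "ennreal (9 * (f x)\<^sup>2) = 9 * ennreal ((f x)\<^sup>2)" for x by (simp add: ennreal_mult)
    show "(\<integral>\<^sup>+x. ennreal (9 * (f x)\<^sup>2) \<partial>M) < \<infinity>" "(\<integral>\<^sup>+x. ennreal (9 * (f x)\<^sup>2) \<partial>N) < \<infinity>"
      unfolding * using fin by (simp_all add: nn_integral_cmult ennreal_mult_less_top)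
    show "(\<lambda>k. s k x) \<longlonglongrightarrow> f x" if "x \<in> dset d" for x using s(2) that spaceM by simp
    show "(\<lambda>x. 9 * (f x)\<^sup>2) \<in> borel_measurable M" by measurable
  qed (rule simple f)+
qed

end

lemma integrable_bounded_dset:
  assumes "finite_measure M" "sets M = sets (bor d)"
    and "f \<in> borel_measurable M" "\<And>x. x \<in> dset d \<Longrightarrow> \<bar>f x\<bar> \<le> (C::real)"
  shows "integrable M f"
proof -
  have "space M = dset d" using sets_eq_imp_space_eq[OF assms(2)] by (simp add: space_restrict_space)
  then show ?thesis
    using assms by (intro finite_measure.integrable_const_bound[where B=C]) auto
qed

lemma test_bounded:
  assumes "C1_test d \<psi> \<psi>'"
  obtains C where "\<And>x. x \<in> dset d \<Longrightarrow> \<bar>\<psi> x\<bar> \<le> C" "\<And>x. x \<in> dset d \<Longrightarrow> \<bar>\<psi>' x\<bar> \<le> C"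
proof -
  obtain C1 where "\<And>x. x \<in> {lo d..hi d} \<Longrightarrow> \<bar>\<psi> x\<bar> \<le> C1"
    using continuous_bounded_dset[OF C1_test_continuous(1)[OF assms]] by metis
  moreover obtain C2 where "\<And>x. x \<in> {lo d..hi d} \<Longrightarrow> \<bar>\<psi>' x\<bar> \<le> C2"
    using continuous_bounded_dset[OF C1_test_continuous(2)[OF assms]] by metis
  ultimately show ?thesis
    using that[of "max C1 C2"] dset_subset_Icc[of _ d] by (auto simp: le_max_iff_disj)
qed

text \<open>L1 closeness follows from L2 closeness by integrating |y| \<le> \<eta>/2 + y^2/(2\<eta>)
  against a finite measure.\<close>

lemma (in two_measures) test_dense_L1:
  assumes f: "f \<in> borel_measurable M" "\<And>x. x \<in> dset d \<Longrightarrow> \<bar>f x\<bar> \<le> C" and "e > 0"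
  shows "\<exists>\<psi> \<psi>'. C1_test d \<psi> \<psi>' \<and> L1d M \<psi> f \<le> e \<and> L1d N \<psi> f \<le> e"
proof -
  define K where "K = 1 + measure M (dset d) + measure N (dset d)"
  have K: "K \<ge> 1" "measure M (dset d) \<le> K" "measure N (dset d) \<le> K" by (auto simp: K_def)
  \<comment> \<open>With this \<eta> and squared distance below \<open>e * \<eta>\<close>, each of
    the two terms contributes e/2; \<open>K\<close> bounds both masses and is kept away from
    0.\<close>
  define \<eta> where "\<eta> = e / K"
  have eta: "\<eta> > 0" using K \<open>e > 0\<close> by (simp add: \<eta>_def)
  have sq: "(f x)\<^sup>2 \<le> C\<^sup>2" if "x \<in> dset d" for x
    using f(2)[OF that] by (metis abs_ge_zero power2_abs power_mono)
  have "(\<integral>\<^sup>+x. ennreal ((f x)\<^sup>2) \<partial>M) \<le> (\<integral>\<^sup>+x. ennreal (C\<^sup>2) \<partial>M)"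
    by (intro nn_integral_mono ennreal_leI sq) (simp add: spaceM)
  moreover have "(\<integral>\<^sup>+x. ennreal ((f x)\<^sup>2) \<partial>N) \<le> (\<integral>\<^sup>+x. ennreal (C\<^sup>2) \<partial>N)"
    by (intro nn_integral_mono ennreal_leI sq) (simp add: spaceN)
  ultimately have "approximable f"
    using finite_const[of "C\<^sup>2"] by (intro approximable_L2 f(1)) (auto intro: le_less_trans)
  then obtain \<psi> \<psi>' where psi: "C1_test d \<psi> \<psi>'" "qd \<psi> f < ennreal (e * \<eta>)"
    using eta \<open>e > 0\<close> unfolding approximable_def by (meson mult_pos_pos)
  obtain C' where C': "\<And>x. x \<in> dset d \<Longrightarrow> \<bar>\<psi> x\<bar> \<le> C'" using test_bounded[OF psi(1)] by metis
  have main: "L1d Q \<psi> f \<le> e"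
    if Q: "finite_measure Q" "sets Q = sets (bor d)" "measure Q (dset d) \<le> K"
      "(\<integral>\<^sup>+x. ennreal ((\<psi> x - f x)\<^sup>2) \<partial>Q) \<le> qd \<psi> f" for Q
  proof -
    have sp: "space Q = dset d" using sets_eq_imp_space_eq[OF Q(2)] by (simp add: space_restrict_space)
    have [measurable]: "f \<in> borel_measurable Q" using f(1) setsM Q(2) measurable_cong_sets by blast
    have [measurable]: "\<psi> \<in> borel_measurable Q"
      using measurable_restrict_dset_continuous[OF Q(2)] C1_test_continuous psi(1) by blast
    have b: "\<bar>\<psi> x - f x\<bar> \<le> C' + C" if "x \<in> dset d" for x using f(2)[OF that] C'[OF that] by linarith
    have b2: "\<bar>(\<psi> x - f x)\<^sup>2\<bar> \<le> (C' + C)\<^sup>2" if "x \<in> dset d" for x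
      using b[OF that] by (metis abs_ge_zero abs_power2 power2_abs power_mono)
    have i1: "integrable Q (\<lambda>x. \<bar>\<psi> x - f x\<bar>)"
      by (rule integrable_bounded_dset[OF Q(1,2)]) (use b in auto)
    have i2: "integrable Q (\<lambda>x. (\<psi> x - f x)\<^sup>2)"
      by (rule integrable_bounded_dset[OF Q(1,2)]) (use b2 in auto)
    have i3: "integrable Q (\<lambda>x. \<eta> / 2 + (\<psi> x - f x)\<^sup>2 / (2 * \<eta>))"
      using Q(1) i2 by (auto intro!: finite_measure.integrable_const)
    have "ennreal (\<integral>x. (\<psi> x - f x)\<^sup>2 \<partial>Q) = (\<integral>\<^sup>+x. ennreal ((\<psi> x - f x)\<^sup>2) \<partial>Q)"
      by (rule nn_integral_eq_integral[symmetric, OF i2]) auto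
    also have "\<dots> \<le> ennreal (e * \<eta>)" using Q(4) psi(2) by simp
    finally have small: "(\<integral>x. (\<psi> x - f x)\<^sup>2 \<partial>Q) \<le> e * \<eta>"
      using eta \<open>e > 0\<close> by (subst (asm) ennreal_le_iff) auto
    have "\<bar>y\<bar> \<le> \<eta> / 2 + y\<^sup>2 / (2 * \<eta>)" for y
    proof -
      have "0 \<le> (\<eta> - \<bar>y\<bar>)\<^sup>2" by simp
      then have "2 * \<eta> * \<bar>y\<bar> \<le> \<eta>\<^sup>2 + y\<^sup>2" by (simp add: power2_diff)
      then show ?thesis using eta by (simp add: field_simps power2_eq_square)
    qed
    then have "L1d Q \<psi> f \<le> (\<integral>x. \<eta> / 2 + (\<psi> x - f x)\<^sup>2 / (2 * \<eta>) \<partial>Q)"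
      by (intro integral_mono i1 i3)
    also have "\<dots> = \<eta> / 2 * measure Q (dset d) + (\<integral>x. (\<psi> x - f x)\<^sup>2 \<partial>Q) / (2 * \<eta>)"
      using Q(1) i2 by (subst Bochner_Integration.integral_add)
        (auto simp: sp mult.commute intro!: finite_measure.integrable_const)
    also have "\<dots> \<le> \<eta> / 2 * K + (e * \<eta>) / (2 * \<eta>)"
      using small Q(3) eta by (intro add_mono mult_left_mono divide_right_mono) auto
    also have "\<dots> = e" using eta K by (simp add: \<eta>_def field_simps)
    finally show ?thesis .
  qed
  have "L1d M \<psi> f \<le> e" by (rule main[OF finM setsM K(2)]) (simp add: qd_def)
  moreover have "L1d N \<psi> f \<le> e" by (rule main[OF finN setsN K(3)]) (simp add: qd_def)
  ultimately show ?thesis using psi(1) by blast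
qed

section \<open>Functionals dominated by a measure\<close>

text \<open>\<open>is_TV_measure\<close> with its sign \<sigma> made explicit, so that later
  statements can refer to it.\<close>

definition polar :: "dom1 \<Rightarrow> rfun \<Rightarrow> real measure \<Rightarrow> rfun \<Rightarrow> bool" where
  "polar d w \<nu> \<sigma> \<longleftrightarrow> integrable (leb d) w \<and>
     finite_measure \<nu> \<and> sets \<nu> = sets (bor d) \<and>
     \<sigma> \<in> borel_measurable \<nu> \<and> (\<forall>x \<in> space \<nu>. \<bar>\<sigma> x\<bar> = 1) \<and>
        (\<forall>\<phi> \<phi>'. C1_test d \<phi> \<phi>' \<longrightarrow>
           ip d w \<phi>' = - (\<integral>x. \<phi> x * \<sigma> x \<partial>\<nu>))"

lemma is_TV_measure_iff_polar: "is_TV_measure d w \<nu> \<longleftrightarrow> (\<exists>\<sigma>. polar d w \<nu> \<sigma>)"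
  unfolding is_TV_measure_def polar_def Bex_def by simp

lemma polarD:
  assumes "polar d w \<nu> \<sigma>"
  shows "integrable (leb d) w" "finite_measure \<nu>"
    "sets \<nu> = sets (bor d)" "space \<nu> = dset d" "\<sigma> \<in> borel_measurable \<nu>"
    "\<And>x. x \<in> dset d \<Longrightarrow> \<bar>\<sigma> x\<bar> = 1"
    "\<And>\<phi> \<phi>'. C1_test d \<phi> \<phi>' \<Longrightarrow> ip d w \<phi>' = - (\<integral>x. \<phi> x * \<sigma> x \<partial>\<nu>)"
proof -
  note a = assms[unfolded polar_def]
  show s: "sets \<nu> = sets (bor d)" using a by (elim conjE)
  show sp: "space \<nu> = dset d" using sets_eq_imp_space_eq[OF s] by (simp add: space_restrict_space)
  show "integrable (leb d) w" using a by (elim conjE)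
  show "finite_measure \<nu>" using a by (elim conjE)
  show "\<sigma> \<in> borel_measurable \<nu>" using a by (elim conjE)
  show "\<bar>\<sigma> x\<bar> = 1" if "x \<in> dset d" for x using a that unfolding sp by (elim conjE) (erule bspec)
  show "ip d w \<phi>' = - (\<integral>x. \<phi> x * \<sigma> x \<partial>\<nu>)" if "C1_test d \<phi> \<phi>'" for \<phi> \<phi>'
    using a that by (elim conjE) (erule allE, erule allE, erule mp)
qed

text \<open>Since \<^const>\<open>TV\<close> picks a measure with \<^const>\<open>Eps\<close>, upper bounds for it need this for an arbitrary \<open>\<nu>\<close>.\<close>

lemma tv_mass_le:
  assumes valid: "valid_dom d" and tv: "is_TV_measure d w \<nu>"
    and rho: "finite_measure \<rho>" "sets \<rho> = sets (bor d)"
    and bound: "\<And>\<psi> \<psi>'. C1_test d \<psi> \<psi>' \<Longrightarrow> \<bar>ip d w \<psi>'\<bar> \<le> (\<integral>x. \<bar>\<psi> x\<bar> \<partial>\<rho>)"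
  shows "measure \<nu> (dset d) \<le> measure \<rho> (dset d)"
proof (rule field_le_epsilon)
  fix e :: real assume "e > 0"
  obtain \<sigma> where pol: "polar d w \<nu> \<sigma>" using tv unfolding is_TV_measure_iff_polar by (rule exE)
  note nu = polarD(2,3,4)[OF pol] and sig = polarD(5,6)[OF pol] and dual = polarD(7)[OF pol]
  interpret two_measures d \<nu> \<rho> using valid nu rho by (intro two_measures.intro)
  note sg1 = sig(2)
  \<comment> \<open>\<sigma> is approximated in \<nu>, where pairing with it recovers the mass, and
    in \<rho>, where closeness to a function of modulus 1 keeps the integral of |\<psi>| below the
    mass of \<rho> up to e/2.\<close>
  obtain \<psi> \<psi>' where psi: "C1_test d \<psi> \<psi>'" "L1d \<nu> \<psi> \<sigma> \<le> e/2" "L1d \<rho> \<psi> \<sigma> \<le> e/2"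
    using test_dense_L1[of \<sigma> 1 "e/2"] sig(1) sg1 \<open>e > 0\<close> by auto
  obtain C where C: "\<And>x. x \<in> dset d \<Longrightarrow> \<bar>\<psi> x\<bar> \<le> C" using test_bounded[OF psi(1)] by metis
  have m [measurable]: "\<psi> \<in> borel_measurable \<nu>" "\<psi> \<in> borel_measurable \<rho>" "\<sigma> \<in> borel_measurable \<nu>" "\<sigma> \<in> borel_measurable \<rho>"
    using test_meas[OF psi(1)] sig(1) measN by auto
  have b: "\<bar>\<psi> x - \<sigma> x\<bar> \<le> C + 1" "\<bar>\<psi> x * \<sigma> x\<bar> \<le> C" "\<bar>\<sigma> x\<bar> \<le> 1" if "x \<in> dset d" for x
    using C[OF that] sg1[OF that] by (auto simp: abs_mult)
  have i: "integrable \<nu> (\<lambda>x. \<bar>\<psi> x - \<sigma> x\<bar>)" "integrable \<nu> (\<lambda>x. \<psi> x * \<sigma> x)"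
    by (rule integrable_bounded_dset[OF nu(1,2)]; use b in auto)+
  have ir: "integrable \<rho> (\<lambda>x. \<bar>\<psi> x - \<sigma> x\<bar>)" "integrable \<rho> (\<lambda>x. \<bar>\<psi> x\<bar>)"
    by (rule integrable_bounded_dset[OF rho]; use b C in auto)+
  have "measure \<nu> (dset d) = (\<integral>x. 1 \<partial>\<nu>)" by (simp add: spaceM)
  \<comment> \<open>As \<sigma> is 1 or -1, 1 - \<psi>\<sigma> = \<sigma>(\<sigma> - \<psi>) is at
    most |\<psi> - \<sigma>|.\<close>
  also have "\<dots> \<le> (\<integral>x. \<psi> x * \<sigma> x + \<bar>\<psi> x - \<sigma> x\<bar> \<partial>\<nu>)"
  proof (rule integral_mono)
    fix x assume "x \<in> space \<nu>"
    then have "\<sigma> x = 1 \<or> \<sigma> x = -1" using sig(2)[of x] spaceM by auto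
    then show "1 \<le> \<psi> x * \<sigma> x + \<bar>\<psi> x - \<sigma> x\<bar>" by auto
  qed (use i nu in \<open>auto intro!: finite_measure.integrable_const\<close>)
  also have "\<dots> = (\<integral>x. \<psi> x * \<sigma> x \<partial>\<nu>) + L1d \<nu> \<psi> \<sigma>"
    by (rule Bochner_Integration.integral_add) (use i in auto)
  also have "\<dots> \<le> (\<integral>x. \<bar>\<psi> x\<bar> \<partial>\<rho>) + e / 2"
    using bound[OF psi(1)] dual[OF psi(1)] psi(2) by linarith
  also have "(\<integral>x. \<bar>\<psi> x\<bar> \<partial>\<rho>) \<le> (\<integral>x. 1 + \<bar>\<psi> x - \<sigma> x\<bar> \<partial>\<rho>)"
  proof (rule integral_mono)
    fix x assume "x \<in> space \<rho>"
    then show "\<bar>\<psi> x\<bar> \<le> 1 + \<bar>\<psi> x - \<sigma> x\<bar>" using sg1[of x] spaceN by simp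
  qed (use ir rho in \<open>auto intro!: finite_measure.integrable_const\<close>)
  also have "\<dots> = measure \<rho> (dset d) + L1d \<rho> \<psi> \<sigma>"
    using ir rho by (subst Bochner_Integration.integral_add) (auto intro!: finite_measure.integrable_const simp: spaceN)
  finally show "measure \<nu> (dset d) \<le> measure \<rho> (dset d) + e" using psi(3) by simp
qed

lemma continuous_measurable_lebesgue_on:
  fixes f :: rfun
  shows "continuous_on UNIV f \<Longrightarrow> f \<in> borel_measurable (lebesgue_on S)"
  by (intro measurable_restrict_space1 measurable_completion) (simp add: borel_measurable_continuous_onI)

text \<open>\<open>bound\<close> says that the distribution Dw is 1-Lipschitz for the L1 seminorm of
  \<rho>. Test functions are dense there, so Dw extends to bounded measurable functions and turns
  out to be a density times \<rho>.\<close>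

locale dominated_functional =
  fixes d :: dom1 and w :: rfun and \<rho> :: "real measure"
  assumes valid: "valid_dom d" and w: "integrable (leb d) w"
    and rho: "finite_measure \<rho>" and sets_rho: "sets \<rho> = sets (bor d)"
    and bound: "\<And>\<psi> \<psi>'. C1_test d \<psi> \<psi>' \<Longrightarrow> \<bar>ip d w \<psi>'\<bar> \<le> (\<integral>x. \<bar>\<psi> x\<bar> \<partial>\<rho>)"
begin

interpretation two_measures d \<rho> \<rho>
  using valid rho sets_rho by (intro two_measures.intro)

text \<open>The pairing of Dw with \<psi>, taking the derivative as its argument; that it depends
  only on \<psi>, and continuously so, is \<open>ell_diff\<close>.\<close>

definition ell :: "rfun \<Rightarrow> real" where
  "ell \<psi>' = - ip d w \<psi>'"

text \<open>Bounded rather than integrable: sums, multiples and indicators stay inside the class,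
  and integrability against the finite \<rho> is automatic.\<close>

definition bm :: "rfun \<Rightarrow> bool" where
  "bm f \<longleftrightarrow> f \<in> borel_measurable \<rho> \<and> (\<exists>C. \<forall>x\<in>dset d. \<bar>f x\<bar> \<le> C)"

lemma bm_test: "C1_test d \<psi> \<psi>' \<Longrightarrow> bm \<psi>"
  unfolding bm_def using test_meas test_bounded by metis

lemma bm_add: assumes "bm f" "bm g" shows "bm (\<lambda>x. f x + g x)"
proof -
  from assms obtain C D where b: "\<forall>x\<in>dset d. \<bar>f x\<bar> \<le> C" "\<forall>x\<in>dset d. \<bar>g x\<bar> \<le> D"
    unfolding bm_def by auto
  have "\<forall>x\<in>dset d. \<bar>f x + g x\<bar> \<le> C + D"
  proof
    fix x assume "x \<in> dset d"
    then show "\<bar>f x + g x\<bar> \<le> C + D" using b abs_triangle_ineq[of "f x" "g x"] by fastforce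
  qed
  then show ?thesis using assms unfolding bm_def by auto
qed

lemma bm_cmult: assumes "bm f" shows "bm (\<lambda>x. c * f x)"
proof -
  from assms obtain C where b: "\<forall>x\<in>dset d. \<bar>f x\<bar> \<le> C"
    unfolding bm_def by auto
  have "\<forall>x\<in>dset d. \<bar>c * f x\<bar> \<le> \<bar>c\<bar> * C"
    using b by (auto simp: abs_mult intro: mult_left_mono)
  then show ?thesis using assms unfolding bm_def by auto
qed

lemma bm_sum: "finite I \<Longrightarrow> (\<And>i. i \<in> I \<Longrightarrow> bm (f i)) \<Longrightarrow> bm (\<lambda>x. \<Sum>i\<in>I. f i x)"
proof (induction I rule: finite_induct)
  case empty
  show ?case by (auto simp: bm_def intro!: exI[of _ 0])
next
  case (insert a I)
  then show ?case using bm_add[of "f a" "\<lambda>x. \<Sum>i\<in>I. f i x"] by simp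
qed

lemma bm_diff: "bm f \<Longrightarrow> bm g \<Longrightarrow> bm (\<lambda>x. f x - g x)"
  using bm_add[of f "\<lambda>x. (-1) * g x"] bm_cmult[of g "-1"] by simp

lemma bm_indicator: "B \<in> sets \<rho> \<Longrightarrow> bm (indicator B)"
  unfolding bm_def by (auto intro!: exI[of _ 1] simp: indicator_def)

lemma bm_integrable: "bm f \<Longrightarrow> integrable \<rho> f"
  unfolding bm_def using integrable_bounded_dset[OF rho sets_rho] by blast

lemma bm_integrable_abs_diff: "bm f \<Longrightarrow> bm g \<Longrightarrow> integrable \<rho> (\<lambda>x. \<bar>f x - g x\<bar>)"
  using bm_integrable[OF bm_diff] by (intro integrable_abs)

lemma L1_triangle:
  assumes "bm f" "bm g" "bm h"
  shows "L1d \<rho> f h \<le> L1d \<rho> f g + L1d \<rho> g h"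
proof -
  have "L1d \<rho> f h \<le> (\<integral>x. \<bar>f x - g x\<bar> + \<bar>g x - h x\<bar> \<partial>\<rho>)"
    by (rule integral_mono) (use assms bm_integrable_abs_diff in auto)
  then show ?thesis
    using assms bm_integrable_abs_diff by simp
qed

lemma L1_sym: "L1d \<rho> f h = L1d \<rho> h f" for f h :: rfun
  by (simp add: abs_minus_commute)

lemma integrable_mult_test:
  assumes "C1_test d \<psi> \<psi>'"
  shows "integrable (leb d) (\<lambda>x. w x * \<psi>' x)"
proof -
  obtain C where C: "\<And>x. x \<in> dset d \<Longrightarrow> \<bar>\<psi>' x\<bar> \<le> C" using test_bounded[OF assms] by metis
  have m [measurable]: "\<psi>' \<in> borel_measurable (leb d)"
    using C1_test_continuous(2)[OF assms] by (rule continuous_measurable_lebesgue_on)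
  show ?thesis
  proof (rule Bochner_Integration.integrable_bound)
    show "integrable (leb d) (\<lambda>x. \<bar>C\<bar> * \<bar>w x\<bar>)"
      using w by (intro integrable_mult_right integrable_abs)
    have "\<bar>w x\<bar> * \<bar>\<psi>' x\<bar> \<le> \<bar>C\<bar> * \<bar>w x\<bar>" if "x \<in> dset d" for x
      using C[OF that] by (subst mult.commute, intro mult_right_mono) auto
    then show "AE x in leb d. norm (w x * \<psi>' x) \<le> norm (\<bar>C\<bar> * \<bar>w x\<bar>)"
      by (intro AE_I2) (simp add: abs_mult)
    show "(\<lambda>x. w x * \<psi>' x) \<in> borel_measurable (leb d)"
      using w by (intro borel_measurable_times m) auto
  qed
qed

lemma ell_add: "C1_test d \<psi> \<psi>' \<Longrightarrow> C1_test d \<phi> \<phi>' \<Longrightarrow> ell (\<lambda>x. \<psi>' x + \<phi>' x) = ell \<psi>' + ell \<phi>'"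
  unfolding ell_def by (simp add: distrib_left integrable_mult_test)

lemma ell_cmult: "ell (\<lambda>x. c * \<psi>' x) = c * ell \<psi>'"
proof -
  have "(\<lambda>x. w x * (c * \<psi>' x)) = (\<lambda>x. c * (w x * \<psi>' x))" by (simp add: ac_simps)
  then show ?thesis unfolding ell_def by simp
qed

lemma ell_diff:
  assumes "C1_test d \<psi> \<psi>'" "C1_test d \<phi> \<phi>'"
  shows "\<bar>ell \<psi>' - ell \<phi>'\<bar> \<le> L1d \<rho> \<psi> \<phi>"
proof -
  have "ell \<psi>' - ell \<phi>' = ell (\<lambda>x. \<psi>' x + (-1) * \<phi>' x)"
    using ell_add[OF assms(1) C1_test_mult_const[OF assms(2), of "-1"]] ell_cmult[of "-1" \<phi>'] by simp
  then show ?thesis using bound[OF C1_test_diff[OF assms]] by (simp add: ell_def)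
qed

text \<open>Along test functions approximating f in L1, the values of \<open>ell\<close> are Cauchy
  by \<open>ell_diff\<close>. Demanding the estimate against all test functions at once pins c down,
  which is why every property of \<open>Ext\<close> can be derived from it.\<close>

lemma extension_exists:
  assumes "bm f"
  shows "\<exists>c. \<forall>\<psi> \<psi>'. C1_test d \<psi> \<psi>' \<longrightarrow> \<bar>c - ell \<psi>'\<bar> \<le> L1d \<rho> f \<psi>"
proof -
  from assms obtain C where "f \<in> borel_measurable \<rho>" "\<And>x. x \<in> dset d \<Longrightarrow> \<bar>f x\<bar> \<le> C"
    unfolding bm_def by auto
  note dense = test_dense_L1[OF this]
  have "\<forall>k::nat. \<exists>\<psi> \<psi>'. C1_test d \<psi> \<psi>' \<and> L1d \<rho> \<psi> f \<le> 1 / real (Suc k)"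
  proof
    fix k :: nat
    have "1 / real (Suc k) > 0" by simp
    from dense[OF _ this] show "\<exists>\<psi> \<psi>'. C1_test d \<psi> \<psi>' \<and> L1d \<rho> \<psi> f \<le> 1 / real (Suc k)"
      by simp
  qed
  then obtain \<psi> \<psi>' where psi: "\<And>k. C1_test d (\<psi> k) (\<psi>' k)"
    "\<And>k::nat. (\<integral>x. \<bar>\<psi> k x - f x\<bar> \<partial>\<rho>) \<le> 1 / real (Suc k)" by metis
  have i0: "(\<lambda>k. 1 / real (Suc k)) \<longlonglongrightarrow> 0" using LIMSEQ_inverse_real_of_nat by (simp add: inverse_eq_divide)
  have close: "\<bar>ell (\<psi>' k) - ell \<phi>'\<bar> \<le> 1 / real (Suc k) + L1d \<rho> f \<phi>"
    if "C1_test d \<phi> \<phi>'" for k \<phi> \<phi>'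
    using ell_diff[OF psi(1)[of k] that] L1_triangle[OF bm_test[OF psi(1)[of k]] assms bm_test[OF that]] psi(2)[of k] by linarith
  have "Cauchy (\<lambda>k. ell (\<psi>' k))"
  proof (rule CauchyI)
    fix e :: real assume "e > 0"
    then have "\<forall>\<^sub>F k in sequentially. 1 / real (Suc k) < e/2" using i0 by (intro order_tendstoD) auto
    then obtain K where K: "\<And>k. k \<ge> K \<Longrightarrow> 1 / real (Suc k) < e/2" by (auto simp: eventually_sequentially)
    show "\<exists>K. \<forall>m\<ge>K. \<forall>n\<ge>K. norm (ell (\<psi>' m) - ell (\<psi>' n)) < e"
    proof (intro exI allI impI)
      fix m n assume "m \<ge> K" "n \<ge> K"
      then show "norm (ell (\<psi>' m) - ell (\<psi>' n)) < e"
        using close[OF psi(1)[of n], of m] psi(2)[of n] L1_sym[of "\<psi> n" f] K[of m] K[of n] by simp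
    qed
  qed
  then obtain c where c: "(\<lambda>k. ell (\<psi>' k)) \<longlonglongrightarrow> c"
    using Cauchy_convergent convergent_def by blast
  have "\<bar>c - ell \<phi>'\<bar> \<le> L1d \<rho> f \<phi>" if "C1_test d \<phi> \<phi>'" for \<phi> \<phi>'
  proof (rule LIMSEQ_le)
    show "(\<lambda>k. \<bar>ell (\<psi>' k) - ell \<phi>'\<bar>) \<longlonglongrightarrow> \<bar>c - ell \<phi>'\<bar>" by (intro tendsto_intros c)
    show "(\<lambda>k. 1 / real (Suc k) + L1d \<rho> f \<phi>) \<longlonglongrightarrow> L1d \<rho> f \<phi>"
      using tendsto_add[OF i0 tendsto_const] by simp
    show "\<exists>N. \<forall>k\<ge>N. \<bar>ell (\<psi>' k) - ell \<phi>'\<bar> \<le> 1 / real (Suc k) + L1d \<rho> f \<phi>"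
      using close[OF that] by blast
  qed
  then show ?thesis by blast
qed

section \<open>Extension of Dw to bounded measurable functions\<close>

definition Ext :: "rfun \<Rightarrow> real" where
  "Ext f = (SOME c. \<forall>\<psi> \<psi>'. C1_test d \<psi> \<psi>' \<longrightarrow> \<bar>c - ell \<psi>'\<bar> \<le> L1d \<rho> f \<psi>)"

lemma Ext_close:
  assumes "bm f" "C1_test d \<psi> \<psi>'"
  shows "\<bar>Ext f - ell \<psi>'\<bar> \<le> L1d \<rho> f \<psi>"
  using someI_ex[OF extension_exists[OF assms(1)], folded Ext_def] assms(2) by simp

lemma Ext_bound: "bm f \<Longrightarrow> \<bar>Ext f\<bar> \<le> (\<integral>x. \<bar>f x\<bar> \<partial>\<rho>)"
  using Ext_close[OF _ C1_test_zero, of f] by (simp add: ell_def)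

lemma Ext_test: "C1_test d \<psi> \<psi>' \<Longrightarrow> Ext \<psi> = ell \<psi>'"
  using Ext_close[OF bm_test, of \<psi> \<psi>' \<psi> \<psi>'] by simp

lemma bm_approx:
  assumes "bm f" "e > 0"
  obtains \<psi> \<psi>' where "C1_test d \<psi> \<psi>'" "L1d \<rho> f \<psi> \<le> e"
proof -
  from assms(1) obtain C where C: "f \<in> borel_measurable \<rho>" "\<And>x. x \<in> dset d \<Longrightarrow> \<bar>f x\<bar> \<le> C"
    unfolding bm_def by auto
  obtain \<psi> \<psi>' where "C1_test d \<psi> \<psi>'" "L1d \<rho> \<psi> f \<le> e"
    using test_dense_L1[OF C assms(2)] by auto
  then show ?thesis using that[of \<psi> \<psi>'] L1_sym[of \<psi> f] by simp
qed

text \<open>\<open>Ext\<close> is a choice, so additivity is not built in: both arguments are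
  approximated by test functions, where \<open>ell\<close> is additive, and the error is made
  arbitrarily small.\<close>

lemma Ext_add:
  assumes f: "bm f" and g: "bm g"
  shows "Ext (\<lambda>x. f x + g x) = Ext f + Ext g"
proof -
  have "\<bar>Ext (\<lambda>x. f x + g x) - (Ext f + Ext g)\<bar> \<le> 0 + e" if "e > 0" for e
  proof -
    have e4: "e / 4 > 0" using that by simp
    obtain \<psi> \<psi>' where psi: "C1_test d \<psi> \<psi>'" "L1d \<rho> f \<psi> \<le> e/4" by (rule bm_approx[OF f e4])
    obtain \<phi> \<phi>' where phi: "C1_test d \<phi> \<phi>'" "L1d \<rho> g \<phi> \<le> e/4" by (rule bm_approx[OF g e4])
    have "(\<integral>x. \<bar>f x + g x - (\<psi> x + \<phi> x)\<bar> \<partial>\<rho>) \<le> (\<integral>x. \<bar>f x - \<psi> x\<bar> + \<bar>g x - \<phi> x\<bar> \<partial>\<rho>)"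
      using bm_integrable_abs_diff[OF f bm_test[OF psi(1)]] bm_integrable_abs_diff[OF g bm_test[OF phi(1)]]
        bm_integrable_abs_diff[OF bm_add[OF f g] bm_test[OF C1_test_add[OF psi(1) phi(1)]]]
      by (intro integral_mono Bochner_Integration.integrable_add) auto
    also have "\<dots> \<le> e/4 + e/4"
      using bm_integrable_abs_diff[OF f bm_test[OF psi(1)]] bm_integrable_abs_diff[OF g bm_test[OF phi(1)]] psi(2) phi(2)
      by (subst Bochner_Integration.integral_add) auto
    finally have "\<bar>Ext (\<lambda>x. f x + g x) - (ell \<psi>' + ell \<phi>')\<bar> \<le> e/4 + e/4"
      using Ext_close[OF bm_add[OF f g] C1_test_add[OF psi(1) phi(1)]] ell_add[OF psi(1) phi(1)] by simp
    moreover have "\<bar>Ext f - ell \<psi>'\<bar> \<le> e/4" "\<bar>Ext g - ell \<phi>'\<bar> \<le> e/4"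
      using Ext_close[OF f psi(1)] Ext_close[OF g phi(1)] psi phi by linarith+
    ultimately show ?thesis by linarith
  qed
  then have "\<bar>Ext (\<lambda>x. f x + g x) - (Ext f + Ext g)\<bar> \<le> 0" by (rule field_le_epsilon)
  then show ?thesis by simp
qed

lemma Ext_cmult:
  assumes f: "bm f"
  shows "Ext (\<lambda>x. c * f x) = c * Ext f"
proof -
  have "\<bar>Ext (\<lambda>x. c * f x) - c * Ext f\<bar> \<le> 0 + e" if "e > 0" for e
  proof -
    have e4: "e / (2 * (1 + \<bar>c\<bar>)) > 0" using that by (simp add: add_pos_nonneg)
    obtain \<psi> \<psi>' where psi: "C1_test d \<psi> \<psi>'" "L1d \<rho> f \<psi> \<le> e / (2 * (1 + \<bar>c\<bar>))" by (rule bm_approx[OF f e4])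
    have "(\<integral>x. \<bar>c * f x - c * \<psi> x\<bar> \<partial>\<rho>) = \<bar>c\<bar> * L1d \<rho> f \<psi>"
      by (simp add: right_diff_distrib[symmetric] abs_mult)
    then have 1: "\<bar>Ext (\<lambda>x. c * f x) - c * ell \<psi>'\<bar> \<le> \<bar>c\<bar> * L1d \<rho> f \<psi>"
      using Ext_close[OF bm_cmult[OF f, of c] C1_test_mult_const[OF psi(1), of c]] ell_cmult[of c \<psi>'] by simp
    have 2: "\<bar>c * ell \<psi>' - c * Ext f\<bar> \<le> \<bar>c\<bar> * L1d \<rho> f \<psi>"
      using mult_left_mono[OF Ext_close[OF f psi(1)], of "\<bar>c\<bar>"]
      by (simp add: right_diff_distrib[symmetric] abs_mult abs_minus_commute)
    have "\<bar>c\<bar> * L1d \<rho> f \<psi> \<le> (1 + \<bar>c\<bar>) * (e / (2 * (1 + \<bar>c\<bar>)))"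
      using psi(2) by (intro mult_mono) auto
    also have "\<dots> = e / 2"
    proof -
      have "1 + \<bar>c\<bar> \<noteq> 0" by linarith
      then show ?thesis by (simp add: field_simps)
    qed
    finally show ?thesis using 1 2 by linarith
  qed
  then have "\<bar>Ext (\<lambda>x. c * f x) - c * Ext f\<bar> \<le> 0" by (rule field_le_epsilon)
  then show ?thesis by simp
qed

lemma Ext_zero: "Ext (\<lambda>x. 0) = 0"
  using Ext_test[OF C1_test_zero] by (simp add: ell_def)

lemma Ext_sum: "finite I \<Longrightarrow> (\<And>i. i \<in> I \<Longrightarrow> bm (f i)) \<Longrightarrow> Ext (\<lambda>x. \<Sum>i\<in>I. f i x) = (\<Sum>i\<in>I. Ext (f i))"
proof (induction I rule: finite_induct)
  case empty
  show ?case by (simp add: Ext_zero)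
next
  case (insert a I)
  then show ?case using Ext_add[of "f a" "\<lambda>x. \<Sum>i\<in>I. f i x"] bm_sum[of I f] by simp
qed

lemma Ext_diff: 
  assumes "bm f" "bm g" shows "\<bar>Ext f - Ext g\<bar> \<le> L1d \<rho> f g"
proof -
  have "Ext (\<lambda>x. f x + (-1) * g x) = Ext f - Ext g"
    using Ext_add[OF assms(1) bm_cmult[OF assms(2), of "-1"]] Ext_cmult[OF assms(2), of "-1"] by simp
  then show ?thesis using Ext_bound[OF bm_diff[OF assms]] by simp
qed

lemma L1_dominated:
  assumes "\<And>k. bm (s k)" "bm f" "\<And>x. x \<in> dset d \<Longrightarrow> (\<lambda>k. s k x) \<longlonglongrightarrow> f x"
    and "\<And>k x. x \<in> dset d \<Longrightarrow> \<bar>s k x - f x\<bar> \<le> C"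
  shows "(\<lambda>k. \<integral>x. \<bar>f x - s k x\<bar> \<partial>\<rho>) \<longlonglongrightarrow> 0"
proof -
  have "(\<lambda>k. \<integral>x. \<bar>f x - s k x\<bar> \<partial>\<rho>) \<longlonglongrightarrow> (\<integral>x. 0 \<partial>\<rho>)"
  proof (rule integral_dominated_convergence[where w="\<lambda>_. C"])
    show "(\<lambda>x. \<bar>f x - s k x\<bar>) \<in> borel_measurable \<rho>" for k
      using bm_integrable_abs_diff[OF assms(2) assms(1)[of k]] by auto
    show "integrable \<rho> (\<lambda>_. C)" using rho by (rule finite_measure.integrable_const)
    show "AE x in \<rho>. (\<lambda>k. \<bar>f x - s k x\<bar>) \<longlonglongrightarrow> 0"
    proof (rule AE_I2)
      fix x assume "x \<in> space \<rho>"
      then have "(\<lambda>k. \<bar>f x - s k x\<bar>) \<longlonglongrightarrow> \<bar>f x - f x\<bar>"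
        using assms(3) spaceM by (intro tendsto_intros) auto
      then show "(\<lambda>k. \<bar>f x - s k x\<bar>) \<longlonglongrightarrow> 0" by simp
    qed
    show "AE x in \<rho>. norm \<bar>f x - s k x\<bar> \<le> C" for k
      using assms(4) spaceM by (intro AE_I2) (simp add: abs_minus_commute)
  qed simp
  then show ?thesis by simp
qed

lemma Ext_lim:
  assumes "\<And>k. bm (s k)" "bm f" "\<And>x. x \<in> dset d \<Longrightarrow> (\<lambda>k. s k x) \<longlonglongrightarrow> f x"
    and "\<And>k x. x \<in> dset d \<Longrightarrow> \<bar>s k x - f x\<bar> \<le> C"
  shows "(\<lambda>k. Ext (s k)) \<longlonglongrightarrow> Ext f"
proof -
  have "(\<lambda>k. Ext (s k) - Ext f) \<longlonglongrightarrow> 0"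
  proof (rule Lim_null_comparison[OF _ L1_dominated[OF assms]])
    show "\<forall>\<^sub>F k in sequentially. norm (Ext (s k) - Ext f) \<le> (\<integral>x. \<bar>f x - s k x\<bar> \<partial>\<rho>)"
      using Ext_diff[OF assms(1) assms(2)] by (auto simp: L1_sym)
  qed
  then show ?thesis by (rule LIM_zero_cancel)
qed

text \<open>Adding \<open>\<rho>\<close> makes the extension positive, so that Radon-Nikodym applies.\<close>

definition shifted_mass :: "real set \<Rightarrow> real" where
  "shifted_mass B = Ext (indicator B) + measure \<rho> B"

lemma Ext_indicator_bound: "B \<in> sets \<rho> \<Longrightarrow> \<bar>Ext (indicator B)\<bar> \<le> measure \<rho> B"
  using Ext_bound[OF bm_indicator, of B] sets.sets_into_space[of B \<rho>] by (simp add: Int_absorb2)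

lemma shifted_mass_bounds: "B \<in> sets \<rho> \<Longrightarrow> 0 \<le> shifted_mass B" "B \<in> sets \<rho> \<Longrightarrow> shifted_mass B \<le> 2 * measure \<rho> B"
  using Ext_indicator_bound[of B] by (auto simp: shifted_mass_def)

text \<open>L1 continuity of \<open>Ext\<close> along the partial unions is what gives countable
  additivity.\<close>

lemma shifted_mass_sums:
  assumes "range A \<subseteq> sets \<rho>" "disjoint_family A"
  shows "(\<lambda>i. shifted_mass (A i)) sums shifted_mass (\<Union>i. A i)"
proof -
  have Am: "A i \<in> sets \<rho>" for i using assms by auto
  have UA: "(\<Union>i. A i) \<in> sets \<rho>" using Am by auto
  let ?s = "\<lambda>k x. \<Sum>i<k. indicator (A i) x :: real"
  have s_eq: "?s k x = indicator (\<Union>i<k. A i) x" for k x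
    by (rule sum_indicator_disjoint_UN[OF assms(2)])
  have "(\<lambda>k. Ext (?s k)) \<longlonglongrightarrow> Ext (indicator (\<Union>i. A i))"
  proof (rule Ext_lim[where C=1])
    show "bm (?s k)" for k by (intro bm_sum bm_indicator Am) simp
    show "bm (indicator (\<Union>i. A i))" using UA by (rule bm_indicator)
    show "(\<lambda>k. ?s k x) \<longlonglongrightarrow> indicator (\<Union>i. A i) x" for x
      unfolding s_eq by (rule LIMSEQ_indicator_UN)
    show "\<bar>?s k x - indicator (\<Union>i. A i) x\<bar> \<le> 1" for k x
      unfolding s_eq by (auto simp: indicator_def)
  qed
  moreover have "Ext (?s k) = (\<Sum>i<k. Ext (indicator (A i)))" for k
    by (rule Ext_sum) (auto intro: bm_indicator Am)
  ultimately have 1: "(\<lambda>i. Ext (indicator (A i))) sums Ext (indicator (\<Union>i. A i))"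
    by (simp add: sums_def)
  have 2: "(\<lambda>i. measure \<rho> (A i)) sums measure \<rho> (\<Union>i. A i)"
    by (rule finite_measure.finite_measure_UNION[OF rho assms])
  show ?thesis unfolding shifted_mass_def by (rule sums_add[OF 1 2])
qed

section \<open>The density of Dw with respect to \<rho>\<close>

definition shifted_measure :: "real measure" where
  "shifted_measure = measure_of (space \<rho>) (sets \<rho>) (\<lambda>B. ennreal (shifted_mass B))"

lemma sets_shifted_measure: "sets shifted_measure = sets \<rho>" and space_shifted_measure: "space shifted_measure = space \<rho>"
  unfolding shifted_measure_def by (simp_all add: sets.sigma_sets_eq sets.space_closed)

lemma emeasure_shifted_measure: "B \<in> sets \<rho> \<Longrightarrow> emeasure shifted_measure B = ennreal (shifted_mass B)"
proof (rule emeasure_measure_of_sigma[OF _ _ _ _, of "space \<rho>" "sets \<rho>" "\<lambda>B. ennreal (shifted_mass B)" B, folded shifted_measure_def])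
  show "sigma_algebra (space \<rho>) (sets \<rho>)" by (rule sets.sigma_algebra_axioms)
  have "shifted_mass {} = 0" using shifted_mass_bounds[of "{}"] by simp
  then show "positive (sets \<rho>) (\<lambda>B. ennreal (shifted_mass B))" by (simp add: positive_def)
  show "countably_additive (sets \<rho>) (\<lambda>B. ennreal (shifted_mass B))"
  proof (rule countably_additiveI)
    fix A :: "nat \<Rightarrow> real set" assume A: "range A \<subseteq> sets \<rho>" "disjoint_family A" "(\<Union>i. A i) \<in> sets \<rho>"
    then have "A i \<in> sets \<rho>" for i by auto
    then have nn: "0 \<le> shifted_mass (A i)" for i by (rule shifted_mass_bounds(1))
    show "(\<Sum>i. ennreal (shifted_mass (A i))) = ennreal (shifted_mass (\<Union>i. A i))"
      using shifted_mass_sums[OF A(1,2)] nn shifted_mass_bounds(1)[OF A(3)]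
      by (metis sums_unique suminf_ennreal2 sums_summable)
  qed
qed

text \<open>The shifted measure lies between 0 and 2\<rho>, so its density lies in [0,2] almost
  everywhere, and subtracting 1 undoes the shift.\<close>

lemma density_exists:
  "\<exists>\<sigma>\<in>borel_measurable \<rho>. (\<forall>x. \<bar>\<sigma> x\<bar> \<le> 1) \<and> (\<forall>B\<in>sets \<rho>. Ext (indicator B) = (\<integral>x. indicator B x * \<sigma> x \<partial>\<rho>))"
proof -
  interpret rho: finite_measure \<rho> by (rule rho)
  have ac: "absolutely_continuous \<rho> shifted_measure"
    unfolding absolutely_continuous_def
  proof
    fix B assume B: "B \<in> null_sets \<rho>"
    then have "B \<in> sets \<rho>" "measure \<rho> B = 0" by (auto simp: null_sets_def measure_def)
    moreover from this have "shifted_mass B = 0" using shifted_mass_bounds[of B] by simp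
    ultimately show "B \<in> null_sets shifted_measure" by (auto simp: null_sets_def emeasure_shifted_measure sets_shifted_measure)
  qed
  obtain f where f: "f \<in> borel_measurable \<rho>" "density \<rho> f = shifted_measure"
    using rho.Radon_Nikodym[OF ac sets_shifted_measure] by blast
  note f(1)[measurable]
  have em: "(\<integral>\<^sup>+x. f x * indicator B x \<partial>\<rho>) = ennreal (shifted_mass B)" if "B \<in> sets \<rho>" for B
    using emeasure_density[OF f(1) that] emeasure_shifted_measure[OF that] f(2) by simp
  have le2: "AE x in \<rho>. f x \<le> 2"
  proof -
    let ?B = "{x \<in> space \<rho>. f x > 2}"
    have B [measurable]: "?B \<in> sets \<rho>" by measurable
    have fin: "(\<integral>\<^sup>+x. 2 * indicator ?B x \<partial>\<rho>) < \<infinity>"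
      using rho.emeasure_finite[of ?B] by (subst nn_integral_cmult_indicator) (simp_all add: ennreal_mult_eq_top_iff less_top[symmetric])
    \<comment> \<open>Where f exceeds 2, the shifted measure is still at most 2\<rho>, so the
      positive function f - 2 has integral 0 there. Subtraction is truncated on extended nonnegative
      reals, and splitting the integral of a difference relies on the finiteness in
      \<open>fin\<close>.\<close>
    have "(\<integral>\<^sup>+x. f x * indicator ?B x - 2 * indicator ?B x \<partial>\<rho>)
        = (\<integral>\<^sup>+x. f x * indicator ?B x \<partial>\<rho>) - (\<integral>\<^sup>+x. 2 * indicator ?B x \<partial>\<rho>)"
      by (rule nn_integral_diff) (use fin in \<open>auto intro!: AE_I2 simp: indicator_def less_imp_le\<close>)
    also have "(\<integral>\<^sup>+x. 2 * indicator ?B x \<partial>\<rho>) = ennreal (2 * measure \<rho> ?B)"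
      by (subst nn_integral_cmult_indicator) (auto simp: rho.emeasure_eq_measure ennreal_mult)
    also have "(\<integral>\<^sup>+x. f x * indicator ?B x \<partial>\<rho>) - ennreal (2 * measure \<rho> ?B) = 0"
      unfolding em[OF B] using shifted_mass_bounds(2)[OF B] by (simp add: ennreal_minus ennreal_neg)
    finally have "(\<integral>\<^sup>+x. f x * indicator ?B x - 2 * indicator ?B x \<partial>\<rho>) = 0" .
    then have "AE x in \<rho>. f x * indicator ?B x - 2 * indicator ?B x = 0"
      by (subst (asm) nn_integral_0_iff_AE) auto
    then show ?thesis using AE_space
    proof eventually_elim
      case (elim x)
      show ?case
      proof (rule ccontr)
        assume "\<not> f x \<le> 2"
        then have "f x - 2 = 0" "2 < f x" using elim by auto
        then show False by (simp add: diff_eq_0_iff_ennreal leD)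
      qed
    qed
  qed
  \<comment> \<open>Clipping changes f - 1 only on a null set and makes the bound by 1 hold at every
    point.\<close>
  define \<sigma> where "\<sigma> x = max (-1) (min 1 (enn2real (f x) - 1))" for x
  have sm [measurable]: "\<sigma> \<in> borel_measurable \<rho>" unfolding \<sigma>_def by measurable
  have ext: "Ext (indicator B) = (\<integral>x. indicator B x * \<sigma> x \<partial>\<rho>)" if B [measurable]: "B \<in> sets \<rho>" for B
  proof -
    have real2: "AE x in \<rho>. enn2real (f x) \<le> 2"
      using le2 by eventually_elim (use enn2real_mono[of _ 2] in \<open>simp\<close>)
    have int: "integrable \<rho> (\<lambda>x. indicator B x * enn2real (f x))"
    proof (rule rho.integrable_const_bound[where B=2])
      show "AE x in \<rho>. norm (indicator B x * enn2real (f x)) \<le> 2"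
        using real2 by eventually_elim (auto simp: indicator_def)
    qed measurable
    have "(\<integral>x. indicator B x * \<sigma> x \<partial>\<rho>) = (\<integral>x. indicator B x * enn2real (f x) - indicator B x \<partial>\<rho>)"
    proof (rule integral_cong_AE)
      show "AE x in \<rho>. indicator B x * \<sigma> x = indicator B x * enn2real (f x) - indicator B x"
        using real2 by eventually_elim (auto simp: indicator_def \<sigma>_def max_def min_def)
    qed measurable
    also have "\<dots> = (\<integral>x. indicator B x * enn2real (f x) \<partial>\<rho>) - (\<integral>x. indicator B x \<partial>\<rho>)"
      by (rule Bochner_Integration.integral_diff[OF int]) (simp add: rho.emeasure_finite less_top[symmetric])
    also have "(\<integral>x. indicator B x * enn2real (f x) \<partial>\<rho>) = enn2real (\<integral>\<^sup>+x. ennreal (indicator B x * enn2real (f x)) \<partial>\<rho>)"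
      by (rule integral_eq_nn_integral) (auto intro!: AE_I2)
    also have "(\<integral>\<^sup>+x. ennreal (indicator B x * enn2real (f x)) \<partial>\<rho>) = (\<integral>\<^sup>+x. f x * indicator B x \<partial>\<rho>)"
    proof (rule nn_integral_cong_AE, use le2 in eventually_elim)
      case (elim x)
      then have "f x < top" by (rule le_less_trans) simp
      then show ?case by (simp add: indicator_def ennreal_enn2real)
    qed
    also have "\<dots> = ennreal (shifted_mass B)" by (rule em[OF B])
    also have "(\<integral>x. indicator B x \<partial>\<rho>) = measure \<rho> B"
      using sets.sets_into_space[OF B] by (simp add: Int_absorb2)
    finally show ?thesis using shifted_mass_bounds(1)[OF B] by (simp add: shifted_mass_def)
  qed
  have "\<bar>\<sigma> x\<bar> \<le> 1" for x unfolding \<sigma>_def by linarith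
  then show ?thesis by (intro bexI[of _ \<sigma>] conjI allI ballI ext sm)
qed

lemma representation:
  "\<exists>\<sigma>\<in>borel_measurable \<rho>. (\<forall>x. \<bar>\<sigma> x\<bar> \<le> 1) \<and>
     (\<forall>\<psi> \<psi>'. C1_test d \<psi> \<psi>' \<longrightarrow> ip d w \<psi>' = - (\<integral>x. \<psi> x * \<sigma> x \<partial>\<rho>))"
proof -
  from density_exists obtain \<sigma> where sig [measurable]: "\<sigma> \<in> borel_measurable \<rho>" and s1: "\<And>x. \<bar>\<sigma> x\<bar> \<le> 1"
    and ext: "\<And>B. B \<in> sets \<rho> \<Longrightarrow> Ext (indicator B) = (\<integral>x. indicator B x * \<sigma> x \<partial>\<rho>)" by auto
  have int: "integrable \<rho> (\<lambda>x. f x * \<sigma> x)" if bmf: "bm f" for f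
  proof -
    obtain C where f [measurable]: "f \<in> borel_measurable \<rho>" and C: "\<forall>x\<in>dset d. \<bar>f x\<bar> \<le> C"
      using bmf unfolding bm_def by blast
    show ?thesis
    proof (rule integrable_bounded_dset[OF rho sets_rho])
      show "\<bar>f x * \<sigma> x\<bar> \<le> C" if "x \<in> dset d" for x
        using mult_mono[of "\<bar>f x\<bar>" C "\<bar>\<sigma> x\<bar>" 1] C that s1[of x] by (force simp: abs_mult)
    qed measurable
  qed
  have "ip d w \<psi>' = - (\<integral>x. \<psi> x * \<sigma> x \<partial>\<rho>)" if psi: "C1_test d \<psi> \<psi>'" for \<psi> \<psi>'
  proof -
    obtain C where C: "\<And>x. x \<in> dset d \<Longrightarrow> \<bar>\<psi> x\<bar> \<le> C" using test_bounded[OF psi] by metis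
    have pm [measurable]: "\<psi> \<in> borel_measurable \<rho>" by (rule test_meas[OF psi])
    obtain s where s: "\<And>i. simple_function \<rho> (s i)" "\<And>x. x \<in> space \<rho> \<Longrightarrow> (\<lambda>i. s i x) \<longlonglongrightarrow> \<psi> x"
      "\<And>i x. x \<in> space \<rho> \<Longrightarrow> dist (s i x) 0 \<le> 2 * dist (\<psi> x) 0"
      using borel_measurable_implies_sequence_metric[OF pm, of 0] by metis
    have sC: "\<bar>s i x\<bar> \<le> 2 * C" "\<bar>s i x - \<psi> x\<bar> \<le> 3 * C" if "x \<in> dset d" for i x
      using s(3)[of x i] C[OF that] that by (auto simp: spaceM)
    have bs: "bm (s i)" for i
      unfolding bm_def using sC borel_measurable_simple_function[OF s(1)] by auto
    have Es: "Ext (s i) = (\<integral>x. s i x * \<sigma> x \<partial>\<rho>)" for i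
    proof -
      let ?D = "\<lambda>y. s i -` {y} \<inter> space \<rho>"
      let ?t = "\<lambda>x. \<Sum>y\<in>s i ` space \<rho>. y * indicator (?D y) x"
      have fin: "finite (s i ` space \<rho>)" using s(1) by (simp add: simple_function_def)
      have D: "?D y \<in> sets \<rho>" for y by (rule simple_functionD(2)[OF s(1)])
      have bD: "bm (\<lambda>x. y * indicator (?D y) x)" for y by (intro bm_cmult bm_indicator D)
      have eq: "?t x = s i x" if "x \<in> dset d" for x
        by (rule simple_function_real_representation[OF s(1)]) (use that spaceM in simp)
      have bt: "bm ?t" by (intro bm_sum fin bD)
      \<comment> \<open>\<open>s i\<close> and \<open>?t\<close> agree only on the domain, while
        \<open>Ext\<close> is applied to functions on the whole line; its L1 bound identifies the
        two values.\<close>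
      have "(\<integral>x. \<bar>s i x - ?t x\<bar> \<partial>\<rho>) = (\<integral>x. 0 \<partial>\<rho>)"
        by (intro Bochner_Integration.integral_cong refl) (simp only: spaceM[symmetric] eq[unfolded spaceM[symmetric]] diff_self abs_zero)
      then have "Ext (s i) = Ext ?t" using Ext_diff[OF bs bt, of i] by simp
      also have "\<dots> = (\<Sum>y\<in>s i ` space \<rho>. y * (\<integral>x. indicator (?D y) x * \<sigma> x \<partial>\<rho>))"
        using Ext_sum[OF fin bD] by (simp only: Ext_cmult[OF bm_indicator[OF D]] ext[OF D])
      also have "\<dots> = (\<Sum>y\<in>s i ` space \<rho>. (\<integral>x. (y * indicator (?D y) x) * \<sigma> x \<partial>\<rho>))"
        by (simp only: mult.assoc integral_mult_right_zero)
      also have "\<dots> = (\<integral>x. (\<Sum>y\<in>s i ` space \<rho>. (y * indicator (?D y) x) * \<sigma> x) \<partial>\<rho>)"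
        by (rule Bochner_Integration.integral_sum[symmetric]) (rule int[OF bD])
      also have "\<dots> = (\<integral>x. s i x * \<sigma> x \<partial>\<rho>)"
        by (intro Bochner_Integration.integral_cong refl)
           (simp only: sum_distrib_right[symmetric] eq[unfolded spaceM[symmetric]])
      finally show ?thesis .
    qed
    have "(\<lambda>i. Ext (s i)) \<longlonglongrightarrow> Ext \<psi>"
      by (rule Ext_lim[OF bs bm_test[OF psi], where C="3 * C"]) (use s(2) sC spaceM in auto)
    moreover have "(\<lambda>i. \<integral>x. s i x * \<sigma> x \<partial>\<rho>) \<longlonglongrightarrow> (\<integral>x. \<psi> x * \<sigma> x \<partial>\<rho>)"
    proof (rule integral_dominated_convergence[where w="\<lambda>_. 2 * C"])
      show "(\<lambda>x. s i x * \<sigma> x) \<in> borel_measurable \<rho>" for i using int[OF bs] by auto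
      show "integrable \<rho> (\<lambda>_. 2 * C)" using rho by (rule finite_measure.integrable_const)
      show "AE x in \<rho>. (\<lambda>i. s i x * \<sigma> x) \<longlonglongrightarrow> \<psi> x * \<sigma> x"
        using s(2) by (intro AE_I2 tendsto_intros)
      show "AE x in \<rho>. norm (s i x * \<sigma> x) \<le> 2 * C" for i
      proof (rule AE_I2)
        fix x assume "x \<in> space \<rho>"
        then have "\<bar>s i x\<bar> \<le> 2 * C" using sC spaceM by simp
        then show "norm (s i x * \<sigma> x) \<le> 2 * C"
          using mult_mono[of "\<bar>s i x\<bar>" "2*C" "\<bar>\<sigma> x\<bar>" 1] s1[of x] by (simp add: abs_mult)
      qed
    qed measurable
    ultimately have "Ext \<psi> = (\<integral>x. \<psi> x * \<sigma> x \<partial>\<rho>)" unfolding Es by (rule LIMSEQ_unique)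
    then show ?thesis using Ext_test[OF psi] by (simp add: ell_def)
  qed
  then show ?thesis by (intro bexI[of _ \<sigma>] conjI allI s1 sig impI)
qed

text \<open>The density \<sigma> has modulus at most 1, whereas a polar decomposition asks for
  modulus 1: |\<sigma>| moves into the measure and the sign stays behind. Domination of \<nu> by
  \<rho> can then be read off from |\<sigma>| \<le> 1.\<close>

theorem tv_measure_exists:
  "\<exists>\<nu>. is_TV_measure d w \<nu> \<and>
     (\<forall>\<phi>::real \<Rightarrow> real. continuous_on UNIV \<phi> \<and> (\<forall>x. 0 \<le> \<phi> x) \<longrightarrow> (\<integral>x. \<phi> x \<partial>\<nu>) \<le> (\<integral>x. \<phi> x \<partial>\<rho>))"
proof -
  from representation obtain \<sigma> where sig [measurable]: "\<sigma> \<in> borel_measurable \<rho>" and s1: "\<And>x. \<bar>\<sigma> x\<bar> \<le> 1"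
    and rep: "\<And>\<psi> \<psi>'. C1_test d \<psi> \<psi>' \<Longrightarrow> ip d w \<psi>' = - (\<integral>x. \<psi> x * \<sigma> x \<partial>\<rho>)"
    by auto
  define \<nu> where "\<nu> = density \<rho> (\<lambda>x. ennreal \<bar>\<sigma> x\<bar>)"
  \<comment> \<open>The value 1 at zeros of \<sigma> is arbitrary, since \<nu> does not charge
    them.\<close>
  define s where "s x = (if \<sigma> x \<ge> 0 then 1 else -1 :: real)" for x
  have sm [measurable]: "s \<in> borel_measurable \<rho>" unfolding s_def by measurable
  have fin: "finite_measure \<nu>"
  proof
    have "emeasure \<nu> (space \<nu>) = (\<integral>\<^sup>+x. ennreal \<bar>\<sigma> x\<bar> \<partial>\<rho>)"
      unfolding \<nu>_def by (simp add: emeasure_density cong: nn_integral_cong)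
    also have "\<dots> \<le> (\<integral>\<^sup>+x. 1 \<partial>\<rho>)" using s1 by (intro nn_integral_mono) simp
    also have "\<dots> < top" using finite_measure.emeasure_finite[OF rho] by (simp add: less_top)
    finally show "emeasure \<nu> (space \<nu>) \<noteq> \<infinity>" by simp
  qed
  have sets: "sets \<nu> = sets (bor d)" by (simp add: \<nu>_def sets_rho)
  have int: "(\<integral>x. f x \<partial>\<nu>) = (\<integral>x. \<bar>\<sigma> x\<bar> * f x \<partial>\<rho>)" if [measurable]: "f \<in> borel_measurable \<rho>" for f :: rfun
    unfolding \<nu>_def by (subst integral_density) auto
  have "polar d w \<nu> s"
    unfolding polar_def
  proof (intro conjI allI impI w fin sets)
    show "s \<in> borel_measurable \<nu>" unfolding \<nu>_def by simp
    show "\<forall>x\<in>space \<nu>. \<bar>s x\<bar> = 1" by (simp add: s_def)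
    fix \<phi> \<phi>' assume t: "C1_test d \<phi> \<phi>'"
    have [measurable]: "\<phi> \<in> borel_measurable \<rho>" by (rule test_meas[OF t])
    have "(\<integral>x. \<phi> x * s x \<partial>\<nu>) = (\<integral>x. \<phi> x * \<sigma> x \<partial>\<rho>)"
      by (subst int) (auto intro!: Bochner_Integration.integral_cong simp: s_def)
    then show "ip d w \<phi>' = - (\<integral>x. \<phi> x * s x \<partial>\<nu>)"
      using rep[OF t] by simp
  qed
  then have "is_TV_measure d w \<nu>" unfolding is_TV_measure_iff_polar by (intro exI[of "polar d w \<nu>" s])
  moreover have "\<forall>\<phi>::real \<Rightarrow> real. continuous_on UNIV \<phi> \<and> (\<forall>x. 0 \<le> \<phi> x) \<longrightarrow> (\<integral>x. \<phi> x \<partial>\<nu>) \<le> (\<integral>x. \<phi> x \<partial>\<rho>)"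
  proof (intro allI impI)
    fix \<phi> :: rfun
    assume "continuous_on UNIV \<phi> \<and> (\<forall>x. 0 \<le> \<phi> x)"
    then have c: "continuous_on UNIV \<phi>" and nn: "\<forall>x. 0 \<le> \<phi> x" by auto
    have m [measurable]: "\<phi> \<in> borel_measurable \<rho>" by (rule measurable_restrict_dset_continuous[OF sets_rho c])
    obtain C where C: "\<And>x. x \<in> {lo d..hi d} \<Longrightarrow> \<bar>\<phi> x\<bar> \<le> C" using continuous_bounded_dset[OF c] by metis
    have le: "\<bar>\<sigma> x\<bar> * \<phi> x \<le> \<phi> x" for x
      using mult_right_mono[OF s1[of x], of "\<phi> x"] nn by simp
    have i: "integrable \<rho> \<phi>"
      by (rule integrable_bounded_dset[OF rho sets_rho m]) (use C dset_subset_Icc in blast)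
    show "(\<integral>x. \<phi> x \<partial>\<nu>) \<le> (\<integral>x. \<phi> x \<partial>\<rho>)" unfolding int[OF m]
    proof (rule integral_mono[OF _ i le])
      show "integrable \<rho> (\<lambda>x. \<bar>\<sigma> x\<bar> * \<phi> x)"
      proof (rule Bochner_Integration.integrable_bound[OF i])
        show "AE x in \<rho>. norm (\<bar>\<sigma> x\<bar> * \<phi> x) \<le> norm (\<phi> x)"
          using le nn by (intro AE_I2) (simp add: abs_mult)
      qed measurable
    qed
  qed
  ultimately show ?thesis by (intro exI[of _ \<nu>] conjI)
qed

end

section \<open>The discrete resolvent\<close>

text \<open>Neighbours are cyclic for the interval too. There the weight of the edge into index 0 is
  0, which forces the flux across it to vanish: the homogeneous Neumann condition.\<close>

definition prv :: "nat \<Rightarrow> nat \<Rightarrow> nat" where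
  "prv n i = (if i = 0 then n - 1 else i - 1)"

definition nxt :: "nat \<Rightarrow> nat \<Rightarrow> nat" where
  "nxt n i = (if Suc i = n then 0 else Suc i)"

lemma prv_less: "i < n \<Longrightarrow> prv n i < n" and nxt_less: "i < n \<Longrightarrow> nxt n i < n"
  and nxt_prv: "i < n \<Longrightarrow> nxt n (prv n i) = i" and prv_nxt: "i < n \<Longrightarrow> prv n (nxt n i) = i"
  by (auto simp: prv_def nxt_def)

lemma prv_neq: "i < n \<Longrightarrow> 2 \<le> n \<Longrightarrow> prv n i \<noteq> i"
  by (auto simp: prv_def)

text \<open>Cyclic indexing leaves no boundary terms.\<close>

lemma cyclic_sum_by_parts:
  fixes Z c :: "nat \<Rightarrow> real"
  shows "(\<Sum>i<n. (Z (nxt n i) - Z i) * c i) = - (\<Sum>i<n. Z i * (c i - c (prv n i)))"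
proof -
  have "(\<Sum>i<n. Z (nxt n i) * c i) = (\<Sum>i<n. Z i * c (prv n i))"
    by (rule sum.reindex_bij_witness[of _ "prv n" "nxt n"])
       (auto simp: prv_less nxt_less nxt_prv prv_nxt)
  then show ?thesis by (simp add: algebra_simps sum_subtractf)
qed

text \<open>The dual of an implicit Euler step: among fluxes below the obstacle, minimise the norm
  of the data plus the difference of the flux. The box consists of whole sequences, so it is a
  product of compact intervals and Tychonoff's theorem applies.\<close>

lemma box_minimizer_exists:
  fixes a b :: "nat \<Rightarrow> real" and n :: nat
  assumes "\<And>i. 0 \<le> b i"
  obtains Z where "\<And>i. \<bar>Z i\<bar> \<le> b i"
    "\<And>Z'. (\<And>i. \<bar>Z' i\<bar> \<le> b i) \<Longrightarrow> (\<Sum>i<n. (a i + Z (nxt n i) - Z i)\<^sup>2) \<le> (\<Sum>i<n. (a i + Z' (nxt n i) - Z' i)\<^sup>2)"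
proof -
  let ?S = "PiE UNIV (\<lambda>i. {- b i..b i})"
  have S: "Z \<in> ?S \<longleftrightarrow> (\<forall>i. \<bar>Z i\<bar> \<le> b i)" for Z :: "nat \<Rightarrow> real"
    by (auto simp: PiE_iff abs_le_iff minus_le_iff)
  have "compactin (product_topology (\<lambda>i::nat. euclidean) UNIV) ?S"
    unfolding compactin_PiE by simp
  then have comp: "compact ?S" unfolding euclidean_product_topology by simp
  have "(\<lambda>i. 0) \<in> ?S" unfolding S using assms by simp
  then have ne: "?S \<noteq> {}" by blast
  have "continuous_on ?S (\<lambda>Z. \<Sum>i<n. (a i + Z (nxt n i) - Z i)\<^sup>2)"
    by (intro continuous_intros continuous_on_subset[OF continuous_on_product_coordinates]) auto
  from continuous_attains_inf[OF comp ne this] obtain Z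
    where "Z \<in> ?S" "\<forall>Z'\<in>?S. (\<Sum>i<n. (a i + Z (nxt n i) - Z i)\<^sup>2) \<le> (\<Sum>i<n. (a i + Z' (nxt n i) - Z' i)\<^sup>2)"
    by blast
  then show ?thesis using S by (intro that[of Z]) blast+
qed

text \<open>First-order optimality: divide by t and let t tend to 0. Only t up to 1 are available,
  because the variations below stay in the box by convexity.\<close>

lemma nonneg_from_small_scaling:
  fixes A B :: real
  assumes "\<And>t. 0 < t \<Longrightarrow> t \<le> 1 \<Longrightarrow> 0 \<le> t * A + t\<^sup>2 * B"
  shows "0 \<le> A"
proof (rule ccontr)
  assume "\<not> 0 \<le> A"
  define t where "t = min 1 (- A / (2 * (\<bar>B\<bar> + 1)))"
  have "0 < - A / (2 * (\<bar>B\<bar> + 1))" using \<open>\<not> 0 \<le> A\<close> by (intro divide_pos_pos) auto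
  then have t: "0 < t" "t \<le> 1" unfolding t_def by linarith+
  have "t * B \<le> t * (\<bar>B\<bar> + 1)" using t by (intro mult_left_mono) auto
  also have "\<dots> \<le> (- A / (2 * (\<bar>B\<bar> + 1))) * (\<bar>B\<bar> + 1)"
    by (intro mult_right_mono) (auto simp: t_def)
  also have "\<dots> = - A / 2" by (simp add: field_simps add_nonneg_eq_0_iff)
  finally have "A + t * B < 0" using \<open>\<not> 0 \<le> A\<close> by simp
  then have "t * (A + t * B) < 0" using t by (simp add: mult_pos_neg)
  then show False using assms[OF t] by (simp add: power2_eq_square algebra_simps)
qed

text \<open>The discrete resolvent is solved through its dual, an obstacle problem for the flux \<open>Z\<close>.
  Where \<open>w\<close> jumps, \<open>Z\<close> touches its obstacle, hence is extremal among its neighbours,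
  and the second difference of \<open>Z\<close> can only decrease the jump.\<close>

lemma discrete_resolvent:
  fixes y e :: "nat \<Rightarrow> real" and h lam :: real
  assumes n: "2 \<le> n" and h: "0 < h" and lam: "0 < lam" and e: "\<And>i. e i = 0 \<or> e i = 1"
  obtains w Z where
    "\<And>i. i < n \<Longrightarrow> h * (w i - y i) = Z (nxt n i) - Z i"
    "\<And>i. i < n \<Longrightarrow> \<bar>Z i\<bar> \<le> lam * e i"
    "\<And>i. i < n \<Longrightarrow> Z i * (w i - w (prv n i)) = lam * (e i * \<bar>w i - w (prv n i)\<bar>)"
    "\<And>i. i < n \<Longrightarrow> e i = 1 \<Longrightarrow> \<bar>w i - w (prv n i)\<bar> \<le> \<bar>y i - y (prv n i)\<bar>"
proof -
  define b where "b i = lam * e i" for i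
  have b0: "0 \<le> b i" "b i \<le> lam" for i using e[of i] lam by (auto simp: b_def)
  obtain Z where Z: "\<And>i. \<bar>Z i\<bar> \<le> b i"
    and min: "\<And>Z'. (\<And>i. \<bar>Z' i\<bar> \<le> b i) \<Longrightarrow>
      (\<Sum>i<n. (h * y i + Z (nxt n i) - Z i)\<^sup>2) \<le> (\<Sum>i<n. (h * y i + Z' (nxt n i) - Z' i)\<^sup>2)"
    using box_minimizer_exists[where b=b and n=n and a="\<lambda>i. h * y i"] b0 by blast
  define W where "W i = h * y i + Z (nxt n i) - Z i" for i
  define w where "w i = W i / h" for i
  \<comment> \<open>Variational inequality in one coordinate: moving \<open>Z i\<close> towards
    \<zeta> changes only \<open>W i\<close> and the value at its predecessor, by opposite amounts,
    and minimality of the sum of squares fixes the sign of the first variation.\<close>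
  have var: "0 \<le> (\<zeta> - Z i) * (W (prv n i) - W i)" if i: "i < n" and z: "\<bar>\<zeta>\<bar> \<le> b i" for i \<zeta>
  proof -
    define \<delta> where "\<delta> = \<zeta> - Z i"
    have "0 \<le> t * (2 * \<delta> * (W (prv n i) - W i)) + t\<^sup>2 * (2 * \<delta>\<^sup>2)" if t: "0 < t" "t \<le> 1" for t
    proof -
      let ?Z = "Z(i := Z i + t * \<delta>)"
      have "Z i + t * \<delta> = (1 - t) * Z i + t * \<zeta>" by (simp add: \<delta>_def algebra_simps)
      moreover have "\<bar>(1 - t) * Z i + t * \<zeta>\<bar> \<le> (1 - t) * b i + t * b i"
        using t Z[of i] z
        by (intro order_trans[OF abs_triangle_ineq] add_mono) (auto simp: abs_mult intro!: mult_left_mono)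
      ultimately have "\<bar>Z i + t * \<delta>\<bar> \<le> b i" by (simp add: algebra_simps)
      then have Zb: "\<bar>?Z j\<bar> \<le> b j" for j using Z by simp
      let ?p = "prv n i"
      have p: "?p < n" "?p \<noteq> i" "nxt n ?p = i" using i n by (auto simp: prv_less prv_neq nxt_prv)
      have ni: "nxt n i \<noteq> i" using i n by (auto simp: nxt_def)
      have terms: "h * y j + ?Z (nxt n j) - ?Z j = (if j = i then W i - t * \<delta> else if j = ?p then W ?p + t * \<delta> else W j)"
        if "j < n" for j
      proof -
        have "nxt n j = i \<longleftrightarrow> j = ?p" using that i by (metis nxt_prv prv_nxt)
        then show ?thesis using p ni by (auto simp: W_def)
      qed
      have split: "(\<Sum>j<n. f j) = f i + f ?p + (\<Sum>j\<in>{..<n} - {i, ?p}. f j)" for f :: "nat \<Rightarrow> real"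
      proof -
        have "(\<Sum>j<n. f j) = (\<Sum>j\<in>{i, ?p}. f j) + (\<Sum>j\<in>{..<n} - {i, ?p}. f j)"
          using i p by (subst add.commute, intro sum.subset_diff) auto
        then show ?thesis using p by simp
      qed
      have "(\<Sum>j<n. (h * y j + ?Z (nxt n j) - ?Z j)\<^sup>2)
        = (\<Sum>j<n. (if j = i then W i - t * \<delta> else if j = ?p then W ?p + t * \<delta> else W j)\<^sup>2)"
        by (intro sum.cong refl) (simp only: terms lessThan_iff)
      also have "\<dots> = (W i - t * \<delta>)\<^sup>2 + (W ?p + t * \<delta>)\<^sup>2 + (\<Sum>j\<in>{..<n} - {i, ?p}. (W j)\<^sup>2)"
        unfolding split using p by simp
      finally have new: "(\<Sum>j<n. (h * y j + ?Z (nxt n j) - ?Z j)\<^sup>2)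
         = (W i - t * \<delta>)\<^sup>2 + (W ?p + t * \<delta>)\<^sup>2 + (\<Sum>j\<in>{..<n} - {i, ?p}. (W j)\<^sup>2)" .
      have old: "(\<Sum>j<n. (h * y j + Z (nxt n j) - Z j)\<^sup>2)
         = (W i)\<^sup>2 + (W ?p)\<^sup>2 + (\<Sum>j\<in>{..<n} - {i, ?p}. (W j)\<^sup>2)"
        unfolding split W_def by simp
      have "(W i)\<^sup>2 + (W ?p)\<^sup>2 \<le> (W i - t * \<delta>)\<^sup>2 + (W ?p + t * \<delta>)\<^sup>2"
        using min[of ?Z, OF Zb] unfolding new old by simp
      then show ?thesis by (simp add: power2_eq_square algebra_simps)
    qed
    from nonneg_from_small_scaling[OF this] have "0 \<le> \<delta> * (W (prv n i) - W i)" by (simp add: zero_le_mult_iff)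
    then show ?thesis by (simp add: \<delta>_def)
  qed
  \<comment> \<open>Testing \<open>var\<close> with an endpoint of the box: a strict jump of w pins
    Z to its obstacle, upper or lower according to the sign.\<close>
  have up: "Z i = b i" if "i < n" "w (prv n i) < w i" for i
  proof -
    have "W (prv n i) < W i" using that(2) h by (simp add: w_def divide_less_cancel)
    moreover have "0 \<le> (b i - Z i) * (W (prv n i) - W i)" using b0 by (intro var that(1)) simp
    ultimately have "b i \<le> Z i" by (simp add: zero_le_mult_iff)
    then show ?thesis using Z[of i] by simp
  qed
  have down: "Z i = - b i" if "i < n" "w i < w (prv n i)" for i
  proof -
    have "W i < W (prv n i)" using that(2) h by (simp add: w_def divide_less_cancel)
    moreover have "0 \<le> (- b i - Z i) * (W (prv n i) - W i)" using b0 by (intro var that(1)) simp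
    ultimately have "Z i \<le> - b i" by (simp add: zero_le_mult_iff)
    then show ?thesis using Z[of i] by simp
  qed
  have eq: "h * (w i - y i) = Z (nxt n i) - Z i" for i
  proof -
    have "h * w i = W i" using h by (simp add: w_def)
    then show ?thesis by (simp add: W_def right_diff_distrib)
  qed
  show ?thesis
  proof (rule that[of w Z, OF eq])
    show "\<bar>Z i\<bar> \<le> lam * e i" for i using Z[of i] by (simp add: b_def)
    show "Z i * (w i - w (prv n i)) = lam * (e i * \<bar>w i - w (prv n i)\<bar>)" if i: "i < n" for i
      using up[OF i] down[OF i] by (cases "w i" "w (prv n i)" rule: linorder_cases) (auto simp: b_def algebra_simps)
    show "\<bar>w i - w (prv n i)\<bar> \<le> \<bar>y i - y (prv n i)\<bar>" if i: "i < n" and e1: "e i = 1" for i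
    proof -
      let ?p = "prv n i"
      have d: "h * (w i - w ?p) = h * (y i - y ?p) + Z (nxt n i) - 2 * Z i + Z ?p"
        using eq[of i] eq[of ?p] nxt_prv[OF i] by (simp add: algebra_simps)
      have b1: "b i = lam" using e1 by (simp add: b_def)
      \<comment> \<open>The neighbouring fluxes obey the same bound \<open>lam\<close>, also across
        a removed edge, where they are 0. Hence an extremal \<open>Z i\<close> makes the second
        difference in \<open>d\<close> act against the jump.\<close>
      have zb: "\<bar>Z j\<bar> \<le> lam" for j using Z[of j] b0(2)[of j] by linarith
      consider "w ?p < w i" | "w i < w ?p" | "w i = w ?p" by linarith
      then show ?thesis
      proof cases
        case 1
        then have "Z i = lam" using up[OF i] b1 by simp
        then have "h * (w i - w ?p) \<le> h * (y i - y ?p)" using d zb[of "nxt n i"] zb[of ?p] by linarith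
        then show ?thesis using h 1 by simp
      next
        case 2
        then have "Z i = - lam" using down[OF i] b1 by simp
        then have "h * (y i - y ?p) \<le> h * (w i - w ?p)" using d zb[of "nxt n i"] zb[of ?p] by linarith
        then show ?thesis using h 2 by simp
      qed simp
    qed
  qed
qed

section \<open>Lebesgue measure on the domain\<close>

lemma integral_lebesgue_on_dset:
  fixes f :: rfun
  assumes [measurable]: "f \<in> borel_measurable borel"
  shows "(\<integral>x. f x \<partial>leb d) = (\<integral>x. indicator (dset d) x * f x \<partial>lborel)"
proof -
  have "(\<integral>x. f x \<partial>leb d) = (\<integral>x. indicator (dset d) x *\<^sub>R f x \<partial>lebesgue)"
    by (rule integral_restrict_space) simp
  also have "\<dots> = (\<integral>x. indicator (dset d) x *\<^sub>R f x \<partial>lborel)"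
    by (rule integral_completion) measurable
  finally show ?thesis by simp
qed

lemma AE_lebesgue_on_neq: "AE x in lebesgue_on S. x \<noteq> (c::real)" if "S \<in> sets lebesgue"
proof -
  have "AE x in lebesgue. x \<noteq> c"
    using AE_lborel_singleton[of c] by (rule AE_completion)
  then show ?thesis using that by (subst AE_restrict_space_iff) auto
qed

lemma finite_measure_lebesgue_on_dset: "finite_measure (leb d)"
proof
  have "emeasure (leb d) (space (leb d)) = emeasure lebesgue (dset d)"
    by (simp add: emeasure_restrict_space)
  also have "\<dots> \<le> emeasure lebesgue {lo d..hi d}"
    using dset_subset_Icc by (intro emeasure_mono) (auto simp: subset_iff)
  also have "\<dots> < \<infinity>" by (simp add: emeasure_lborel_Icc_eq)
  finally show "emeasure (leb d) (space (leb d)) \<noteq> \<infinity>" by simp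
qed

section \<open>Step functions on a uniform grid\<close>

text \<open>A C1 version of max 0 x whose slope rises linearly from 0 to 1 on [0, \<epsilon>]. It is
  exactly 0 to the left and exactly x - \<epsilon>/2 to the right, so its second differences have
  compact support.\<close>

definition ramp :: "real \<Rightarrow> real \<Rightarrow> real" where
  "ramp \<epsilon> x = ((max 0 x)\<^sup>2 - (max 0 (x - \<epsilon>))\<^sup>2) / (2 * \<epsilon>)"

definition ramp' :: "real \<Rightarrow> real \<Rightarrow> real" where
  "ramp' \<epsilon> x = (max 0 x - max 0 (x - \<epsilon>)) / \<epsilon>"

lemma ramp_deriv: "\<epsilon> > 0 \<Longrightarrow> (ramp \<epsilon> has_real_derivative ramp' \<epsilon> x) (at x)"
  unfolding ramp_def[abs_def] ramp'_def
  by (rule DERIV_cong[OF DERIV_cdivide[OF DERIV_diff[OF DERIV_max0_sq DERIV_chain2[OF DERIV_max0_sq]]]])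
     (auto intro!: derivative_eq_intros simp: field_simps)

lemma ramp'_bounds: "\<epsilon> > 0 \<Longrightarrow> 0 \<le> ramp' \<epsilon> x" "\<epsilon> > 0 \<Longrightarrow> ramp' \<epsilon> x \<le> 1"
  by (auto simp: ramp'_def max_def field_simps)

lemma ramp'_eq_0: "x \<le> 0 \<Longrightarrow> \<epsilon> > 0 \<Longrightarrow> ramp' \<epsilon> x = 0"
  by (auto simp: ramp'_def max_def)

lemma ramp'_eq_1: "\<epsilon> \<le> x \<Longrightarrow> \<epsilon> > 0 \<Longrightarrow> ramp' \<epsilon> x = 1"
  by (auto simp: ramp'_def max_def)

lemma ramp_eq_0: "x \<le> 0 \<Longrightarrow> \<epsilon> > 0 \<Longrightarrow> ramp \<epsilon> x = 0"
  by (auto simp: ramp_def max_def)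

lemma ramp_eq: "\<epsilon> \<le> x \<Longrightarrow> \<epsilon> > 0 \<Longrightarrow> ramp \<epsilon> x = x - \<epsilon> / 2"
  by (auto simp: ramp_def max_def field_simps power2_eq_square)

lemma ramp_close:
  assumes "\<epsilon> > 0" shows "\<bar>ramp \<epsilon> x - max 0 x\<bar> \<le> \<epsilon>"
proof -
  consider "x \<le> 0" | "0 < x" "x < \<epsilon>" | "\<epsilon> \<le> x" by linarith
  then show ?thesis
  proof cases
    case 2
    then have "x\<^sup>2 \<le> 2 * \<epsilon> * x" using assms by (simp add: power2_eq_square)
    then have "ramp \<epsilon> x \<le> x" "0 \<le> ramp \<epsilon> x" using 2 by (auto simp: ramp_def max_def field_simps)
    then show ?thesis using 2 by (simp add: max_def)
  qed (use assms in \<open>auto simp: ramp_eq_0 ramp_eq\<close>)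
qed

lemma ramp'_continuous: "continuous_on UNIV (ramp' \<epsilon>)"
  unfolding ramp'_def[abs_def] by (cases "\<epsilon> = 0") (auto intro!: continuous_intros)

locale grid =
  fixes d :: dom1 and n :: nat
  assumes valid: "valid_dom d" and n2: "2 \<le> n"
begin

definition h :: real where "h = (hi d - lo d) / real n"

definition node :: "nat \<Rightarrow> real" where "node i = lo d + real i * h"

definition cell :: "nat \<Rightarrow> real set" where "cell i = {node i..<node (Suc i)}"

text \<open>Cells are numbered cyclically. The edge between the last cell and cell 0 exists only on the circle,
  and \<open>ed\<close> is the indicator of the existing edges.\<close>

definition ed :: "nat \<Rightarrow> real" where "ed i = (if i = 0 \<and> d \<noteq> Circle then 0 else 1)"

definition ci :: "nat \<Rightarrow> rfun \<Rightarrow> real" where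
  "ci i f = (\<integral>x. indicator (cell i) x * f x \<partial>leb d)"

definition pc :: "(nat \<Rightarrow> real) \<Rightarrow> real \<Rightarrow> real" where
  "pc c x = (\<Sum>i<n. c i * indicator (cell i) x)"

lemma h_pos: "h > 0"
  using lo_less_hi[OF valid] n2 by (simp add: h_def)

lemma node_0: "node 0 = lo d" and node_n: "node n = hi d" and node_Suc: "node (Suc i) = node i + h"
proof -
  have "real n * h = hi d - lo d" using n2 by (simp add: h_def)
  then show "node n = hi d" by (simp add: node_def)
qed (auto simp: node_def distrib_right)

lemma node_mono: "i \<le> j \<Longrightarrow> node i \<le> node j"
  using h_pos by (simp add: node_def mult_right_mono)

lemma node_strict_mono: "i < j \<Longrightarrow> node i < node j"
  using h_pos by (simp add: node_def)

lemma node_range: "i \<le> n \<Longrightarrow> lo d \<le> node i \<and> node i \<le> hi d"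
  using node_mono[of 0 i] node_mono[of i n] node_0 node_n by simp

lemma node_in_dset: "i < n \<Longrightarrow> ed i = 1 \<Longrightarrow> node i \<in> dset d"
proof (cases "i = 0")
  case True
  assume "ed i = 1"
  with True have "d = Circle" by (auto simp: ed_def split: if_splits)
  with True show ?thesis using node_0 by simp
next
  case False
  assume "i < n"
  with False have "node i \<in> {lo d<..<hi d}"
    using node_strict_mono[of 0 i] node_strict_mono[of i n] node_0 node_n by simp
  then show ?thesis using open_subset_dset by blast
qed

lemma cell_borel [measurable]: "cell i \<in> sets borel" by (simp add: cell_def)

lemma in_cell_obtain:
  assumes "x \<in> dset d"
  obtains j where "j < n" "x \<in> cell j"
proof -
  have x: "lo d \<le> x" "x < hi d" using assms dset_subset[of d] by auto
  define j where "j = nat \<lfloor>(x - lo d) / h\<rfloor>"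
  have fl: "0 \<le> \<lfloor>(x - lo d) / h\<rfloor>" using x h_pos by simp
  have "real j \<le> (x - lo d) / h" "(x - lo d) / h < real j + 1"
    using fl by (auto simp: j_def)
  then have j: "real j * h \<le> x - lo d" "x - lo d < (real j + 1) * h"
    using h_pos by (auto simp: field_simps)
  then have c: "x \<in> cell j" by (auto simp: cell_def node_def algebra_simps)
  have "real j * h < real n * h" using j(1) x n2 by (simp add: h_def)
  then have "j < n" using h_pos by simp
  then show ?thesis using c that by blast
qed

lemma cell_unique: "x \<in> cell i \<Longrightarrow> x \<in> cell j \<Longrightarrow> i = j"
  using node_mono[of "Suc i" j] node_mono[of "Suc j" i] by (cases i j rule: linorder_cases) (auto simp: cell_def)

lemma pc_eq: "i < n \<Longrightarrow> x \<in> cell i \<Longrightarrow> pc c x = c i"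
proof -
  assume i: "i < n" "x \<in> cell i"
  have "pc c x = (\<Sum>j<n. if j = i then c j else 0)"
    unfolding pc_def using i cell_unique[of x] by (intro sum.cong) (auto simp: indicator_def)
  then show ?thesis using i by (simp add: sum.delta)
qed

lemma pc_measurable [measurable]: "pc c \<in> borel_measurable borel"
  unfolding pc_def[abs_def] by measurable

text \<open>Only almost everywhere: the closed interval adds the right end of the cell, and
  \<open>lo d\<close> is in cell 0 but outside an open interval domain.\<close>

lemma cell_AE:
  fixes f :: rfun
  assumes "i < n"
  shows "AE x in lborel. indicator (dset d) x * (indicator (cell i) x * f x) = f x * indicator {node i..node (Suc i)} x"
  using AE_lborel_singleton[of "node i"] AE_lborel_singleton[of "node (Suc i)"]
proof eventually_elim
  case (elim x)
  have "{node i<..<node (Suc i)} \<subseteq> dset d"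
    using node_range[of i] node_range[of "Suc i"] assms open_subset_dset[of d] by force
  then have "x \<in> {node i<..<node (Suc i)} \<Longrightarrow> x \<in> dset d" by blast
  then show ?case using elim by (auto simp: indicator_def cell_def)
qed

lemma cell_lebesgue_on [measurable]:
  "indicator (cell i) \<in> borel_measurable (leb d)" (is "?f \<in> _")
proof -
  have "?f \<in> borel_measurable borel" by measurable
  then show ?thesis by (intro measurable_restrict_space1 measurable_completion) simp
qed

lemma integrable_real_mult_indicator_cell:
  assumes "integrable (leb d) f"
  shows "integrable (leb d) (\<lambda>x. indicator (cell i) x * f x :: real)"
proof (rule Bochner_Integration.integrable_bound[OF assms])
  show "(\<lambda>x. indicator (cell i) x * f x) \<in> borel_measurable (leb d)"
    using assms by (intro borel_measurable_times cell_lebesgue_on) auto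
qed (auto intro!: AE_I2 simp: indicator_def)

lemma ci_FTC:
  assumes "i < n" "C1_test d \<psi> \<psi>'"
  shows "ci i \<psi>' = \<psi> (node (Suc i)) - \<psi> (node i)"
proof -
  have c: "continuous_on UNIV \<psi>'" by (rule C1_test_continuous[OF assms(2)])
  then have [measurable]: "\<psi>' \<in> borel_measurable borel" by (rule borel_measurable_continuous_onI)
  have "ci i \<psi>' = (\<integral>x. indicator (dset d) x * (indicator (cell i) x * \<psi>' x) \<partial>lborel)"
    unfolding ci_def by (rule integral_lebesgue_on_dset) measurable
  also have "\<dots> = (\<integral>x. \<psi>' x * indicator {node i..node (Suc i)} x \<partial>lborel)"
    by (rule integral_cong_AE[OF _ _ cell_AE[OF assms(1)]]) measurable
  also have "\<dots> = \<psi> (node (Suc i)) - \<psi> (node i)"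
  proof (rule integral_FTC_Icc_real)
    show "node i \<le> node (Suc i)" by (rule node_mono) simp
    show "DERIV \<psi> x :> \<psi>' x" for x using assms(2) by (simp add: C1_test_def)
    show "isCont \<psi>' x" for x using c by (simp add: continuous_on_eq_continuous_at)
  qed
  finally show ?thesis .
qed

lemma ci_one: "i < n \<Longrightarrow> ci i (\<lambda>x. 1) = h"
proof -
  assume i: "i < n"
  have "ci i (\<lambda>x. 1) = (\<integral>x. indicator (dset d) x * (indicator (cell i) x * 1) \<partial>lborel)"
    unfolding ci_def by (rule integral_lebesgue_on_dset) measurable
  also have "\<dots> = (\<integral>x. 1 * indicator {node i..node (Suc i)} x \<partial>lborel)"
    by (rule integral_cong_AE[OF _ _ cell_AE[OF i]]) measurable
  also have "\<dots> = h" using node_mono[of i "Suc i"] by (simp add: node_Suc)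
  finally show ?thesis .
qed

text \<open>A second difference of hinges instead of the usual formula in \<open>hat_eq\<close>, so
  that replacing each hinge by a \<open>ramp\<close> smooths it.\<close>

definition hat :: "nat \<Rightarrow> real \<Rightarrow> real" where
  "hat i x = (max 0 (x - (node i - h)) - 2 * max 0 (x - node i) + max 0 (x - (node i + h))) / h"

lemma hat_eq: "hat i x = max 0 (1 - \<bar>x - node i\<bar> / h)"
  using h_pos by (auto simp: hat_def max_def abs_if field_simps)

text \<open>The hat has slope 1/h on cell i - 1 and -1/h on cell i, so testing Du with it yields the
  difference of the cell integrals. Smoothing it and shrinking its support slightly makes it
  admissible, and dominated convergence removes both changes.\<close>

lemma tent_identity_interior:
  assumes pol: "polar d u \<nu> \<sigma>" and i: "0 < i" "i < n"
  shows "ci i u - ci (i - 1) u = h * (\<integral>x. hat i x * \<sigma> x \<partial>\<nu>)"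
proof -
  note u = polarD(1)[OF pol] and nu = polarD(2,3,4)[OF pol] and sig = polarD(5,6)[OF pol] and dual = polarD(7)[OF pol]
  note u[measurable] sig(1)[measurable]
  define c where "c = node i"
  have nodes: "node (i - 1) = c - h" "node (Suc i) = c + h" "lo d \<le> c - h" "c + h \<le> hi d"
    using i node_Suc[of "i-1"] node_Suc[of i] node_range[of "i - 1"] node_range[of "Suc i"] by (auto simp: c_def)
  \<comment> \<open>The factor 1/(k+3) ensures 3\<epsilon> \<le> h, which keeps the three kinks
    apart.\<close>
  define \<epsilon> where "\<epsilon> k = h * inverse (real (Suc (k + 2)))" for k :: nat
  have eps: "\<epsilon> k > 0" "3 * \<epsilon> k \<le> h" for k using h_pos by (auto simp: \<epsilon>_def field_simps)
  have eps0: "\<epsilon> \<longlonglongrightarrow> 0"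
    unfolding \<epsilon>_def using tendsto_mult[OF tendsto_const LIMSEQ_ignore_initial_segment[OF LIMSEQ_inverse_real_of_nat, of 2], of h]
    by simp
  \<comment> \<open>The outer kinks move inwards by 2\<epsilon> each, so the linear and constant
    parts still cancel to the right of all of them. The support ends at c + h - \<epsilon>, strictly
    inside the domain.\<close>
  let ?r1 = "\<lambda>r k x. r (\<epsilon> k) (x - (c - h + 2 * \<epsilon> k)) :: real" and ?r2 = "\<lambda>r k x. r (\<epsilon> k) (x - c) :: real"
    and ?r3 = "\<lambda>r k x. r (\<epsilon> k) (x - (c + h - 2 * \<epsilon> k)) :: real"
  define T where "T k x = (?r1 ramp k x - 2 * ?r2 ramp k x
      + ?r3 ramp k x) / h" for k x
  define T' where "T' k x = (?r1 ramp' k x - 2 * ?r2 ramp' k x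
      + ?r3 ramp' k x) / h" for k x
  have rd: "((\<lambda>x. ramp (\<epsilon> k) (x - s)) has_real_derivative ramp' (\<epsilon> k) (x - s)) (at x)" for k s x
    by (rule DERIV_cong[OF DERIV_chain2[OF ramp_deriv[OF eps(1)]]]) (auto intro!: derivative_eq_intros)
  have Td: "(T k has_real_derivative T' k x) (at x)" for k x
    unfolding T_def[abs_def] T'_def
    by (intro DERIV_cdivide DERIV_add DERIV_diff DERIV_cmult rd)
  have Tc: "continuous_on UNIV (T' k)" for k
    unfolding T'_def[abs_def] using h_pos
    by (intro continuous_intros continuous_on_compose2[OF ramp'_continuous[of "\<epsilon> k"]]) auto
  have Tz: "T k x = 0" if "x \<notin> {c - h + 2 * \<epsilon> k..c + h - \<epsilon> k}" for k x
  proof (cases "x < c - h + 2 * \<epsilon> k")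
    case True
    then show ?thesis using eps[of k] by (simp add: T_def ramp_eq_0)
  next
    case False
    then have x: "x > c + h - \<epsilon> k" using that by auto
    have "?r1 ramp k x = x - (c - h + 2 * \<epsilon> k) - \<epsilon> k / 2"
      "?r2 ramp k x = x - c - \<epsilon> k / 2"
      "?r3 ramp k x = x - (c + h - 2 * \<epsilon> k) - \<epsilon> k / 2"
      using x eps[of k] by (intro ramp_eq; linarith)+
    then show ?thesis by (simp add: T_def)
  qed
  have "\<exists>\<psi> \<psi>'. C1_test d \<psi> \<psi>' \<and> (\<forall>x\<in>{lo d..<hi d}. \<psi> x = T k x \<and> \<psi>' x = T' k x)" for k
  proof -
    have sub: "{c - h + 2 * \<epsilon> k..c + h - \<epsilon> k} \<subseteq> {lo d<..<hi d}"
    proof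
      fix x assume "x \<in> {c - h + 2 * \<epsilon> k..c + h - \<epsilon> k}"
      then show "x \<in> {lo d<..<hi d}" using nodes(3,4) eps[of k] by auto
    qed
    obtain \<psi> \<psi>' where "C1_test d \<psi> \<psi>'" "\<And>x. x \<in> {lo d..<hi d} \<Longrightarrow> \<psi> x = T k x \<and> \<psi>' x = T' k x"
      using C1_test_extend[OF compact_Icc sub Tz Tc Td] by blast
    then show ?thesis by blast
  qed
  then obtain \<psi> \<psi>' where psi: "\<And>k. C1_test d (\<psi> k) (\<psi>' k)"
    and eq: "\<And>k x. x \<in> {lo d..<hi d} \<Longrightarrow> \<psi> k x = T k x" "\<And>k x. x \<in> {lo d..<hi d} \<Longrightarrow> \<psi>' k x = T' k x"
    by metis
  have ident: "(\<integral>x. u x * T' k x \<partial>leb d) = - (\<integral>x. T k x * \<sigma> x \<partial>\<nu>)" for k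
  proof -
    have "(\<integral>x. u x * T' k x \<partial>leb d) = (\<integral>x. u x * \<psi>' k x \<partial>leb d)"
      using dset_subset[of d] eq(2)[of _ k] by (intro Bochner_Integration.integral_cong refl) (auto simp: subset_iff)
    also have "\<dots> = - (\<integral>x. \<psi> k x * \<sigma> x \<partial>\<nu>)" by (rule dual[OF psi])
    also have "(\<integral>x. \<psi> k x * \<sigma> x \<partial>\<nu>) = (\<integral>x. T k x * \<sigma> x \<partial>\<nu>)"
      using dset_subset[of d] eq(1)[of _ k] by (intro Bochner_Integration.integral_cong refl) (auto simp: subset_iff nu(3))
    finally show ?thesis .
  qed
  have T_hat: "\<bar>T k x - hat i x\<bar> \<le> 10 * \<epsilon> k / h" for k x
  proof -
    have 1: "\<bar>?r1 ramp k x - max 0 (x - (c - h))\<bar> \<le> 3 * \<epsilon> k"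
      using ramp_close[OF eps(1), of k "x - (c - h + 2 * \<epsilon> k)"] eps(1)[of k] by linarith
    have 2: "\<bar>?r2 ramp k x - max 0 (x - c)\<bar> \<le> \<epsilon> k"
      by (rule ramp_close[OF eps(1)])
    have 3: "\<bar>?r3 ramp k x - max 0 (x - (c + h))\<bar> \<le> 3 * \<epsilon> k"
      using ramp_close[OF eps(1), of k "x - (c + h - 2 * \<epsilon> k)"] eps(1)[of k] by linarith
    have "\<bar>T k x - hat i x\<bar> = \<bar>(?r1 ramp k x - max 0 (x - (c - h)))
      - 2 * (?r2 ramp k x - max 0 (x - c)) + (?r3 ramp k x - max 0 (x - (c + h)))\<bar> / h"
      using h_pos by (simp add: T_def hat_def c_def[symmetric] diff_divide_distrib[symmetric] abs_divide algebra_simps)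
    also have "\<dots> \<le> (10 * \<epsilon> k) / h"
    proof (rule divide_right_mono)
      have "\<bar>p - 2 * q + r\<bar> \<le> 10 * e" if "\<bar>p\<bar> \<le> 3 * e" "\<bar>q\<bar> \<le> e" "\<bar>r\<bar> \<le> 3 * e" for p q r e :: real
        using that by linarith
      from this[OF 1 2 3] show "\<bar>(?r1 ramp k x - max 0 (x - (c - h)))
        - 2 * (?r2 ramp k x - max 0 (x - c)) + (?r3 ramp k x - max 0 (x - (c + h)))\<bar> \<le> 10 * \<epsilon> k" .
    qed (use h_pos in simp)
    finally show ?thesis .
  qed
  have hat_m [measurable]: "hat i \<in> borel_measurable \<nu>"
    by (rule measurable_restrict_dset_continuous[OF nu(2)])
       (use h_pos in \<open>auto simp: hat_def[abs_def] intro!: continuous_intros\<close>)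
  have Tm [measurable]: "T k \<in> borel_measurable \<nu>" for k
    by (rule measurable_restrict_dset_continuous[OF nu(2)])
       (use Td in \<open>meson DERIV_isCont continuous_at_imp_continuous_on\<close>)
  have hat01: "0 \<le> hat i x" "hat i x \<le> 1" for x using h_pos by (auto simp: hat_eq)
  \<comment> \<open>The hat is at most 1 and the smoothing error 10\<epsilon>/h at most 10/3, so the
    constant 5 dominates.\<close>
  have lim1: "(\<lambda>k. \<integral>x. T k x * \<sigma> x \<partial>\<nu>) \<longlonglongrightarrow> (\<integral>x. hat i x * \<sigma> x \<partial>\<nu>)"
  proof (rule integral_dominated_convergence[where w="\<lambda>_. 5"])
    show "integrable \<nu> (\<lambda>_. 5)" by (rule finite_measure.integrable_const[OF nu(1)])
    show "AE x in \<nu>. (\<lambda>k. T k x * \<sigma> x) \<longlonglongrightarrow> hat i x * \<sigma> x"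
    proof (intro AE_I2 tendsto_mult tendsto_const)
      fix x
      have "(\<lambda>k. T k x - hat i x) \<longlonglongrightarrow> 0"
      proof (rule Lim_null_comparison[OF always_eventually])
        show "\<forall>k. norm (T k x - hat i x) \<le> 10 * \<epsilon> k / h" using T_hat by simp
        show "(\<lambda>k. 10 * \<epsilon> k / h) \<longlonglongrightarrow> 0"
          using tendsto_divide[OF tendsto_mult[OF tendsto_const[of 10] eps0] tendsto_const[of h]] h_pos by simp
      qed
      then show "(\<lambda>k. T k x) \<longlonglongrightarrow> hat i x" by (rule LIM_zero_cancel)
    qed
    show "AE x in \<nu>. norm (T k x * \<sigma> x) \<le> 5" for k
    proof (rule AE_I2)
      fix x assume "x \<in> space \<nu>"
      then have "\<bar>\<sigma> x\<bar> = 1" using sig(2) nu(3) by simp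
      moreover have "10 * \<epsilon> k / h \<le> 4" using eps(2)[of k] h_pos by (simp add: field_simps)
      then have "\<bar>T k x\<bar> \<le> 5" using T_hat[of k x] hat01[of x] by linarith
      ultimately show "norm (T k x * \<sigma> x) \<le> 5" by (simp add: abs_mult)
    qed
  qed measurable
  let ?g = "\<lambda>x. (indicator (cell (i - 1)) x - indicator (cell i) x) / h"
  have T'b: "\<bar>T' k x\<bar> \<le> 4 / h" for k x
  proof -
    have "\<bar>?r1 ramp' k x - 2 * ?r2 ramp' k x + ?r3 ramp' k x\<bar> \<le> 4"
      using ramp'_bounds[OF eps(1), of k "x - (c - h + 2 * \<epsilon> k)"] ramp'_bounds[OF eps(1), of k "x - c"]
        ramp'_bounds[OF eps(1), of k "x - (c + h - 2 * \<epsilon> k)"] by linarith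
    then show ?thesis using h_pos by (simp add: T'_def abs_divide divide_right_mono)
  qed
  \<comment> \<open>Away from the three limiting kinks each slope is eventually 0 or 1. A distance
    of 3\<epsilon> covers the shift by 2\<epsilon> and the transition zone of width
    \<epsilon>.\<close>
  have T'l: "(\<lambda>k. T' k x) \<longlonglongrightarrow> ?g x" if "x \<noteq> c - h" "x \<noteq> c" "x \<noteq> c + h" for x
  proof -
    have ev: "\<forall>\<^sub>F k in sequentially. 3 * \<epsilon> k < r" if "r > 0" for r
      using order_tendstoD(2)[OF tendsto_mult[OF tendsto_const[of 3] eps0], of r] that by simp
    have "\<forall>\<^sub>F k in sequentially. 3 * \<epsilon> k < \<bar>x - (c - h)\<bar>" "\<forall>\<^sub>F k in sequentially. 3 * \<epsilon> k < \<bar>x - c\<bar>"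
      "\<forall>\<^sub>F k in sequentially. 3 * \<epsilon> k < \<bar>x - (c + h)\<bar>" using that by (auto intro!: ev)
    then have "\<forall>\<^sub>F k in sequentially. T' k x = ?g x"
    proof eventually_elim
      case (elim k)
      note e = eps(1)[of k]
      have r1: "?r1 ramp' k x = (if x > c - h then 1 else 0)"
        using elim e by (auto intro!: ramp'_eq_1 ramp'_eq_0)
      have r2: "?r2 ramp' k x = (if x > c then 1 else 0)"
        using elim e by (auto intro!: ramp'_eq_1 ramp'_eq_0)
      have r3: "?r3 ramp' k x = (if x > c + h then 1 else 0)"
        using elim e by (auto intro!: ramp'_eq_1 ramp'_eq_0)
      have cells: "cell (i - 1) = {c - h..<c}" "cell i = {c..<c + h}"
        using nodes i by (auto simp: cell_def c_def)
      show ?case unfolding T'_def r1 r2 r3 cells using h_pos that by (auto simp: indicator_def)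
    qed
    then show ?thesis by (rule tendsto_eventually)
  qed
  have lim2: "(\<lambda>k. \<integral>x. u x * T' k x \<partial>leb d) \<longlonglongrightarrow> ip d u ?g"
  proof (rule integral_dominated_convergence[where w="\<lambda>x. 4 / h * \<bar>u x\<bar>"])
    have [measurable]: "T' k \<in> borel_measurable (leb d)" for k
      by (rule continuous_measurable_lebesgue_on[OF Tc])
    show "(\<lambda>x. u x * T' k x) \<in> borel_measurable (leb d)" for k by measurable
    have "?g \<in> borel_measurable borel" by measurable
    then have "?g \<in> borel_measurable (leb d)"
      by (intro measurable_restrict_space1 measurable_completion) simp
    then show "(\<lambda>x. u x * ?g x) \<in> borel_measurable (leb d)" by measurable
    show "integrable (leb d) (\<lambda>x. 4 / h * \<bar>u x\<bar>)" using u by (intro integrable_mult_right integrable_abs)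
    have "dset d \<in> sets lebesgue" by simp
    note ne = AE_lebesgue_on_neq[OF this]
    show "AE x in leb d. (\<lambda>k. u x * T' k x) \<longlonglongrightarrow> u x * ?g x"
      using ne[of "c - h"] ne[of c] ne[of "c + h"]
      by eventually_elim (intro tendsto_mult tendsto_const T'l)
    show "AE x in leb d. norm (u x * T' k x) \<le> 4 / h * \<bar>u x\<bar>" for k
      using mult_right_mono[OF T'b, of "\<bar>u x\<bar>" k x for x] by (intro AE_I2) (simp add: abs_mult mult.commute)
  qed
  have ind: "integrable (leb d) (\<lambda>x. indicator (cell j) x * u x)" for j
    by (rule integrable_real_mult_indicator_cell[OF u])
  have "ip d u ?g = (\<integral>x. (indicator (cell (i-1)) x * u x - indicator (cell i) x * u x) / h \<partial>leb d)"
    by (intro Bochner_Integration.integral_cong refl) (simp add: algebra_simps)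
  also have "\<dots> = (ci (i-1) u - ci i u) / h"
    unfolding ci_def using ind by simp
  finally have g: "ip d u ?g = (ci (i-1) u - ci i u) / h" .
  have "(ci (i-1) u - ci i u) / h = - (\<integral>x. hat i x * \<sigma> x \<partial>\<nu>)"
    using LIMSEQ_unique[OF lim2 tendsto_minus[OF lim1, folded ident]] g by simp
  then show ?thesis using h_pos by (simp add: field_simps)
qed


lemma ed_cases: "ed i = 0 \<or> ed i = 1" and ed_pos: "0 < i \<Longrightarrow> ed i = 1" and ed_0: "ed i = 0 \<Longrightarrow> i = 0 \<and> d \<noteq> Circle"
  by (auto simp: ed_def split: if_splits)

lemma abs_ed: "\<bar>ed i\<bar> = ed i"
  by (simp add: ed_def)

text \<open>On the circle the hat function of node 0 wraps around and is not the periodic extension of a function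
  supported inside \<open>(0, 1)\<close>. Taking it as the complement of the others reduces it to the test function 1.\<close>

definition tent :: "nat \<Rightarrow> real \<Rightarrow> real" where
  "tent i x = (if i = 0 then ed 0 * (1 - (\<Sum>i\<in>{1..<n}. hat i x)) else hat i x)"

section \<open>Sums, supports and masses of the hat functions\<close>

lemma hat_in_cell:
  assumes "x \<in> cell j"
  shows "hat i x = (if i = j then 1 - (x - node j) / h else if i = Suc j then (x - node j) / h else 0)"
proof -
  have x: "node j \<le> x" "x < node j + h" using assms by (auto simp: cell_def node_Suc)
  consider "i < j" | "i = j" | "i = Suc j" | "Suc (Suc j) \<le> i" by linarith
  then show ?thesis
  proof cases
    case 1
    then have "node (Suc i) \<le> node j" by (intro node_mono) simp
    then have "h \<le> x - node i" using x by (simp add: node_Suc)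
    then show ?thesis using 1 h_pos by (simp add: hat_eq field_simps)
  next
    case 2
    then show ?thesis using x h_pos by (simp add: hat_eq field_simps)
  next
    case 3
    then show ?thesis using x h_pos by (simp add: hat_eq node_Suc field_simps)
  next
    case 4
    then have "node (Suc (Suc j)) \<le> node i" by (rule node_mono)
    then have "h \<le> node i - x" using x by (simp add: node_Suc)
    then show ?thesis using 4 h_pos by (simp add: hat_eq field_simps)
  qed
qed

text \<open>Nodes 0 and n carry no hat in this sum, so it falls short of 1 only on the first and the
  last cell; on the circle that deficit is \<open>tent 0\<close>.\<close>

lemma hat_sum:
  assumes "x \<in> cell j" "j < n"
  shows "(\<Sum>i\<in>{1..<n}. hat i x) = (if 0 < j then 1 - (x - node j) / h else 0) + (if Suc j < n then (x - node j) / h else 0)"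
proof -
  have "(\<Sum>i\<in>{1..<n}. hat i x) = (\<Sum>i\<in>{1..<n}. (if i = j then 1 - (x - node j) / h else 0) + (if i = Suc j then (x - node j) / h else 0))"
    by (intro sum.cong refl) (simp add: hat_in_cell[OF assms(1)])
  also have "\<dots> = (if 0 < j then 1 - (x - node j) / h else 0) + (if Suc j < n then (x - node j) / h else 0)"
    unfolding sum.distrib using assms(2) by (simp add: sum.delta)
  finally show ?thesis .
qed

lemma hat_sum_bounds:
  assumes "x \<in> dset d"
  shows "(\<Sum>i\<in>{1..<n}. hat i x) \<le> 1"
proof -
  obtain j where j: "j < n" "x \<in> cell j" using in_cell_obtain[OF assms] .
  then have "0 \<le> (x - node j) / h" "(x - node j) / h \<le> 1" using h_pos by (auto simp: cell_def node_Suc field_simps)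
  then show ?thesis unfolding hat_sum[OF j(2,1)] by auto
qed

lemma hat_nonneg: "0 \<le> hat i x"
  by (simp add: hat_eq)

lemma tent_nonneg: "x \<in> dset d \<Longrightarrow> 0 \<le> tent i x"
  using hat_sum_bounds[of x] hat_nonneg ed_cases[of 0] by (auto simp: tent_def)

lemma sum_lessThan_split: "(\<Sum>i<n. f i) = f 0 + (\<Sum>i\<in>{1..<n}. f i)" for f :: "nat \<Rightarrow> real"
proof -
  have "{..<n} = insert 0 {1..<n}" using n2 by auto
  then show ?thesis by simp
qed

lemma tent_sum_le_1:
  assumes "x \<in> dset d" shows "(\<Sum>i<n. tent i x) \<le> 1"
proof -
  have "(\<Sum>i<n. tent i x) = tent 0 x + (\<Sum>i\<in>{1..<n}. hat i x)"
    unfolding sum_lessThan_split by (simp add: tent_def)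
  then show ?thesis using hat_sum_bounds[OF assms] ed_cases[of 0] by (auto simp: tent_def)
qed

lemma tent_le_1:
  assumes "x \<in> dset d" "i < n" shows "tent i x \<le> 1"
  using member_le_sum[of i "{..<n}" "\<lambda>i. tent i x"] tent_nonneg[OF assms(1)] tent_sum_le_1[OF assms(1)] assms(2)
  by simp

text \<open>The second alternative is the tent of node 0 on the circle, half of which sits in the
  last cell.\<close>

lemma tent_support:
  assumes x: "x \<in> dset d" and nz: "tent i x \<noteq> 0"
  shows "\<bar>x - node i\<bar> \<le> h \<or> i = 0 \<and> \<bar>x - hi d\<bar> \<le> h"
proof (cases "i = 0")
  case False
  then have "hat i x \<noteq> 0" using nz by (simp add: tent_def)
  then have "\<bar>x - node i\<bar> / h \<le> 1" by (auto simp: hat_eq max_def split: if_splits)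
  then show ?thesis using h_pos by simp
next
  case True
  obtain j where j: "j < n" "x \<in> cell j" using in_cell_obtain[OF x] .
  have s: "(\<Sum>i\<in>{1..<n}. hat i x) \<noteq> 1" using nz True by (auto simp: tent_def)
  have "j = 0 \<or> Suc j = n"
    using s j(1) unfolding hat_sum[OF j(2,1)] by (auto split: if_splits)
  moreover have "\<bar>x - node j\<bar> \<le> h" "\<bar>x - node (Suc j)\<bar> \<le> h" using j by (auto simp: cell_def node_Suc)
  ultimately show ?thesis using True node_n by auto
qed

lemma hat_continuous: "continuous_on UNIV (hat i)"
  unfolding hat_def[abs_def] using h_pos by (auto intro!: continuous_intros)

lemma tent_continuous: "continuous_on UNIV (tent i)"
  unfolding tent_def[abs_def] by (cases "i = 0") (auto intro!: continuous_intros hat_continuous)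

lemma tent_integrable:
  assumes "finite_measure \<nu>" "sets \<nu> = sets (bor d)" "i < n"
  shows "integrable \<nu> (tent i)"
proof (rule integrable_bounded_dset[OF assms(1,2) measurable_restrict_dset_continuous[OF assms(2) tent_continuous]])
  show "\<bar>tent i x\<bar> \<le> 1" if "x \<in> dset d" for x using tent_nonneg[OF that] tent_le_1[OF that assms(3)] by simp
qed

lemma tent_mass:
  assumes "finite_measure \<nu>" "sets \<nu> = sets (bor d)"
  shows "(\<Sum>i<n. \<integral>x. tent i x \<partial>\<nu>) \<le> measure \<nu> (dset d)"
proof -
  have sp: "space \<nu> = dset d" using sets_eq_imp_space_eq[OF assms(2)] by (simp add: space_restrict_space)
  have "(\<Sum>i<n. \<integral>x. tent i x \<partial>\<nu>) = (\<integral>x. (\<Sum>i<n. tent i x) \<partial>\<nu>)"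
    by (rule Bochner_Integration.integral_sum[symmetric]) (use tent_integrable[OF assms] in simp)
  also have "\<dots> \<le> (\<integral>x. 1 \<partial>\<nu>)"
  proof (rule integral_mono)
    show "integrable \<nu> (\<lambda>x. \<Sum>i<n. tent i x)"
      by (intro Bochner_Integration.integrable_sum) (use tent_integrable[OF assms] in simp)
    show "integrable \<nu> (\<lambda>x. 1 :: real)" by (rule finite_measure.integrable_const[OF assms(1)])
  qed (use tent_sum_le_1 sp in auto)
  also have "\<dots> = measure \<nu> (dset d)" by (simp add: sp)
  finally show ?thesis .
qed

text \<open>For node 0 of the circle, testing Du with the constant 1 shows that the integral of
  \<sigma> vanishes. The tent, 1 minus the hats, then gives minus the sum of the interior
  differences, which telescopes to the jump across the seam.\<close>

lemma tent_identity:
  assumes pol: "polar d u \<nu> \<sigma>" and i: "i < n" "ed i = 1"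
  shows "ci i u - ci (prv n i) u = h * (\<integral>x. tent i x * \<sigma> x \<partial>\<nu>)"
proof (cases "i = 0")
  case False
  then have "tent i = hat i" by (auto simp: tent_def)
  then show ?thesis using tent_identity_interior[OF pol, of i] False i by (simp add: prv_def)
next
  case True
  then have C: "d = Circle" using i by (auto simp: ed_def split: if_splits)
  note nu = polarD(2,3,4)[OF pol] and sig = polarD(5,6)[OF pol]
  have hs: "integrable \<nu> (\<lambda>x. hat j x * \<sigma> x)" for j
  proof (rule integrable_bounded_dset[OF nu(1,2)])
    show "(\<lambda>x. hat j x * \<sigma> x) \<in> borel_measurable \<nu>"
      using measurable_restrict_dset_continuous[OF nu(2) hat_continuous] sig(1) by (intro borel_measurable_times)
    show "\<bar>hat j x * \<sigma> x\<bar> \<le> 1" if "x \<in> dset d" for x using sig(2)[OF that] h_pos by (simp add: abs_mult hat_eq)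
  qed
  have isig: "integrable \<nu> \<sigma>"
    by (rule integrable_bounded_dset[OF nu(1,2) sig(1)]) (use sig(2) in force)
  have "(\<integral>x. u x * 0 \<partial>leb d) = - (\<integral>x. 1 * \<sigma> x \<partial>\<nu>)"
    by (rule polarD(7)[OF pol]) (use C1_test_one_Circle C in simp)
  then have s0: "(\<integral>x. \<sigma> x \<partial>\<nu>) = 0" by simp
  have tele: "(\<Sum>j\<in>{1..<n}. f j - f (j - 1)) = f (n - 1) - f 0" for f :: "nat \<Rightarrow> real"
  proof -
    have "(\<Sum>j\<in>{1..<n}. f j - f (j - 1)) = (\<Sum>j<n - 1. f (Suc j) - f j)"
      by (rule sum.reindex_bij_witness[of _ Suc "\<lambda>j. j - 1"]) auto
    then show ?thesis by (simp add: sum_lessThan_telescope)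
  qed
  have "h * (\<integral>x. tent 0 x * \<sigma> x \<partial>\<nu>) = h * (\<integral>x. \<sigma> x - (\<Sum>j\<in>{1..<n}. hat j x * \<sigma> x) \<partial>\<nu>)"
    using True i by (simp add: tent_def left_diff_distrib sum_distrib_right)
  also have "(\<integral>x. \<sigma> x - (\<Sum>j\<in>{1..<n}. hat j x * \<sigma> x) \<partial>\<nu>) = (\<integral>x. \<sigma> x \<partial>\<nu>) - (\<Sum>j\<in>{1..<n}. \<integral>x. hat j x * \<sigma> x \<partial>\<nu>)"
    using hs isig by (subst Bochner_Integration.integral_diff) auto
  also have "h * \<dots> = - (\<Sum>j\<in>{1..<n}. h * (\<integral>x. hat j x * \<sigma> x \<partial>\<nu>))"
    using s0 by (simp add: sum_distrib_left)
  also have "\<dots> = - (\<Sum>j\<in>{1..<n}. ci j u - ci (j - 1) u)"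
    using tent_identity_interior[OF pol] by simp
  also have "\<dots> = ci 0 u - ci (n - 1) u" unfolding tele[of "\<lambda>j. ci j u"] by simp
  finally show ?thesis using True by (simp add: prv_def)
qed

text \<open>Serves twice: for the initial datum it puts the cell averages into the invariant set,
  and for a general u it bounds |Du| from below in \<open>flux_bound\<close>.\<close>

lemma cell_jump_bound:
  assumes pol: "polar d u \<nu> \<sigma>" and i: "i < n" "ed i = 1"
  shows "\<bar>ci i u - ci (prv n i) u\<bar> \<le> h * (\<integral>x. tent i x \<partial>\<nu>)"
proof -
  note nu = polarD(2,3,4)[OF pol] and sig = polarD(5,6)[OF pol]
  have tm: "tent i \<in> borel_measurable \<nu>" by (rule measurable_restrict_dset_continuous[OF nu(2) tent_continuous])
  have ti: "integrable \<nu> (tent i)" by (rule tent_integrable[OF nu(1,2) i(1)])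
  have "\<bar>\<integral>x. tent i x * \<sigma> x \<partial>\<nu>\<bar> \<le> (\<integral>x. \<bar>tent i x * \<sigma> x\<bar> \<partial>\<nu>)" by (rule integral_abs_bound)
  also have "\<dots> = (\<integral>x. tent i x \<partial>\<nu>)"
    using sig(2) tent_nonneg by (intro Bochner_Integration.integral_cong refl) (simp add: abs_mult nu(3))
  finally show ?thesis unfolding tent_identity[OF assms] using h_pos by (simp add: abs_mult)
qed

text \<open>Weak duality for every BV function, not just for step functions: after summation by
  parts the flux is at most \<open>lam\<close>, each jump of cell integrals is at most h times a
  tent mass, and the tents sum to at most 1.\<close>

lemma flux_bound:
  assumes pol: "polar d u \<nu> \<sigma>" and Z: "\<And>i. i < n \<Longrightarrow> \<bar>Z i\<bar> \<le> lam * ed i" and lam: "0 < lam"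
  shows "- (\<Sum>i<n. (Z (nxt n i) - Z i) * ci i u) \<le> lam * h * measure \<nu> (dset d)"
proof -
  note nu = polarD(2,3,4)[OF pol]
  have nn: "0 \<le> (\<integral>x. tent i x \<partial>\<nu>)" for i
    by (rule Bochner_Integration.integral_nonneg) (simp add: nu(3) tent_nonneg)
  have "- (\<Sum>i<n. (Z (nxt n i) - Z i) * ci i u) = (\<Sum>i<n. Z i * (ci i u - ci (prv n i) u))"
    unfolding cyclic_sum_by_parts[of Z n "\<lambda>i. ci i u"] by simp
  also have "\<dots> \<le> (\<Sum>i<n. lam * (h * (\<integral>x. tent i x \<partial>\<nu>)))"
  proof (rule sum_mono)
    fix i assume "i \<in> {..<n}"
    then have i: "i < n" by simp
    show "Z i * (ci i u - ci (prv n i) u) \<le> lam * (h * (\<integral>x. tent i x \<partial>\<nu>))"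
    proof (cases "ed i = 1")
      case True
      have "Z i * (ci i u - ci (prv n i) u) \<le> \<bar>Z i\<bar> * \<bar>ci i u - ci (prv n i) u\<bar>"
        by (metis abs_ge_self abs_mult)
      also have "\<dots> \<le> lam * (h * (\<integral>x. tent i x \<partial>\<nu>))"
        using Z[OF i] True cell_jump_bound[OF pol i True] lam by (intro mult_mono) auto
      finally show ?thesis .
    next
      case False
      then have "Z i = 0" using Z[OF i] ed_cases[of i] by auto
      then show ?thesis using lam h_pos nn[of i] by simp
    qed
  qed
  also have "\<dots> = lam * h * (\<Sum>i<n. \<integral>x. tent i x \<partial>\<nu>)" by (simp add: sum_distrib_left mult.assoc)
  also have "\<dots> \<le> lam * h * measure \<nu> (dset d)"
    using tent_mass[OF nu(1,2)] lam h_pos by (intro mult_left_mono) auto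
  finally show ?thesis .
qed

section \<open>Pairings and total variation of step functions\<close>

lemma integral_pc_mult:
  assumes "integrable (leb d) f"
  shows "ip d (pc c) f = (\<Sum>i<n. c i * ci i f)"
    and "integrable (leb d) (\<lambda>x. pc c x * f x)"
proof -
  have eq: "(\<lambda>x. pc c x * f x) = (\<lambda>x. \<Sum>i<n. c i * (indicator (cell i) x * f x))"
    by (simp add: pc_def sum_distrib_right mult.assoc del: sum_mult_indicator sum_indicator_mult)
  have i: "integrable (leb d) (\<lambda>x. c i * (indicator (cell i) x * f x))" for i
    by (intro integrable_mult_right integrable_real_mult_indicator_cell assms)
  show "ip d (pc c) f = (\<Sum>i<n. c i * ci i f)"
    unfolding eq ci_def using i by (subst Bochner_Integration.integral_sum) auto
  show "integrable (leb d) (\<lambda>x. pc c x * f x)"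
    unfolding eq by (intro Bochner_Integration.integrable_sum i)
qed

lemma pc_lebesgue_on [measurable]: "pc c \<in> borel_measurable (leb d)"
  by (intro measurable_restrict_space1 measurable_completion) simp

lemma pc_integrable: "integrable (leb d) (pc c)"
  using integral_pc_mult(2)[OF finite_measure.integrable_const[OF finite_measure_lebesgue_on_dset, of d 1], of c] by simp

lemma pc_L2: "L2 d (pc c)"
  unfolding L2_def power2_eq_square using integral_pc_mult(2)[OF pc_integrable] pc_lebesgue_on by simp

lemma ci_pc:
  assumes "i < n" shows "ci i (pc c) = h * c i"
proof -
  have "ci i (pc c) = (\<integral>x. c i * (indicator (cell i) x * 1) \<partial>leb d)"
    unfolding ci_def by (intro Bochner_Integration.integral_cong refl) (use pc_eq[OF assms] in \<open>auto simp: indicator_def\<close>)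
  also have "\<dots> = c i * ci i (\<lambda>x. 1)" unfolding ci_def by (rule integral_mult_right_zero)
  finally show ?thesis using ci_one[OF assms] by simp
qed

lemma node_nxt:
  assumes "i < n" "Cc_test d \<psi>" shows "\<psi> (node (Suc i)) = \<psi> (node (nxt n i))"
  using Cc_test_lo_hi[OF valid assms(2)] node_0 node_n by (auto simp: nxt_def)

lemma pc_dual:
  assumes t: "C1_test d \<psi> \<psi>'"
  shows "ip d (pc c) \<psi>' = - (\<Sum>i<n. ed i * (\<psi> (node i) * (c i - c (prv n i))))"
proof -
  have cc: "Cc_test d \<psi>" using t by (simp add: C1_test_def)
  obtain C where C: "\<And>x. x \<in> dset d \<Longrightarrow> \<bar>\<psi>' x\<bar> \<le> C" using test_bounded[OF t] by metis
  have i: "integrable (leb d) \<psi>'"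
    by (rule finite_measure.integrable_const_bound[OF finite_measure_lebesgue_on_dset, where B=C])
       (use C continuous_measurable_lebesgue_on[OF C1_test_continuous(2)[OF t]] in auto)
  have "ip d (pc c) \<psi>' = (\<Sum>i<n. (\<psi> (node (nxt n i)) - \<psi> (node i)) * c i)"
    unfolding integral_pc_mult(1)[OF i]
    by (intro sum.cong refl) (simp add: ci_FTC[OF _ t] node_nxt[OF _ cc])
  also have "\<dots> = - (\<Sum>i<n. \<psi> (node i) * (c i - c (prv n i)))"
    by (rule cyclic_sum_by_parts)
  \<comment> \<open>On an interval node 0 is the left endpoint, where test functions vanish, so the
    weight can be inserted.\<close>
  also have "(\<Sum>i<n. \<psi> (node i) * (c i - c (prv n i))) = (\<Sum>i<n. ed i * (\<psi> (node i) * (c i - c (prv n i))))"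
  proof (rule sum.cong[OF refl])
    fix i
    have "ed i = 1 \<or> \<psi> (node i) = 0"
    proof (cases "ed i = 0")
      case True
      then have "i = 0" "d \<noteq> Circle" using ed_0 by auto
      then obtain a b where "d = Interval a b" by (cases d) auto
      then show ?thesis using Cc_test_lo_Interval[of a b \<psi>] cc node_0 \<open>i = 0\<close> by simp
    qed (use ed_cases in blast)
    then show "\<psi> (node i) * (c i - c (prv n i)) = ed i * (\<psi> (node i) * (c i - c (prv n i)))" by auto
  qed
  finally show ?thesis .
qed

text \<open>The derivative of a step function consists of point masses at the nodes. The measure
  \<rho> is the image of a point measure on the edge indices, and
  \<open>dominated_functional\<close> turns the estimate for test functions into a total variation
  measure. An upper bound for \<open>TV\<close> suffices, as step functions occur on the larger side
  of the subdifferential inequality.\<close>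

lemma pc_TV:
  "is_BV d (pc c)" "TV d (pc c) \<le> ereal (\<Sum>i<n. ed i * \<bar>c i - c (prv n i)\<bar>)"
proof -
  define E where "E = {i. i < n \<and> ed i = 1}"
  have fE: "finite E" by (simp add: E_def)
  define J where "J i = \<bar>c i - c (prv n i)\<bar>" for i
  define P where "P = point_measure E (\<lambda>i. ennreal (J i))"
  define \<rho> where "\<rho> = distr P (bor d) node"
  have nm: "node \<in> measurable P (bor d)"
    unfolding P_def by (auto simp: measurable_def sets_point_measure space_point_measure space_restrict_space E_def node_in_dset)
  have sets: "sets \<rho> = sets (bor d)" by (simp add: \<rho>_def)
  have Esum: "(\<Sum>i\<in>E. g i) = (\<Sum>i<n. ed i * g i)" for g :: "nat \<Rightarrow> real"
  proof -
    have "(\<Sum>i\<in>E. g i) = (\<Sum>i\<in>E. ed i * g i)" by (rule sum.cong) (auto simp: E_def)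
    also have "\<dots> = (\<Sum>i<n. ed i * g i)"
      by (rule sum.mono_neutral_left) (use ed_cases in \<open>auto simp: E_def\<close>)
    finally show ?thesis .
  qed
  have int: "(\<integral>x. f x \<partial>\<rho>) = (\<Sum>i<n. ed i * (J i * f (node i)))" if f: "f \<in> borel_measurable (bor d)" for f :: rfun
  proof -
    have "(\<integral>x. f x \<partial>\<rho>) = (\<integral>i. f (node i) \<partial>P)" unfolding \<rho>_def by (rule integral_distr[OF nm f])
    also have "\<dots> = (\<Sum>i\<in>E. J i * f (node i))"
      unfolding P_def by (subst lebesgue_integral_point_measure_finite[OF fE]) (auto simp: J_def)
    finally show ?thesis unfolding Esum .
  qed
  have dset_in: "dset d \<in> sets (bor d)" by (simp add: sets_restrict_space_iff)
  have finP: "emeasure P (space P) < top"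
    unfolding P_def using fE by (simp add: space_point_measure emeasure_point_measure_finite sum_ennreal J_def)
  have fin: "finite_measure \<rho>"
  proof
    have "emeasure \<rho> (space \<rho>) = emeasure P (space P)"
      unfolding \<rho>_def using nm dset_in
      by (subst emeasure_distr) (auto simp: space_restrict_space intro!: arg_cong[where f="emeasure P"] dest: measurable_space)
    then show "emeasure \<rho> (space \<rho>) \<noteq> \<infinity>" using finP by simp
  qed
  have bound: "\<bar>ip d (pc c) \<psi>'\<bar> \<le> (\<integral>x. \<bar>\<psi> x\<bar> \<partial>\<rho>)" if t: "C1_test d \<psi> \<psi>'" for \<psi> \<psi>'
  proof -
    have m: "(\<lambda>x. \<bar>\<psi> x\<bar>) \<in> borel_measurable (bor d)"
      using measurable_restrict_dset_continuous[OF refl C1_test_continuous(1)[OF t]] by simp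
    have "\<bar>ip d (pc c) \<psi>'\<bar> \<le> (\<Sum>i<n. \<bar>ed i * (\<psi> (node i) * (c i - c (prv n i)))\<bar>)"
      unfolding pc_dual[OF t] abs_minus_cancel by (rule sum_abs)
    also have "\<dots> = (\<integral>x. \<bar>\<psi> x\<bar> \<partial>\<rho>)"
      unfolding int[OF m] J_def by (intro sum.cong refl) (simp add: abs_mult mult.commute abs_ed)
    finally show ?thesis .
  qed
  interpret dominated_functional d "pc c" \<rho>
    by (intro dominated_functional.intro valid pc_integrable fin sets bound)
  obtain \<nu> where nu: "is_TV_measure d (pc c) \<nu>" using tv_measure_exists by (elim exE conjE)
  show bv: "is_BV d (pc c)" unfolding is_BV_def using nu by (rule exI)
  have some: "is_TV_measure d (pc c) (SOME \<nu>. is_TV_measure d (pc c) \<nu>)" using nu by (rule someI)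
  have "measure (SOME \<nu>. is_TV_measure d (pc c) \<nu>) (dset d) \<le> measure \<rho> (dset d)"
    by (rule tv_mass_le[OF valid some fin sets bound])
  also have "measure \<rho> (dset d) = (\<integral>x. 1 \<partial>\<rho>)" by (simp add: \<rho>_def space_restrict_space)
  also have "\<dots> = (\<Sum>i<n. ed i * J i)" by (subst int) auto
  finally show "TV d (pc c) \<le> ereal (\<Sum>i<n. ed i * \<bar>c i - c (prv n i)\<bar>)"
    unfolding TV_def using bv by (simp add: J_def)
qed

section \<open>The resolvent step in L2\<close>

definition jump_le :: "(nat \<Rightarrow> real) \<Rightarrow> (nat \<Rightarrow> real) \<Rightarrow> bool" where
  "jump_le b c \<longleftrightarrow> (\<forall>i<n. ed i = 1 \<longrightarrow> \<bar>c i - c (prv n i)\<bar> \<le> b i)"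

lemma pc_diff: "pc y x - pc w x = pc (\<lambda>i. y i - w i) x"
  by (simp add: pc_def sum_subtractf left_diff_distrib del: sum_mult_indicator sum_indicator_mult)

text \<open>The second claim is monotonicity of the subdifferential between u and
  \<open>pc w\<close>, with the difference of \<open>pc y\<close> and \<open>pc w\<close>, divided
  by \<open>lam\<close>, acting as subgradient at \<open>pc w\<close>. It is the sum of two
  inequalities: the one of u tested with \<open>pc w\<close>, and \<open>flux_bound\<close> for u
  combined with complementarity. One w serves every u and v, hence all times of an interval at
  once.\<close>

lemma resolvent:
  assumes lam: "0 < lam"
  shows "\<exists>w. (\<forall>b. jump_le b y \<longrightarrow> jump_le b w) \<and>
    (\<forall>u v. in_subdiff_TV d u (\<lambda>x. - v x) \<longrightarrow>
      (\<integral>x. v x * (u x - pc w x) \<partial>leb d)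
        \<le> - ip d (\<lambda>x. pc y x - pc w x) (\<lambda>x. u x - pc w x) / lam)"
proof -
  obtain w Z where w: "\<And>i. i < n \<Longrightarrow> h * (w i - y i) = Z (nxt n i) - Z i"
    and Z: "\<And>i. i < n \<Longrightarrow> \<bar>Z i\<bar> \<le> lam * ed i"
    and slack: "\<And>i. i < n \<Longrightarrow> Z i * (w i - w (prv n i)) = lam * (ed i * \<bar>w i - w (prv n i)\<bar>)"
    and contr: "\<And>i. i < n \<Longrightarrow> ed i = 1 \<Longrightarrow> \<bar>w i - w (prv n i)\<bar> \<le> \<bar>y i - y (prv n i)\<bar>"
    using discrete_resolvent[where y=y and e=ed, OF n2 h_pos lam ed_cases] by blast
  define V where "V = (\<Sum>i<n. ed i * \<bar>w i - w (prv n i)\<bar>)"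
  \<comment> \<open>h(w - y) is a difference of Z. So \<open>flux_bound\<close> handles the part
    containing u, and the complementarity in \<open>slack\<close> evaluates the part containing w to
    \<open>lam * V\<close>.\<close>
  have main: "ip d (\<lambda>x. pc y x - pc w x) (\<lambda>x. u x - pc w x) \<le> lam * measure \<nu> (dset d) - lam * V"
    if pol: "polar d u \<nu> \<sigma>" for u \<nu> \<sigma>
  proof -
    have u: "integrable (leb d) u" by (rule polarD(1)[OF pol])
    have uw: "integrable (leb d) (\<lambda>x. u x - pc w x)"
      using u pc_integrable by (rule Bochner_Integration.integrable_diff)
    have ciu: "ci i (\<lambda>x. u x - pc w x) = ci i u - h * w i" if "i < n" for i
    proof -
      have "ci i (\<lambda>x. u x - pc w x) = ci i u - ci i (pc w)"
        unfolding ci_def right_diff_distrib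
        by (intro Bochner_Integration.integral_diff integrable_real_mult_indicator_cell u pc_integrable)
      then show ?thesis using ci_pc[OF that] by simp
    qed
    have "h * ip d (\<lambda>x. pc y x - pc w x) (\<lambda>x. u x - pc w x)
      = (\<Sum>i<n. h * ((y i - w i) * ci i (\<lambda>x. u x - pc w x)))"
      unfolding pc_diff[of y _ w] integral_pc_mult(1)[OF uw] by (rule sum_distrib_left)
    also have "\<dots> = (\<Sum>i<n. - ((Z (nxt n i) - Z i) * ci i u) + h * ((Z (nxt n i) - Z i) * w i))"
    proof (rule sum.cong[OF refl])
      fix i assume "i \<in> {..<n}"
      then have i: "i < n" by simp
      have "h * ((y i - w i) * (ci i u - h * w i)) = - ((h * (w i - y i)) * ci i u) + h * ((h * (w i - y i)) * w i)"
        by (simp add: algebra_simps)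
      then show "h * ((y i - w i) * ci i (\<lambda>x. u x - pc w x)) = - ((Z (nxt n i) - Z i) * ci i u) + h * ((Z (nxt n i) - Z i) * w i)"
        unfolding ciu[OF i] w[OF i] .
    qed
    also have "\<dots> = - (\<Sum>i<n. (Z (nxt n i) - Z i) * ci i u) + h * (\<Sum>i<n. (Z (nxt n i) - Z i) * w i)"
      by (simp add: sum.distrib sum_subtractf sum_negf sum_distrib_left)
    also have "(\<Sum>i<n. (Z (nxt n i) - Z i) * w i) = - (lam * V)"
      unfolding cyclic_sum_by_parts[of Z n w] V_def sum_distrib_left using slack by simp
    finally have "h * ip d (\<lambda>x. pc y x - pc w x) (\<lambda>x. u x - pc w x)
      \<le> h * (lam * measure \<nu> (dset d) - lam * V)"
      using flux_bound[OF pol Z lam] by (simp add: algebra_simps)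
    then show ?thesis using h_pos by simp
  qed
  show ?thesis
  proof (intro exI[of _ w] conjI allI impI)
    show "jump_le b w" if "jump_le b y" for b
      using that contr unfolding jump_le_def by (meson order_trans)
    fix u v assume sub: "in_subdiff_TV d u (\<lambda>x. - v x)"
    have fin: "TV d u < \<infinity>" using sub by (simp add: in_subdiff_TV_def)
    have bv: "is_BV d u"
    proof (rule ccontr)
      assume "\<not> is_BV d u"
      then show False using fin by (simp add: TV_def)
    qed
    \<comment> \<open>The same choice as inside \<open>TV\<close>, so that \<open>TV d u\<close>
      becomes the mass of this measure.\<close>
    define \<nu> where "\<nu> = (SOME \<nu>. is_TV_measure d u \<nu>)"
    have "is_TV_measure d u \<nu>" using bv unfolding is_BV_def \<nu>_def by (rule someI_ex)
    then obtain \<sigma> where pol: "polar d u \<nu> \<sigma>" unfolding is_TV_measure_iff_polar by (rule exE)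
    have Tu: "TV d u = ereal (measure \<nu> (dset d))" using bv by (simp add: TV_def \<nu>_def)
    have "TV d u + ereal (\<integral>x. - v x * (pc w x - u x) \<partial>leb d) \<le> TV d (pc w)"
      using sub pc_L2[of w] by (simp add: in_subdiff_TV_def)
    also have "\<dots> \<le> ereal V" using pc_TV(2)[of w] by (simp add: V_def)
    finally have "measure \<nu> (dset d) + (\<integral>x. - v x * (pc w x - u x) \<partial>leb d) \<le> V"
      unfolding Tu by simp
    moreover have "(\<integral>x. - v x * (pc w x - u x) \<partial>leb d) = (\<integral>x. v x * (u x - pc w x) \<partial>leb d)"
      by (intro Bochner_Integration.integral_cong refl) (simp add: algebra_simps)
    ultimately have "(\<integral>x. v x * (u x - pc w x) \<partial>leb d) \<le> V - measure \<nu> (dset d)" by linarith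
    also have "\<dots> = - (lam * measure \<nu> (dset d) - lam * V) / lam" using lam by (simp add: field_simps)
    also have "\<dots> \<le> - ip d (\<lambda>x. pc y x - pc w x) (\<lambda>x. u x - pc w x) / lam"
      using main[OF pol] lam by (intro divide_right_mono) auto
    finally show "(\<integral>x. v x * (u x - pc w x) \<partial>leb d)
        \<le> - ip d (\<lambda>x. pc y x - pc w x) (\<lambda>x. u x - pc w x) / lam" .
  qed
qed

end

section \<open>The energy of the flow\<close>

lemma abs_mult_le_squares: "\<bar>a * b\<bar> \<le> a\<^sup>2 + b\<^sup>2" for a b :: real
proof -
  have "2 * (\<bar>a\<bar> * \<bar>b\<bar>) \<le> a\<^sup>2 + b\<^sup>2" using sum_squares_bound[of "\<bar>a\<bar>" "\<bar>b\<bar>"] by simp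
  moreover have "0 \<le> \<bar>a\<bar> * \<bar>b\<bar>" by simp
  ultimately show ?thesis unfolding abs_mult by linarith
qed

section \<open>The L2 inner product\<close>

lemma L2_integrable_mult:
  assumes "L2 d f" "L2 d g"
  shows "integrable (leb d) (\<lambda>x. f x * g x)"
proof (rule Bochner_Integration.integrable_bound)
  show "integrable (leb d) (\<lambda>x. (f x)\<^sup>2 + (g x)\<^sup>2)"
    using assms by (simp add: L2_def)
  show "(\<lambda>x. f x * g x) \<in> borel_measurable (leb d)"
    using assms by (auto simp: L2_def)
  show "AE x in leb d. norm (f x * g x) \<le> norm ((f x)\<^sup>2 + (g x)\<^sup>2)"
    using abs_mult_le_squares by (intro AE_I2) simp
qed

lemma L2_diff:
  assumes "L2 d f" "L2 d g" shows "L2 d (\<lambda>x. f x - g x)"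
proof -
  have "(\<lambda>x. (f x - g x)\<^sup>2) = (\<lambda>x. (f x)\<^sup>2 + (g x)\<^sup>2 - 2 * (f x * g x))"
    by (simp add: power2_diff algebra_simps)
  moreover have "integrable (leb d) \<dots>"
    using assms L2_integrable_mult[OF assms]
    by (intro Bochner_Integration.integrable_diff Bochner_Integration.integrable_add integrable_mult_right) (auto simp: L2_def)
  ultimately show ?thesis using assms by (auto simp: L2_def)
qed

lemma L2_integrable:
  assumes "L2 d f" shows "integrable (leb d) f"
proof -
  have "L2 d (\<lambda>_. 1)"
    using finite_measure.integrable_const[OF finite_measure_lebesgue_on_dset] by (simp add: L2_def)
  from L2_integrable_mult[OF assms this] show ?thesis by simp
qed

lemma ip_self: "ip d f f = (\<integral>x. (f x)\<^sup>2 \<partial>leb d)"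
  by (simp add: power2_eq_square)

lemma ip_nonneg: "0 \<le> ip d f f"
  by simp

lemma ip_diff_left:
  assumes "L2 d f" "L2 d g" "L2 d k"
  shows "ip d (\<lambda>x. f x - g x) k = ip d f k - ip d g k"
  using L2_integrable_mult[OF assms(1,3)] L2_integrable_mult[OF assms(2,3)] by (simp add: left_diff_distrib)

lemma ip_commute: "ip d f g = ip d g f"
  by (simp add: mult.commute)

lemma ip_diff_right:
  assumes "L2 d f" "L2 d g" "L2 d k"
  shows "ip d k (\<lambda>x. f x - g x) = ip d k f - ip d k g"
  using ip_diff_left[OF assms] by (simp add: ip_commute[of d k])

lemma ip_young:
  assumes "L2 d f" "L2 d g" "0 < c"
  shows "ip d f g \<le> c / 2 * ip d f f + ip d g g / (2 * c)"
proof -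
  have "ip d f g \<le> (\<integral>x. c / 2 * (f x * f x) + (g x * g x) / (2 * c) \<partial>leb d)"
  proof (rule integral_mono)
    show "integrable (leb d) (\<lambda>x. f x * g x)" by (rule L2_integrable_mult[OF assms(1,2)])
    show "integrable (leb d) (\<lambda>x. c / 2 * (f x * f x) + (g x * g x) / (2 * c))"
      using L2_integrable_mult[OF assms(1,1)] L2_integrable_mult[OF assms(2,2)] by auto
    fix x
    have "0 \<le> (c * f x - g x)\<^sup>2" by simp
    then have "2 * c * (f x * g x) \<le> c * c * (f x * f x) + g x * g x"
      by (simp add: power2_eq_square algebra_simps)
    then show "f x * g x \<le> c / 2 * (f x * f x) + (g x * g x) / (2 * c)"
      using \<open>0 < c\<close> by (simp add: field_simps)
  qed
  also have "\<dots> = c / 2 * ip d f f + ip d g g / (2 * c)"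
    using L2_integrable_mult[OF assms(1,1)] L2_integrable_mult[OF assms(2,2)] by simp
  finally show ?thesis .
qed

text \<open>Stated in extended nonnegative reals, so that it applies at every x without knowing that
  the velocity is square integrable in time there.\<close>

lemma Cauchy_Schwarz_interval:
  fixes f :: rfun
  assumes [measurable]: "f \<in> borel_measurable lborel" and "a \<le> b"
  shows "ennreal ((LINT r:{a..b}|lborel. f r)\<^sup>2) \<le> ennreal (b - a) * (\<integral>\<^sup>+r. ennreal (indicator {a..b} r * (f r)\<^sup>2) \<partial>lborel)"
proof (cases "set_integrable lborel {a..b} f")
  \<comment> \<open>The integral of a non-integrable function is 0 by convention.\<close>
  case False
  then show ?thesis
    by (simp add: set_lebesgue_integral_def set_integrable_def not_integrable_integral_eq)
next
  case True
  let ?I = "\<lambda>r. ennreal (indicator {a..b} r)"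
  have "ennreal \<bar>LINT r:{a..b}|lborel. f r\<bar> \<le> (\<integral>\<^sup>+r. ennreal (norm (indicator {a..b} r *\<^sub>R f r)) \<partial>lborel)"
    using True integral_norm_bound_ennreal unfolding set_lebesgue_integral_def set_integrable_def by fastforce
  also have "\<dots> = (\<integral>\<^sup>+r. (ennreal \<bar>f r\<bar> * ?I r) * ?I r \<partial>lborel)"
    by (intro nn_integral_cong) (auto simp: indicator_def)
  finally have 1: "ennreal \<bar>LINT r:{a..b}|lborel. f r\<bar> \<le> (\<integral>\<^sup>+r. (ennreal \<bar>f r\<bar> * ?I r) * ?I r \<partial>lborel)" .
  have "ennreal ((LINT r:{a..b}|lborel. f r)\<^sup>2) = (ennreal \<bar>LINT r:{a..b}|lborel. f r\<bar>)\<^sup>2"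
    by (simp add: ennreal_power)
  also have "\<dots> \<le> (\<integral>\<^sup>+r. (ennreal \<bar>f r\<bar> * ?I r) * ?I r \<partial>lborel)\<^sup>2"
    using 1 by (rule power_mono) simp
  also have "\<dots> \<le> (\<integral>\<^sup>+r. (ennreal \<bar>f r\<bar> * ?I r)\<^sup>2 \<partial>lborel) * (\<integral>\<^sup>+r. (?I r)\<^sup>2 \<partial>lborel)"
    by (rule Cauchy_Schwarz_nn_integral) measurable
  also have "(\<integral>\<^sup>+r. (?I r)\<^sup>2 \<partial>lborel) = (\<integral>\<^sup>+r. indicator {a..b} r \<partial>lborel)"
    by (intro nn_integral_cong) (auto simp: indicator_def)
  also have "\<dots> = ennreal (b - a)" using \<open>a \<le> b\<close> by simp
  also have "(\<integral>\<^sup>+r. (ennreal \<bar>f r\<bar> * ?I r)\<^sup>2 \<partial>lborel) = (\<integral>\<^sup>+r. ennreal (indicator {a..b} r * (f r)\<^sup>2) \<partial>lborel)"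
    by (intro nn_integral_cong) (auto simp: indicator_def ennreal_power)
  finally show ?thesis by (simp add: mult.commute)
qed

locale flow =
  fixes d :: dom1 and u v :: "real \<Rightarrow> real \<Rightarrow> real"
  assumes L2u: "\<And>t. 0 \<le> t \<Longrightarrow> L2 d (u t)"
    and vm: "(\<lambda>(t, x). v t x) \<in> borel_measurable (lborel \<Otimes>\<^sub>M leb d)"
    and vfin: "\<And>\<delta>. 0 < \<delta> \<Longrightarrow> (\<integral>\<^sup>+ t \<in> {\<delta><..}. (\<integral>\<^sup>+ x. ennreal ((v t x)\<^sup>2) \<partial>leb d) \<partial>lborel) < \<infinity>"
    and incr: "\<And>s t. 0 < s \<Longrightarrow> s \<le> t \<Longrightarrow>
           (AE x in leb d. u t x - u s x = (LINT \<tau>:{s..t}|lborel. v \<tau> x))"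
    and sub: "AE t in lborel. t > 0 \<longrightarrow> in_subdiff_TV d (u t) (\<lambda>x. - v t x)"
begin

interpretation X: finite_measure "leb d"
  by (rule finite_measure_lebesgue_on_dset)

interpretation PS: pair_sigma_finite lborel "leb d"
  by unfold_locales

lemma v_measurable [measurable]: "case_prod v \<in> borel_measurable (lborel \<Otimes>\<^sub>M leb d)"
  using vm by simp

lemma v_section [measurable]: "x \<in> dset d \<Longrightarrow> (\<lambda>r. v r x) \<in> borel_measurable lborel"
  using measurable_compose[OF measurable_Pair2' v_measurable, of x] by (simp add: space_restrict_space)

text \<open>Informative for s > 0: up to time 0 the velocity may fail to be square integrable, and
  the integral may be the default 0.\<close>

definition energy :: "real \<Rightarrow> real \<Rightarrow> real" where
  "energy s t = (\<integral>\<tau>. indicator {s..t} \<tau> * ip d (v \<tau>) (v \<tau>) \<partial>lborel)"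

lemma joint_integrable:
  assumes "0 < s"
  shows "integrable (lborel \<Otimes>\<^sub>M leb d) (\<lambda>(\<tau>, x). indicator {s..t} \<tau> * (v \<tau> x)\<^sup>2)"
proof (rule integrableI_bounded)
  show m: "(\<lambda>(\<tau>, x). indicator {s..t} \<tau> * (v \<tau> x)\<^sup>2) \<in> borel_measurable (lborel \<Otimes>\<^sub>M leb d)"
    by measurable
  have "(\<integral>\<^sup>+z. ennreal (norm (case z of (\<tau>, x) \<Rightarrow> indicator {s..t} \<tau> * (v \<tau> x)\<^sup>2)) \<partial>(lborel \<Otimes>\<^sub>M leb d))
    = (\<integral>\<^sup>+\<tau>. \<integral>\<^sup>+x. ennreal (norm (indicator {s..t} \<tau> * (v \<tau> x)\<^sup>2)) \<partial>leb d \<partial>lborel)"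
    using m by (subst X.nn_integral_fst[symmetric]) auto
  \<comment> \<open>\<open>vfin\<close> speaks of an open half-line, which has to contain s; hence
    s/2.\<close>
  also have "\<dots> \<le> (\<integral>\<^sup>+ t \<in> {s/2<..}. (\<integral>\<^sup>+ x. ennreal ((v t x)\<^sup>2) \<partial>leb d) \<partial>lborel)"
    using assms by (intro nn_integral_mono) (auto simp: indicator_def)
  also have "\<dots> < \<infinity>" using assms by (intro vfin) simp
  finally show "(\<integral>\<^sup>+z. ennreal (norm (case z of (\<tau>, x) \<Rightarrow> indicator {s..t} \<tau> * (v \<tau> x)\<^sup>2)) \<partial>(lborel \<Otimes>\<^sub>M leb d)) < \<infinity>" .
qed

lemma energy_integrable: "0 < s \<Longrightarrow> integrable lborel (\<lambda>\<tau>. indicator {s..t} \<tau> * ip d (v \<tau>) (v \<tau>))"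
  and energy_joint: "0 < s \<Longrightarrow> energy s t = (\<integral>z. (case z of (\<tau>, x) \<Rightarrow> indicator {s..t} \<tau> * (v \<tau> x)\<^sup>2) \<partial>(lborel \<Otimes>\<^sub>M leb d))"
proof -
  assume s: "0 < s"
  show "integrable lborel (\<lambda>\<tau>. indicator {s..t} \<tau> * ip d (v \<tau>) (v \<tau>))"
    using PS.integrable_fst'[OF joint_integrable[OF s, of t]] by (simp add: power2_eq_square)
  show "energy s t = (\<integral>z. (case z of (\<tau>, x) \<Rightarrow> indicator {s..t} \<tau> * (v \<tau> x)\<^sup>2) \<partial>(lborel \<Otimes>\<^sub>M leb d))"
    using PS.integral_fst'[OF joint_integrable[OF s, of t]] by (simp add: energy_def power2_eq_square)
qed

lemma energy_nonneg: "0 \<le> energy s t"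
  unfolding energy_def by (intro Bochner_Integration.integral_nonneg mult_nonneg_nonneg ip_nonneg) auto

lemma energy_add:
  assumes "0 < s" "s \<le> r" "r \<le> t"
  shows "energy s r + energy r t = energy s t"
proof -
  have "energy s r + energy r t = (\<integral>\<tau>. indicator {s..r} \<tau> * ip d (v \<tau>) (v \<tau>) + indicator {r..t} \<tau> * ip d (v \<tau>) (v \<tau>) \<partial>lborel)"
    unfolding energy_def using energy_integrable[of s r] energy_integrable[of r t] assms by simp
  also have "\<dots> = energy s t"
    unfolding energy_def
  proof (rule integral_cong_AE)
    show "AE \<tau> in lborel. indicator {s..r} \<tau> * ip d (v \<tau>) (v \<tau>) + indicator {r..t} \<tau> * ip d (v \<tau>) (v \<tau>) = indicator {s..t} \<tau> * ip d (v \<tau>) (v \<tau>)"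
      using AE_lborel_singleton[of r] by eventually_elim (use assms in \<open>auto simp: indicator_def\<close>)
  qed (use energy_integrable assms in \<open>auto intro!: borel_measurable_add borel_measurable_integrable\<close>)
  finally show ?thesis .
qed

lemma energy_mono: "0 < s \<Longrightarrow> s \<le> r \<Longrightarrow> r \<le> t \<Longrightarrow> energy s r \<le> energy s t"
  using energy_add[of s r t] energy_nonneg[of r t] by simp

text \<open>Cauchy-Schwarz in time for each x, then Tonelli. The extra factor \<tau> - s is what
  makes the error of one Euler step second order.\<close>

lemma displacement:
  assumes "0 < s" "s \<le> \<tau>"
  shows "dist2 d (u \<tau>) (u s) \<le> (\<tau> - s) * energy s \<tau>"
proof -
  have L: "L2 d (\<lambda>x. u \<tau> x - u s x)" using assms by (intro L2_diff L2u) auto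
  have "ennreal (dist2 d (u \<tau>) (u s)) = (\<integral>\<^sup>+x. ennreal ((u \<tau> x - u s x)\<^sup>2) \<partial>leb d)"
    using L by (subst nn_integral_eq_integral) (auto simp: L2_def power2_eq_square)
  also have "\<dots> \<le> (\<integral>\<^sup>+x. ennreal (\<tau> - s) * (\<integral>\<^sup>+r. ennreal (indicator {s..\<tau>} r * (v r x)\<^sup>2) \<partial>lborel) \<partial>leb d)"
  proof (rule nn_integral_mono_AE)
    show "AE x in leb d. ennreal ((u \<tau> x - u s x)\<^sup>2) \<le> ennreal (\<tau> - s) * (\<integral>\<^sup>+r. ennreal (indicator {s..\<tau>} r * (v r x)\<^sup>2) \<partial>lborel)"
      using incr[OF assms] AE_space
    proof eventually_elim
      case (elim x)
      then show ?case using Cauchy_Schwarz_interval[OF v_section assms(2), of x] by (simp add: space_restrict_space)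
    qed
  qed
  also have "\<dots> = ennreal (\<tau> - s) * (\<integral>\<^sup>+x. \<integral>\<^sup>+r. ennreal (indicator {s..\<tau>} r * (v r x)\<^sup>2) \<partial>lborel \<partial>leb d)"
    by (rule nn_integral_cmult) measurable
  also have "(\<integral>\<^sup>+x. \<integral>\<^sup>+r. ennreal (indicator {s..\<tau>} r * (v r x)\<^sup>2) \<partial>lborel \<partial>leb d)
     = (\<integral>\<^sup>+z. ennreal (case z of (r, x) \<Rightarrow> indicator {s..\<tau>} r * (v r x)\<^sup>2) \<partial>(lborel \<Otimes>\<^sub>M leb d))"
    by (subst PS.nn_integral_snd[symmetric]) (auto intro!: nn_integral_cong)
  also have "\<dots> = ennreal (energy s \<tau>)"
    unfolding energy_joint[OF assms(1)] by (rule nn_integral_eq_integral[OF joint_integrable[OF assms(1)]]) auto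
  also have "ennreal (\<tau> - s) * ennreal (energy s \<tau>) = ennreal ((\<tau> - s) * energy s \<tau>)"
    using assms energy_nonneg by (simp add: ennreal_mult)
  finally show ?thesis
    using assms energy_nonneg[of s \<tau>] by (subst (asm) ennreal_le_iff) auto
qed

text \<open>The increments of u are given pointwise in x, so the weak form of u_t = v comes from
  Fubini; the product of v and f is dominated by v^2 + f^2, integrable on the bounded time
  interval.\<close>

lemma displacement_ip:
  assumes s: "0 < s" "s \<le> t" and f: "L2 d f"
  shows "ip d (\<lambda>x. u t x - u s x) f = (\<integral>\<tau>. indicator {s..t} \<tau> * ip d (v \<tau>) f \<partial>lborel)"
    and "integrable lborel (\<lambda>\<tau>. indicator {s..t} \<tau> * ip d (v \<tau>) f)"
proof -
  have [measurable]: "f \<in> borel_measurable (leb d)" using f by (simp add: L2_def)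
  let ?g = "\<lambda>\<tau> x. indicator {s..t} \<tau> * (v \<tau> x * f x)"
  let ?k = "\<lambda>\<tau> x. indicator {s..t} \<tau> * (v \<tau> x)\<^sup>2 + indicator {s..t} \<tau> * (f x)\<^sup>2"
  have if2: "integrable (lborel \<Otimes>\<^sub>M leb d) (\<lambda>(\<tau>, x). indicator {s..t} \<tau> * (f x)\<^sup>2)"
  proof (rule PS.Fubini_integrable)
    have "integrable lborel (indicator {s..t} :: real \<Rightarrow> real)"
      by (rule integrable_real_indicator) (auto simp: emeasure_lborel_Icc_eq)
    then show "integrable lborel (\<lambda>\<tau>. \<integral>x. norm (case (\<tau>, x) of (\<tau>, x) \<Rightarrow> indicator {s..t} \<tau> * (f x)\<^sup>2) \<partial>leb d)"
      by (simp add: abs_mult) 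
    show "AE \<tau> in lborel. integrable (leb d) (\<lambda>x. case (\<tau>, x) of (\<tau>, x) \<Rightarrow> indicator {s..t} \<tau> * (f x)\<^sup>2)"
      using f by (auto simp: L2_def)
  qed measurable
  have int: "integrable (lborel \<Otimes>\<^sub>M leb d) (case_prod ?g)"
  proof (rule Bochner_Integration.integrable_bound)
    show "integrable (lborel \<Otimes>\<^sub>M leb d) (\<lambda>z. (case z of (\<tau>, x) \<Rightarrow> indicator {s..t} \<tau> * (v \<tau> x)\<^sup>2) + (case z of (\<tau>, x) \<Rightarrow> indicator {s..t} \<tau> * (f x)\<^sup>2))"
      by (rule Bochner_Integration.integrable_add[OF joint_integrable[OF s(1)] if2])
    show "case_prod ?g \<in> borel_measurable (lborel \<Otimes>\<^sub>M leb d)" by measurable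
    show "AE z in lborel \<Otimes>\<^sub>M leb d. norm (case_prod ?g z) \<le> norm ((case z of (\<tau>, x) \<Rightarrow> indicator {s..t} \<tau> * (v \<tau> x)\<^sup>2) + (case z of (\<tau>, x) \<Rightarrow> indicator {s..t} \<tau> * (f x)\<^sup>2))"
      using abs_mult_le_squares by (intro AE_I2) (auto simp: indicator_def)
  qed
  have sec: "(\<integral>x. ?g \<tau> x \<partial>leb d) = indicator {s..t} \<tau> * ip d (v \<tau>) f" for \<tau>
    by (rule integral_mult_right_zero)
  show "integrable lborel (\<lambda>\<tau>. indicator {s..t} \<tau> * ip d (v \<tau>) f)"
    using PS.integrable_fst'[OF int] by (simp add: sec)
  have m: "(\<lambda>x. \<integral>\<tau>. ?g \<tau> x \<partial>lborel) \<in> borel_measurable (leb d)"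
    by measurable
  have "ip d (\<lambda>x. u t x - u s x) f = (\<integral>x. (\<integral>\<tau>. ?g \<tau> x \<partial>lborel) \<partial>leb d)"
  proof (rule integral_cong_AE)
    show "(\<lambda>x. (u t x - u s x) * f x) \<in> borel_measurable (leb d)"
      using L2_diff[OF L2u L2u, of t s] s f by (auto simp: L2_def)
    show "(\<lambda>x. \<integral>\<tau>. ?g \<tau> x \<partial>lborel) \<in> borel_measurable (leb d)" by (rule m)
    show "AE x in leb d. (u t x - u s x) * f x = (\<integral>\<tau>. ?g \<tau> x \<partial>lborel)"
      using incr[OF s]
    proof eventually_elim
      case (elim x)
      then show ?case by (simp add: set_lebesgue_integral_def mult.assoc[symmetric])
    qed
  qed
  also have "\<dots> = (\<integral>\<tau>. (\<integral>x. ?g \<tau> x \<partial>leb d) \<partial>lborel)"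
    by (rule PS.Fubini_integral[OF int])
  finally show "ip d (\<lambda>x. u t x - u s x) f = (\<integral>\<tau>. indicator {s..t} \<tau> * ip d (v \<tau>) f \<partial>lborel)"
    unfolding sec .
qed

end

section \<open>One Euler step against the flow\<close>

lemma ip_add_self:
  assumes "L2 d f" "L2 d g"
  shows "ip d (\<lambda>x. f x + g x) (\<lambda>x. f x + g x) = ip d f f + 2 * ip d f g + ip d g g"
proof -
  have "(\<lambda>x. (f x + g x) * (f x + g x)) = (\<lambda>x. f x * f x + 2 * (f x * g x) + g x * g x)" by (simp add: algebra_simps)
  then show ?thesis
    using L2_integrable_mult[OF assms(1,1)] L2_integrable_mult[OF assms] L2_integrable_mult[OF assms(2,2)] by simp
qed

lemma ip_diff_self:
  assumes "L2 d f" "L2 d g"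
  shows "dist2 d f g = ip d f f - 2 * ip d f g + ip d g g"
proof -
  have "(\<lambda>x. (f x - g x) * (f x - g x)) = (\<lambda>x. f x * f x - 2 * (f x * g x) + g x * g x)" by (simp add: algebra_simps)
  then show ?thesis
    using L2_integrable_mult[OF assms(1,1)] L2_integrable_mult[OF assms] L2_integrable_mult[OF assms(2,2)] by simp
qed

lemma ip_young_neg:
  assumes "L2 d f" "L2 d g" "0 < c"
  shows "- ip d f g \<le> c / 2 * ip d f f + ip d g g / (2 * c)"
proof -
  have "L2 d (\<lambda>x. - f x)" using assms(1) unfolding L2_def by simp
  from ip_young[OF this assms(2,3)] show ?thesis by simp
qed

text \<open>Legend, with e = u(\<tau>) - u(s), a = y - w and b = u(s) - w: \<open>VB\<close>,
  \<open>VW\<close>, \<open>VE\<close> pair v with b, u(\<tau>) - w and e; \<open>XB\<close>,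
  \<open>XE\<close> pair a with b and e; \<open>VV\<close>, \<open>EE\<close>, \<open>XA\<close> are
  the squared norms of v, e, a; \<open>A\<close> is the energy. The moving u(\<tau>) is traded for
  the fixed u(s), and only \<open>VV\<close> still depends on \<tau>.\<close>

lemma step_arith:
  fixes l :: real
  assumes "VB = VW - VE" "- VE \<le> l / 2 * VV + EE / (2 * l)" "VW \<le> - (XE + XB) / l"
    "- XE \<le> XA / 2 + EE / 2" "EE \<le> l * A" "0 < l"
  shows "VB \<le> l / 2 * VV + (A - XB / l + XA / (2 * l))"
proof -
  have "- (XE + XB) / l \<le> (XA / 2 + EE / 2 - XB) / l"
    using assms(4,6) by (intro divide_right_mono) auto
  then have "VB \<le> l / 2 * VV + EE / (2 * l) + (XA / 2 + EE / 2 - XB) / l" using assms(1-3) by linarith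
  also have "\<dots> = l / 2 * VV + (EE / l - XB / l + XA / (2 * l))" using assms(6) by (simp add: field_simps)
  also have "\<dots> \<le> l / 2 * VV + (A - XB / l + XA / (2 * l))"
    using assms(5,6) by (simp add: divide_le_eq mult.commute)
  finally show ?thesis .
qed

locale grid_flow = grid d n + flow d u v for d n u v
begin

text \<open>One implicit Euler step of length \<open>t - s\<close> from \<open>pc y\<close> shadows the flow on \<open>[s, t]\<close>. The error is of
  second order, because \<open>energy\<close> is additive in the time interval, and it disappears under refinement.\<close>

lemma step:
  assumes s: "0 < s" and st: "s < t"
  shows "\<exists>w. (\<forall>b. jump_le b y \<longrightarrow> jump_le b w) \<and>
    dist2 d (u t) (pc w)
      \<le> dist2 d (u s) (pc y) + 4 * ((t - s) * energy s t)"
proof -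
  define l where "l = t - s"
  have l: "0 < l" using st by (simp add: l_def)
  from resolvent[OF l, of y] obtain w where w: "(\<forall>b. jump_le b y \<longrightarrow> jump_le b w) \<and>
    (\<forall>u v. in_subdiff_TV d u (\<lambda>x. - v x) \<longrightarrow> ip d v (\<lambda>x. u x - pc w x) \<le> - ip d (\<lambda>x. pc y x - pc w x) (\<lambda>x. u x - pc w x) / l)"
    by (elim exE)
  note jump = conjunct1[OF w, rule_format] and res = conjunct2[OF w, rule_format]
  let ?q = "u s"
  let ?a = "\<lambda>x. pc y x - pc w x" and ?b = "\<lambda>x. ?q x - pc w x"
  have q: "L2 d ?q" using s by (intro L2u) simp
  have La: "L2 d ?a" by (intro L2_diff pc_L2)
  have Lb: "L2 d ?b" by (intro L2_diff q pc_L2)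
  \<comment> \<open>Independent of \<tau>, so integrating over [s, t] merely multiplies it by
    l.\<close>
  let ?K = "energy s t - ip d ?a ?b / l + ip d ?a ?a / (2 * l)"
  have key: "AE \<tau> in lborel. indicator {s..t} \<tau> * ip d (v \<tau>) ?b
      \<le> indicator {s..t} \<tau> * (l / 2 * ip d (v \<tau>) (v \<tau>)) + indicator {s..t} \<tau> * ?K"
    using sub
  proof eventually_elim
    case (elim \<tau>)
    show ?case
    proof (cases "\<tau> \<in> {s..t}")
      case True
      then have tau: "s \<le> \<tau>" "\<tau> \<le> t" "0 < \<tau>" using s by auto
      have sd: "in_subdiff_TV d (u \<tau>) (\<lambda>x. - v \<tau> x)" using elim tau by simp
      then have "L2 d (\<lambda>x. - v \<tau> x)" unfolding in_subdiff_TV_def by (elim conjE)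
      then have Lv: "L2 d (v \<tau>)" unfolding L2_def by (simp add: borel_measurable_uminus_eq)
      have Lu: "L2 d (u \<tau>)" using tau by (intro L2u) simp
      let ?e = "\<lambda>x. u \<tau> x - ?q x"
      have Le: "L2 d ?e" by (intro L2_diff Lu q)
      have Luw: "L2 d (\<lambda>x. u \<tau> x - pc w x)" by (intro L2_diff Lu pc_L2)
      have e_small: "ip d ?e ?e \<le> l * energy s t"
      proof -
        have "ip d ?e ?e \<le> (\<tau> - s) * energy s \<tau>" by (rule displacement[OF s tau(1)])
        also have "\<dots> \<le> l * energy s t"
          using tau energy_mono[OF s tau(1,2)] energy_nonneg l by (intro mult_mono) (auto simp: l_def)
        finally show ?thesis .
      qed
      have split: "ip d f (\<lambda>x. u \<tau> x - pc w x) = ip d f ?e + ip d f ?b" if "L2 d f" for f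
        using ip_diff_right[OF Luw Le that] ip_diff_right[OF Lu pc_L2[of w] that]
          ip_diff_right[OF Lu q that] ip_diff_right[OF q pc_L2[of w] that] by simp
      have "ip d (v \<tau>) ?b \<le> l / 2 * ip d (v \<tau>) (v \<tau>) + ?K"
      proof (rule step_arith[OF _ ip_young_neg[OF Lv Le l] _ _ e_small l])
        show "ip d (v \<tau>) ?b = ip d (v \<tau>) (\<lambda>x. u \<tau> x - pc w x) - ip d (v \<tau>) ?e" using split[OF Lv] by linarith
        show "ip d (v \<tau>) (\<lambda>x. u \<tau> x - pc w x) \<le> - (ip d ?a ?e + ip d ?a ?b) / l"
          using res[OF sd] unfolding split[OF La] .
        show "- ip d ?a ?e \<le> ip d ?a ?a / 2 + ip d ?e ?e / 2"
          using ip_young_neg[OF La Le, of 1] by linarith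
      qed
      then show ?thesis using True by simp
    qed simp
  qed
  have i1: "integrable lborel (\<lambda>\<tau>. indicator {s..t} \<tau> * (l / 2 * ip d (v \<tau>) (v \<tau>)))"
    using integrable_mult_right[OF energy_integrable[OF s, of t], of "l/2"] by (simp add: ac_simps)
  have i2: "integrable lborel (\<lambda>\<tau>. indicator {s..t} \<tau> * ?K)"
    by (intro integrable_mult_left integrable_real_indicator) (auto simp: emeasure_lborel_Icc_eq)
  have "ip d (\<lambda>x. u t x - ?q x) ?b = (\<integral>\<tau>. indicator {s..t} \<tau> * ip d (v \<tau>) ?b \<partial>lborel)"
    using st by (intro displacement_ip s Lb) simp
  also have "\<dots> \<le> (\<integral>\<tau>. indicator {s..t} \<tau> * (l / 2 * ip d (v \<tau>) (v \<tau>)) + indicator {s..t} \<tau> * ?K \<partial>lborel)"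
    using st by (intro integral_mono_AE displacement_ip s Lb Bochner_Integration.integrable_add i1 i2 key) simp
  also have "\<dots> = (\<integral>\<tau>. indicator {s..t} \<tau> * (l / 2 * ip d (v \<tau>) (v \<tau>)) \<partial>lborel) + (\<integral>\<tau>. indicator {s..t} \<tau> * ?K \<partial>lborel)"
    by (rule Bochner_Integration.integral_add[OF i1 i2])
  also have "(\<integral>\<tau>. indicator {s..t} \<tau> * (l / 2 * ip d (v \<tau>) (v \<tau>)) \<partial>lborel) = l / 2 * energy s t"
    unfolding energy_def by (subst integral_mult_right_zero[symmetric]) (simp add: ac_simps)
  also have "(\<integral>\<tau>. indicator {s..t} \<tau> * ?K \<partial>lborel) = l * ?K"
    using st by (subst integral_mult_left_zero) (simp add: l_def)
  also have "l * ?K = l * energy s t - ip d ?a ?b + ip d ?a ?a / 2" using l by (simp add: field_simps)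
  \<comment> \<open>The 3/2 is 1/2 from the squared norm of v and 1 from \<open>?K\<close>.\<close>
  finally have cross: "ip d (\<lambda>x. u t x - ?q x) ?b \<le> 3/2 * (l * energy s t) - ip d ?a ?b + ip d ?a ?a / 2" by simp
  let ?p = "\<lambda>x. u t x - ?q x"
  have Lt: "L2 d (u t)" using s st by (intro L2u) simp
  have Lp: "L2 d ?p" by (intro L2_diff Lt q)
  have "dist2 d (u t) (pc w) = ip d ?p ?p + 2 * ip d ?p ?b + ip d ?b ?b"
    using ip_add_self[OF Lp Lb] by simp
  \<comment> \<open>One energy term from the displacement and twice 3/2 from the cross term make the
    4. The rest is the squared norm of b - a, and b - a is u(s) minus \<open>pc y\<close>.\<close>
  also have "\<dots> \<le> l * energy s t + 2 * (3/2 * (l * energy s t) - ip d ?a ?b + ip d ?a ?a / 2) + ip d ?b ?b"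
    using displacement[OF s, of t] cross st by (simp add: l_def)
  also have "\<dots> = (ip d ?b ?b - 2 * ip d ?b ?a + ip d ?a ?a) + 4 * (l * energy s t)"
    by (simp add: ip_commute[of d ?a ?b])
  also have "ip d ?b ?b - 2 * ip d ?b ?a + ip d ?a ?a = dist2 d ?q (pc y)"
    using ip_diff_self[OF Lb La] by simp
  finally have fin: "dist2 d (u t) (pc w)
      \<le> dist2 d (u s) (pc y) + 4 * (l * energy s t)" .
  show ?thesis unfolding l_def[symmetric] by (intro exI[of _ w] conjI allI impI jump fin)
qed

text \<open>The jump bounds are quantified inside the claim, so they chain through the steps by
  transitivity; with a fixed step length the local errors add up to a single energy.\<close>

lemma iterate:
  assumes s: "0 < s" and \<eta>: "0 < \<eta>"
  shows "\<exists>w. (\<forall>b. jump_le b y \<longrightarrow> jump_le b w) \<and>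
    dist2 d (u (s + real k * \<eta>)) (pc w)
      \<le> dist2 d (u s) (pc y) + 4 * (\<eta> * energy s (s + real k * \<eta>))"
proof (induction k)
  case 0
  have "0 \<le> \<eta> * energy s s" using \<eta> energy_nonneg by simp
  then show ?case by (intro exI[of _ y]) simp
next
  case (Suc k)
  let ?r = "s + real k * \<eta>" and ?t = "s + real (Suc k) * \<eta>"
  have r: "0 < ?r" "?r < ?t" "s \<le> ?r" "?t - ?r = \<eta>" using s \<eta> by (auto simp: distrib_right add_pos_nonneg)
  from Suc obtain w where w: "\<forall>b. jump_le b y \<longrightarrow> jump_le b w"
    "dist2 d (u ?r) (pc w) \<le> dist2 d (u s) (pc y) + 4 * (\<eta> * energy s ?r)" 
    by (elim exE conjE)
  obtain w' where w': "\<forall>b. jump_le b w \<longrightarrow> jump_le b w'"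
    "dist2 d (u ?t) (pc w') \<le> dist2 d (u ?r) (pc w) + 4 * (\<eta> * energy ?r ?t)"
    using step[OF r(1,2), of w] unfolding r(4) by (elim exE conjE)
  have "energy s ?t = energy s ?r + energy ?r ?t" using energy_add[OF s r(3), of ?t] r(2) by simp
  then have "dist2 d (u ?t) (pc w') \<le> dist2 d (u s) (pc y) + 4 * (\<eta> * energy s ?t)"
    using w(2) w'(2) by (simp add: distrib_left)
  then show ?case using w(1) w'(1) by (intro exI[of _ w']) simp
qed

lemma shadow:
  assumes s: "0 < s" "s < t" and e: "0 < e"
  shows "\<exists>w. (\<forall>b. jump_le b y \<longrightarrow> jump_le b w) \<and>
    dist2 d (u t) (pc w) \<le> dist2 d (u s) (pc y) + e"
proof -
  obtain N :: nat where N: "4 * ((t - s) * energy s t) / e < real N" using reals_Archimedean2 by blast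
  define k where "k = Suc N"
  have k: "real k > 0" "4 * ((t - s) * energy s t) / e < real k" using N by (auto simp: k_def)
  have eta: "0 < (t - s) / real k" using s k by simp
  have "s + real k * ((t - s) / real k) = t" using k by simp
  from iterate[OF s(1) eta, of y k, unfolded this]
  obtain w where w: "\<forall>b. jump_le b y \<longrightarrow> jump_le b w"
    "dist2 d (u t) (pc w) \<le> dist2 d (u s) (pc y) + 4 * ((t - s) / real k * energy s t)"
    by (elim exE conjE)
  have "4 * ((t - s) / real k * energy s t) \<le> e" using k e by (simp add: field_simps)
  then have "dist2 d (u t) (pc w) \<le> dist2 d (u s) (pc y) + e"
    using w(2) by linarith
  then show ?thesis using w(1) by (intro exI[of _ w] conjI)
qed

end

section \<open>Refinement of the grid\<close>

lemma L2_bounded: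
  assumes "f \<in> borel_measurable (leb d)" "\<And>x. x \<in> dset d \<Longrightarrow> \<bar>f x\<bar> \<le> C"
  shows "L2 d f"
  unfolding L2_def
proof (intro conjI finite_measure.integrable_const_bound[OF finite_measure_lebesgue_on_dset, where B="C\<^sup>2"])
  show "AE x in leb d. norm ((f x)\<^sup>2) \<le> C\<^sup>2"
    using assms(2) by (intro AE_I2) (simp add: abs_le_square_iff[symmetric] order_trans[OF _ abs_ge_self])
qed (use assms(1) in auto)

lemma test_L2:
  assumes "C1_test d \<psi> \<psi>'" shows "L2 d \<psi>" "L2 d \<psi>'"
proof -
  obtain C where C: "\<And>x. x \<in> dset d \<Longrightarrow> \<bar>\<psi> x\<bar> \<le> C" "\<And>x. x \<in> dset d \<Longrightarrow> \<bar>\<psi>' x\<bar> \<le> C"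
    using test_bounded[OF assms] by metis
  show "L2 d \<psi>" "L2 d \<psi>'"
    using C by (auto intro!: L2_bounded[where C=C] continuous_measurable_lebesgue_on C1_test_continuous[OF assms])
qed

lemma ip_triangle:
  assumes "L2 d f" "L2 d g" "L2 d k"
  shows "dist2 d f k
    \<le> 2 * dist2 d f g + 2 * dist2 d g k"
proof -
  let ?a = "\<lambda>x. f x - g x" and ?b = "\<lambda>x. g x - k x"
  have L: "L2 d ?a" "L2 d ?b" using assms by (auto intro: L2_diff)
  have "dist2 d f k = ip d ?a ?a + 2 * ip d ?a ?b + ip d ?b ?b"
    using ip_add_self[OF L] by simp
  then show ?thesis using ip_young[OF L, of 1] by linarith
qed

lemma (in two_measures) test_dense_nn:
  assumes f: "f \<in> borel_measurable M"
    and fin: "(\<integral>\<^sup>+x. ennreal ((f x)\<^sup>2) \<partial>M) < \<infinity>" "(\<integral>\<^sup>+x. ennreal ((f x)\<^sup>2) \<partial>N) < \<infinity>" and e: "0 < e"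
  shows "\<exists>\<psi> \<psi>'. C1_test d \<psi> \<psi>' \<and> (\<integral>\<^sup>+x. ennreal ((\<psi> x - f x)\<^sup>2) \<partial>M) \<le> ennreal e"
proof -
  obtain \<psi> \<psi>' where psi: "C1_test d \<psi> \<psi>'" "qd \<psi> f < ennreal e"
    using approximable_L2[OF assms(1-3)] e unfolding approximable_def by blast
  have "(\<integral>\<^sup>+x. ennreal ((\<psi> x - f x)\<^sup>2) \<partial>M) \<le> qd \<psi> f" unfolding qd_def by simp
  then show ?thesis using psi by (meson less_imp_le order_trans)
qed

text \<open>f is only Lebesgue measurable, while density was shown for Borel measures: f is replaced
  by a Borel function equal to it almost everywhere.\<close>

lemma test_dense_L2:
  assumes valid: "valid_dom d" and f: "L2 d f" and e: "0 < e"
  shows "\<exists>\<psi> \<psi>'. C1_test d \<psi> \<psi>' \<and> dist2 d f \<psi> \<le> e"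
proof -
  let ?X = "leb d"
  let ?M = "restrict_space lborel (dset d)"
  have fm: "f \<in> borel_measurable ?X" using f by (simp add: L2_def)
  have "(\<lambda>x. if x \<in> dset d then f x else 0) \<in> borel_measurable lebesgue"
    using fm by (subst borel_measurable_if) simp_all
  from completion_ex_borel_measurable_real[OF this] obtain g
    where g: "g \<in> borel_measurable lborel" "AE x in lborel. (if x \<in> dset d then f x else 0) = g x"
    by blast
  have gm: "g \<in> borel_measurable borel" using g(1) by simp
  have AEfg: "AE x in ?X. f x = g x"
  proof -
    have "AE x in lebesgue. (if x \<in> dset d then f x else 0) = g x" using g(2) by (rule AE_completion)
    then show ?thesis by (subst AE_restrict_space_iff) (auto elim: eventually_mono)
  qed
  have nn: "(\<integral>\<^sup>+x. ennreal (k x) \<partial>?M) = (\<integral>\<^sup>+x. ennreal (k x) \<partial>?X)" if k: "k \<in> borel_measurable borel" for k :: rfun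
  proof -
    have "(\<integral>\<^sup>+x. ennreal (k x) \<partial>?X) = (\<integral>\<^sup>+x. ennreal (k x) * indicator (dset d) x \<partial>lebesgue)"
      by (rule nn_integral_restrict_space) simp
    also have "\<dots> = (\<integral>\<^sup>+x. ennreal (k x) * indicator (dset d) x \<partial>lborel)"
      by (rule nn_integral_completion)
    also have "\<dots> = (\<integral>\<^sup>+x. ennreal (k x) \<partial>?M)"
      by (rule nn_integral_restrict_space[symmetric]) simp
    finally show ?thesis by simp
  qed
  have fin: "finite_measure ?M"
  proof
    have "emeasure ?M (space ?M) = (\<integral>\<^sup>+x. ennreal 1 \<partial>?X)" using nn[of "\<lambda>_. 1"] by simp
    also have "\<dots> < \<infinity>" using finite_measure.emeasure_finite[OF finite_measure_lebesgue_on_dset, of d] by (simp add: less_top)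
    finally show "emeasure ?M (space ?M) \<noteq> \<infinity>" by simp
  qed
  have sets: "sets ?M = sets (bor d)" by (simp only: sets_restrict_space sets_lborel)
  have tm: "two_measures d ?M ?M"
    by (rule two_measures.intro[OF valid fin fin sets sets])
  have "(\<integral>\<^sup>+x. ennreal ((g x)\<^sup>2) \<partial>?M) = (\<integral>\<^sup>+x. ennreal ((g x)\<^sup>2) \<partial>?X)" by (intro nn borel_measurable_power gm)
  also have "\<dots> = (\<integral>\<^sup>+x. ennreal ((f x)\<^sup>2) \<partial>?X)"
  proof (rule nn_integral_cong_AE)
    show "AE x in ?X. ennreal ((g x)\<^sup>2) = ennreal ((f x)\<^sup>2)" using AEfg by eventually_elim simp
  qed
  also have "\<dots> < \<infinity>" using f by (simp add: L2_def nn_integral_eq_integral)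
  finally have gfin: "(\<integral>\<^sup>+x. ennreal ((g x)\<^sup>2) \<partial>?M) < \<infinity>" .
  have "g \<in> borel_measurable ?M" using g(1) by (rule measurable_restrict_space1)
  from two_measures.test_dense_nn[OF tm this gfin gfin e] obtain \<psi> \<psi>'
    where psi: "C1_test d \<psi> \<psi>'" "(\<integral>\<^sup>+x. ennreal ((\<psi> x - g x)\<^sup>2) \<partial>?M) \<le> ennreal e"
    by (elim exE conjE)
  have pm: "\<psi> \<in> borel_measurable borel"
    using C1_test_continuous(1)[OF psi(1)] by (rule borel_measurable_continuous_onI)
  have "L2 d (\<lambda>x. f x - \<psi> x)" by (intro L2_diff f test_L2[OF psi(1)])
  then have "ennreal (dist2 d f \<psi>) = (\<integral>\<^sup>+x. ennreal ((f x - \<psi> x)\<^sup>2) \<partial>?X)"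
    unfolding ip_self by (intro nn_integral_eq_integral[symmetric]) (auto simp: L2_def)
  also have "\<dots> = (\<integral>\<^sup>+x. ennreal ((\<psi> x - g x)\<^sup>2) \<partial>?X)"
  proof (rule nn_integral_cong_AE)
    show "AE x in ?X. ennreal ((f x - \<psi> x)\<^sup>2) = ennreal ((\<psi> x - g x)\<^sup>2)"
      using AEfg by eventually_elim (simp add: power2_commute)
  qed
  also have "\<dots> = (\<integral>\<^sup>+x. ennreal ((\<psi> x - g x)\<^sup>2) \<partial>?M)" by (intro nn[symmetric] borel_measurable_power borel_measurable_diff pm gm)
  also have "\<dots> \<le> ennreal e" by (rule psi(2))
  finally show ?thesis using psi(1) e by (auto simp: ennreal_le_iff)
qed

section \<open>Cell averages and pairings on fine grids\<close>

context grid
begin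

lemma ci_diff_pc:
  assumes "integrable (leb d) f" "i < n"
  shows "ci i (\<lambda>x. f x - pc c x) = ci i f - h * c i"
proof -
  have "ci i (\<lambda>x. f x - pc c x) = ci i f - ci i (pc c)"
    unfolding ci_def right_diff_distrib
    by (intro Bochner_Integration.integral_diff integrable_real_mult_indicator_cell assms(1) pc_integrable)
  then show ?thesis using ci_pc[OF assms(2)] by simp
qed

text \<open>Averaging over cells is the orthogonal projection onto step functions: the residual has
  zero integral on every cell.\<close>

lemma cell_average_best:
  assumes f: "L2 d f"
  defines "c \<equiv> \<lambda>i. ci i f / h"
  shows "dist2 d f (pc c) \<le> dist2 d f (pc p)"
proof -
  let ?g = "\<lambda>x. f x - pc c x" and ?k = "pc (\<lambda>i. c i - p i)"
  have L: "L2 d ?g" "L2 d ?k" by (intro L2_diff f pc_L2)+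
  have "ip d ?g ?k = (\<Sum>i<n. (c i - p i) * ci i ?g)"
    unfolding ip_commute[of d ?g] by (rule integral_pc_mult(1)[OF L2_integrable[OF L(1)]])
  also have "\<dots> = 0"
    using h_pos by (intro sum.neutral) (simp add: ci_diff_pc[OF L2_integrable[OF f]] c_def)
  finally have orth: "ip d ?g ?k = 0" .
  have "dist2 d f (pc p) = ip d (\<lambda>x. ?g x + ?k x) (\<lambda>x. ?g x + ?k x)"
    by (simp add: pc_diff[symmetric])
  also have "\<dots> = ip d ?g ?g + ip d ?k ?k" using ip_add_self[OF L] orth by simp
  finally show ?thesis using ip_nonneg[of d ?k] by linarith
qed

text \<open>The averages of f do at least as well as the nodal values of a nearby test function, and
  those are controlled by uniform continuity.\<close>

lemma cell_average_close:
  assumes f: "L2 d f" and psi: "C1_test d \<psi> \<psi>'"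
    and uc: "\<And>x z. x \<in> {lo d..hi d} \<Longrightarrow> z \<in> {lo d..hi d} \<Longrightarrow> \<bar>x - z\<bar> \<le> h \<Longrightarrow> \<bar>\<psi> x - \<psi> z\<bar> \<le> \<eta>"
  shows "ip d (\<lambda>x. f x - pc (\<lambda>i. ci i f / h) x) (\<lambda>x. f x - pc (\<lambda>i. ci i f / h) x)
    \<le> 2 * dist2 d f \<psi> + 2 * (\<eta>\<^sup>2 * measure (leb d) (dset d))"
proof -
  let ?p = "\<lambda>i. \<psi> (node i)"
  have "dist2 d \<psi> (pc ?p) \<le> (\<integral>x. \<eta>\<^sup>2 \<partial>leb d)"
  proof (rule integral_mono)
    show "integrable (leb d) (\<lambda>x. (\<psi> x - pc ?p x) * (\<psi> x - pc ?p x))"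
      by (intro L2_integrable_mult L2_diff test_L2(1)[OF psi] pc_L2)
    show "integrable (leb d) (\<lambda>x. \<eta>\<^sup>2)"
      by (rule finite_measure.integrable_const[OF finite_measure_lebesgue_on_dset])
    fix x assume "x \<in> space (leb d)"
    then have x: "x \<in> dset d" by simp
    obtain j where j: "j < n" "x \<in> cell j" using in_cell_obtain[OF x] .
    have "\<bar>\<psi> x - \<psi> (node j)\<bar> \<le> \<eta>"
      using node_range[of j] j dset_subset_Icc[OF x] by (intro uc) (auto simp: cell_def node_Suc)
    then have "\<bar>\<psi> x - pc ?p x\<bar> \<le> \<bar>\<eta>\<bar>" by (simp add: pc_eq[OF j])
    then show "(\<psi> x - pc ?p x) * (\<psi> x - pc ?p x) \<le> \<eta>\<^sup>2"
      by (simp add: abs_le_square_iff power2_eq_square)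
  qed
  also have "\<dots> = \<eta>\<^sup>2 * measure (leb d) (dset d)" by simp
  finally have "dist2 d \<psi> (pc ?p) \<le> \<eta>\<^sup>2 * measure (leb d) (dset d)" .
  then show ?thesis
    using cell_average_best[OF f, of ?p] ip_triangle[OF f test_L2(1)[OF psi] pc_L2[of ?p]] by linarith
qed

lemma cell_average_jump:
  assumes "polar d f \<nu> \<sigma>"
  shows "jump_le (\<lambda>i. \<integral>x. tent i x \<partial>\<nu>) (\<lambda>i. ci i f / h)"
  unfolding jump_le_def
proof (intro allI impI)
  fix i assume "i < n" "ed i = 1"
  from cell_jump_bound[OF assms this] show "\<bar>ci i f / h - ci (prv n i) f / h\<bar> \<le> (\<integral>x. tent i x \<partial>\<nu>)"
    using h_pos by (simp add: diff_divide_distrib[symmetric] abs_divide divide_le_eq mult.commute)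
qed

text \<open>The pairing is a sum of jumps weighted by nodal values of \<psi>. Each jump is at most a
  tent mass, \<psi> differs from its nodal value by at most \<eta> on the support of the tent, and
  the tents sum to at most 1.\<close>

lemma jump_bound_test:
  assumes nu: "finite_measure \<nu>" "sets \<nu> = sets (bor d)"
    and w: "jump_le (\<lambda>i. \<integral>x. tent i x \<partial>\<nu>) w" and psi: "C1_test d \<psi> \<psi>'"
    and uc: "\<And>x z. x \<in> {lo d..hi d} \<Longrightarrow> z \<in> {lo d..hi d} \<Longrightarrow> \<bar>x - z\<bar> \<le> h \<Longrightarrow> \<bar>\<psi> x - \<psi> z\<bar> \<le> \<eta>"
    and eta: "0 \<le> \<eta>"
  shows "\<bar>ip d (pc w) \<psi>'\<bar> \<le> (\<integral>x. \<bar>\<psi> x\<bar> \<partial>\<nu>) + \<eta> * measure \<nu> (dset d)"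
proof -
  have sp: "space \<nu> = dset d" using sets_eq_imp_space_eq[OF nu(2)] by (simp add: space_restrict_space)
  have pm: "(\<lambda>x. \<bar>\<psi> x\<bar>) \<in> borel_measurable \<nu>"
    using measurable_restrict_dset_continuous[OF nu(2) C1_test_continuous(1)[OF psi]] by simp
  obtain C where C: "\<And>x. x \<in> dset d \<Longrightarrow> \<bar>\<psi> x\<bar> \<le> C" using test_bounded[OF psi] by metis
  have ip: "integrable \<nu> (\<lambda>x. \<bar>\<psi> x\<bar>)" by (rule integrable_bounded_dset[OF nu pm]) (use C in auto)
  have ipe: "integrable \<nu> (\<lambda>x. \<bar>\<psi> x\<bar> + \<eta>)"
    by (intro Bochner_Integration.integrable_add ip finite_measure.integrable_const[OF nu(1)])
  have it: "integrable \<nu> (\<lambda>x. \<bar>\<psi> (node i)\<bar> * tent i x)" if "i < n" for i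
    by (intro integrable_mult_right tent_integrable[OF nu that])
  have lo0: "\<psi> (hi d) = \<psi> (node 0)" using Cc_test_lo_hi[OF valid, of \<psi>] psi node_0 by (simp add: C1_test_def)
  have pt: "\<bar>\<psi> (node i)\<bar> * tent i x \<le> (\<bar>\<psi> x\<bar> + \<eta>) * tent i x" if x: "x \<in> dset d" and i: "i < n" for i x
  proof (cases "tent i x = 0")
    case False
    have "\<bar>\<psi> x - \<psi> (node i)\<bar> \<le> \<eta>"
      using tent_support[OF x False]
    proof
      assume "\<bar>x - node i\<bar> \<le> h"
      then show ?thesis using node_range[of i] i dset_subset_Icc[OF x] by (intro uc) auto
    next
      \<comment> \<open>The tent of node 0 wraps around; near \<open>hi d\<close> the comparison is
        with \<psi> at \<open>hi d\<close>, which equals \<psi> at \<open>lo d\<close>.\<close>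
      assume a: "i = 0 \<and> \<bar>x - hi d\<bar> \<le> h"
      then have "\<bar>\<psi> x - \<psi> (hi d)\<bar> \<le> \<eta>" using dset_subset_Icc[OF x] lo_less_hi[OF valid] by (intro uc) auto
      then show ?thesis using a lo0 by simp
    qed
    then show ?thesis using tent_nonneg[OF x] by (intro mult_right_mono) linarith+
  qed simp
  have "\<bar>ip d (pc w) \<psi>'\<bar> \<le> (\<Sum>i<n. \<bar>ed i * (\<psi> (node i) * (w i - w (prv n i)))\<bar>)"
    unfolding pc_dual[OF psi] abs_minus_cancel by (rule sum_abs)
  also have "\<dots> \<le> (\<Sum>i<n. \<integral>x. \<bar>\<psi> (node i)\<bar> * tent i x \<partial>\<nu>)"
  proof (rule sum_mono)
    fix i assume "i \<in> {..<n}"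
    then have i: "i < n" by simp
    show "\<bar>ed i * (\<psi> (node i) * (w i - w (prv n i)))\<bar> \<le> (\<integral>x. \<bar>\<psi> (node i)\<bar> * tent i x \<partial>\<nu>)"
    proof (cases "ed i = 1")
      case True
      then show ?thesis using w i by (simp add: jump_le_def abs_mult mult_left_mono)
    next
      case False
      then have "ed i = 0" using ed_cases[of i] by simp
      moreover have "0 \<le> (\<integral>x. \<bar>\<psi> (node i)\<bar> * tent i x \<partial>\<nu>)"
        by (rule Bochner_Integration.integral_nonneg) (simp add: sp tent_nonneg)
      ultimately show ?thesis by simp
    qed
  qed
  also have "\<dots> = (\<integral>x. (\<Sum>i<n. \<bar>\<psi> (node i)\<bar> * tent i x) \<partial>\<nu>)"
    by (rule Bochner_Integration.integral_sum[symmetric]) (use it in simp)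
  also have "\<dots> \<le> (\<integral>x. \<bar>\<psi> x\<bar> + \<eta> \<partial>\<nu>)"
  proof (rule integral_mono[OF _ ipe])
    show "integrable \<nu> (\<lambda>x. \<Sum>i<n. \<bar>\<psi> (node i)\<bar> * tent i x)" by (intro Bochner_Integration.integrable_sum) (use it in simp)
    fix x assume "x \<in> space \<nu>"
    then have x: "x \<in> dset d" using sp by simp
    have "(\<Sum>i<n. \<bar>\<psi> (node i)\<bar> * tent i x) \<le> (\<Sum>i<n. (\<bar>\<psi> x\<bar> + \<eta>) * tent i x)"
      by (rule sum_mono) (use pt[OF x] in simp)
    also have "\<dots> = (\<bar>\<psi> x\<bar> + \<eta>) * (\<Sum>i<n. tent i x)" by (rule sum_distrib_left[symmetric])
    also have "\<dots> \<le> \<bar>\<psi> x\<bar> + \<eta>" using tent_sum_le_1[OF x] eta by (intro mult_left_le) auto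
    finally show "(\<Sum>i<n. \<bar>\<psi> (node i)\<bar> * tent i x) \<le> \<bar>\<psi> x\<bar> + \<eta>" .
  qed
  also have "\<dots> = (\<integral>x. \<bar>\<psi> x\<bar> \<partial>\<nu>) + \<eta> * measure \<nu> (dset d)"
    using ip by (subst Bochner_Integration.integral_add) (auto simp: sp intro!: finite_measure.integrable_const[OF nu(1)])
  finally show ?thesis .
qed

end

section \<open>Passage to the limit at a fixed time\<close>

lemma scaled_small:
  fixes e m :: real
  assumes "0 < e" "0 \<le> m"
  shows "0 < e / (2 * (m + 1)) \<and> e / (2 * (m + 1)) * m \<le> e / 2"
proof -
  have "m + 1 > 0" using assms(2) by simp
  moreover from this have "e * m \<le> e * (m + 1)" using assms by (intro mult_left_mono) auto
  ultimately show ?thesis using assms(1) by (simp add: divide_le_eq mult.commute)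
qed

text \<open>All tolerances depend on e alone. Then come the grid, fine enough both for \<psi> and
  for a test function near the initial datum, the starting time s, and last the time step hidden in
  \<open>shadow\<close>. The limiting inequality no longer mentions the grid.\<close>

lemma (in flow) variation_bound:
  assumes valid: "valid_dom d" and pol: "polar d (u 0) \<nu> \<sigma>"
    and cont: "((\<lambda>s. dist2 d (u s) (u 0)) \<longlongrightarrow> 0) (at 0 within {0..})"
    and T: "0 < T" and psi: "C1_test d \<psi> \<psi>'"
  shows "\<bar>ip d (u T) \<psi>'\<bar> \<le> (\<integral>x. \<bar>\<psi> x\<bar> \<partial>\<nu>)"
proof (rule field_le_epsilon)
  fix e :: real assume e: "0 < e"
  note nu = polarD(2,3,4)[OF pol]
  have Lp: "L2 d \<psi>'" by (rule test_L2(2)[OF psi])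
  have L0: "L2 d (u 0)" and LT: "L2 d (u T)" using T by (auto intro: L2u)
  define \<eta> where "\<eta> = e / (2 * (measure \<nu> (dset d) + 1))"
  have eta: "0 < \<eta>" "\<eta> * measure \<nu> (dset d) \<le> e / 2"
    using scaled_small[OF e measure_nonneg[of \<nu> "dset d"]] unfolding \<eta>_def by auto
  define \<kappa> where "\<kappa> = e / (2 * (ip d \<psi>' \<psi>' + 1))"
  have kap: "0 < \<kappa>" "\<kappa> * ip d \<psi>' \<psi>' \<le> e / 2"
    using scaled_small[OF e ip_nonneg[of d \<psi>']] unfolding \<kappa>_def by blast+
  \<comment> \<open>Young's inequality with weight \<kappa> turns a squared distance \<mu> into an
    error e/4, and \<kappa> is such that the norm of \<psi>' contributes another e/4. The remaining
    e/2 goes to \<eta>.\<close>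
  define \<mu> where "\<mu> = \<kappa> * e / 2"
  have mu: "0 < \<mu>" using kap e by (simp add: \<mu>_def)
  define m where "m = measure (leb d) (dset d)"
  have m: "0 \<le> m" by (simp add: m_def)
  define \<theta> where "\<theta> = sqrt (\<mu> / 16 / (2 * (m + 1)))"
  have th: "0 < \<theta>" "2 * (\<theta>\<^sup>2 * m) \<le> \<mu> / 16"
  proof -
    have sm: "0 < \<mu> / 16 / (2 * (m + 1)) \<and> \<mu> / 16 / (2 * (m + 1)) * m \<le> \<mu> / 16 / 2"
      by (rule scaled_small) (use mu m in simp_all)
    then show "0 < \<theta>" by (simp add: \<theta>_def)
    have "\<theta>\<^sup>2 = \<mu> / 16 / (2 * (m + 1))" using sm unfolding \<theta>_def by (intro real_sqrt_pow2) linarith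
    then have "\<theta>\<^sup>2 * m \<le> \<mu> / 16 / 2" using conjunct2[OF sm] by (simp only:)
    then show "2 * (\<theta>\<^sup>2 * m) \<le> \<mu> / 16" by simp
  qed
  \<comment> \<open>The budget: twice \<mu>/32 plus \<mu>/16 gives \<mu>/8 for the cell averages.
    Together with \<mu>/8 for the starting time, doubled by \<open>ip_triangle\<close>, and \<mu>/2
    for the time steps this makes \<mu>.\<close>
  have "0 < \<mu> / 32" using mu by simp
  from test_dense_L2[OF valid L0 this] obtain \<phi> \<phi>' where phi: "C1_test d \<phi> \<phi>'"
    "dist2 d (u 0) \<phi> \<le> \<mu> / 32" by (elim exE conjE)
  have unif: "\<exists>\<delta>>0. \<forall>x\<in>{lo d..hi d}. \<forall>z\<in>{lo d..hi d}. \<bar>x - z\<bar> < \<delta> \<longrightarrow> \<bar>f x - f z\<bar> < r"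
    if f: "continuous_on UNIV f" and r: "0 < r" for f :: rfun and r
  proof -
    have "uniformly_continuous_on {lo d..hi d} f"
      by (rule compact_uniformly_continuous[OF continuous_on_subset[OF f]]) auto
    then show ?thesis using r by (simp add: uniformly_continuous_on_def dist_real_def abs_minus_commute)
  qed
  obtain \<delta>1 where d1: "0 < \<delta>1" "\<And>x z. x \<in> {lo d..hi d} \<Longrightarrow> z \<in> {lo d..hi d} \<Longrightarrow> \<bar>x - z\<bar> < \<delta>1 \<Longrightarrow> \<bar>\<psi> x - \<psi> z\<bar> < \<eta>"
    using unif[OF C1_test_continuous(1)[OF psi] eta(1)] by blast
  obtain \<delta>2 where d2: "0 < \<delta>2" "\<And>x z. x \<in> {lo d..hi d} \<Longrightarrow> z \<in> {lo d..hi d} \<Longrightarrow> \<bar>x - z\<bar> < \<delta>2 \<Longrightarrow> \<bar>\<phi> x - \<phi> z\<bar> < \<theta>"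
    using unif[OF C1_test_continuous(1)[OF phi(1)] th(1)] by blast
  define \<delta> where "\<delta> = min \<delta>1 \<delta>2"
  have del: "0 < \<delta>" "\<delta> \<le> \<delta>1" "\<delta> \<le> \<delta>2" using d1(1) d2(1) by (auto simp: \<delta>_def)
  obtain N :: nat where N: "(hi d - lo d) / \<delta> < real N" using reals_Archimedean2 by blast
  define n where "n = N + 2"
  interpret grid_flow d n u v
    by unfold_locales (simp_all add: valid n_def)
  have hd: "h < \<delta>"
  proof -
    have "(hi d - lo d) / \<delta> < real n" using N by (simp add: n_def)
    then have "hi d - lo d < real n * \<delta>" using del(1) by (simp add: divide_less_eq)
    moreover have "0 < real n" by (simp add: n_def)
    ultimately show ?thesis unfolding h_def by (simp add: divide_less_eq mult.commute)
  qed
  let ?c = "\<lambda>i. ci i (u 0) / h"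
  have c_close: "dist2 d (u 0) (pc ?c) \<le> \<mu> / 8"
  proof -
    have "dist2 d (u 0) (pc ?c)
      \<le> 2 * dist2 d (u 0) \<phi> + 2 * (\<theta>\<^sup>2 * measure (leb d) (dset d))"
      by (rule cell_average_close[OF L0 phi(1)]) (use d2(2) del hd in \<open>fastforce intro: less_imp_le\<close>)
    then show ?thesis using phi(2) th(2) unfolding m_def by linarith
  qed
  have c_jump: "jump_le (\<lambda>i. \<integral>x. tent i x \<partial>\<nu>) ?c" by (rule cell_average_jump[OF pol])
  \<comment> \<open>The energy is controlled only away from time 0, so the Euler steps start from
    the cell averages of u(0) at a positive time s, where u(s) is still close to u(0).\<close>
  obtain s where s: "0 < s" "s < T" "dist2 d (u s) (u 0) < \<mu> / 8"
  proof -
    have "0 < \<mu> / 8" using mu by simp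
    from order_tendstoD(2)[OF cont this] obtain r where r: "0 < r"
      "\<And>s. s \<in> {0..} \<Longrightarrow> s \<noteq> 0 \<Longrightarrow> dist s 0 < r \<Longrightarrow> dist2 d (u s) (u 0) < \<mu> / 8"
      unfolding eventually_at by blast
    have "ip d (\<lambda>x. u (min r T / 2) x - u 0 x) (\<lambda>x. u (min r T / 2) x - u 0 x) < \<mu> / 8"
      by (rule r(2)) (use r(1) T in \<open>auto simp: dist_real_def min_def\<close>)
    then show ?thesis using r(1) T by (intro that[of "min r T / 2"]) (auto simp: min_def)
  qed
  have Ls: "L2 d (u s)" using s by (intro L2u) simp
  have "0 < \<mu> / 2" using mu by simp
  from shadow[OF s(1,2) this, of ?c] obtain w where w: "\<forall>b. jump_le b ?c \<longrightarrow> jump_le b w"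
    "dist2 d (u T) (pc w) \<le> dist2 d (u s) (pc ?c) + \<mu> / 2"
    by (elim exE conjE)
  have w_close: "dist2 d (u T) (pc w) \<le> \<mu>"
    using w(2) ip_triangle[OF Ls L0 pc_L2[of ?c]] c_close s(3) by linarith
  have w_jump: "jump_le (\<lambda>i. \<integral>x. tent i x \<partial>\<nu>) w" using w(1) c_jump by blast
  have w_bound: "\<bar>ip d (pc w) \<psi>'\<bar> \<le> (\<integral>x. \<bar>\<psi> x\<bar> \<partial>\<nu>) + \<eta> * measure \<nu> (dset d)"
    by (rule jump_bound_test[OF nu(1,2) w_jump psi]) (use d1(2) del hd eta(1) in \<open>fastforce intro: less_imp_le\<close>)+
  let ?g = "\<lambda>x. u T x - pc w x"
  have Lg: "L2 d ?g" by (intro L2_diff LT pc_L2)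
  have "ip d ?g ?g / (2 * \<kappa>) \<le> e / 4"
    using w_close kap(1) by (simp add: \<mu>_def field_simps del: ip_self)
  then have "\<bar>ip d \<psi>' ?g\<bar> \<le> e / 2"
    using ip_young[OF Lp Lg kap(1)] ip_young_neg[OF Lp Lg kap(1)] kap(2) by linarith
  moreover have "ip d \<psi>' ?g = ip d (u T) \<psi>' - ip d (pc w) \<psi>'"
    using ip_diff_left[OF LT pc_L2 Lp, of w] by (simp add: ip_commute[of d \<psi>'])
  ultimately show "\<bar>ip d (u T) \<psi>'\<bar> \<le> (\<integral>x. \<bar>\<psi> x\<bar> \<partial>\<nu>) + e"
    using w_bound eta(2) by linarith
qed

theorem theorem6p1:
  fixes d :: dom1 and u0 :: "real \<Rightarrow> real" and u :: "real \<Rightarrow> real \<Rightarrow> real"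
    and \<nu>0 :: "real measure" and t :: real
  assumes "valid_dom d"
    and "is_TV_measure d u0 \<nu>0"
    and "TV_flow_solution d u0 u"
    and "t > 0"
  shows "\<exists>\<nu>t. is_TV_measure d (u t) \<nu>t \<and>
           (\<forall>\<phi>. Cc_test d \<phi> \<and> (\<forall>x. 0 \<le> \<phi> x) \<longrightarrow>
              (\<integral>x. \<phi> x \<partial>\<nu>t) \<le> (\<integral>x. \<phi> x \<partial>\<nu>0))"
proof -
  note sol = assms(3)[unfolded TV_flow_solution_def]
  note L2u = conjunct1[OF sol, rule_format] and cont = conjunct1[OF conjunct2[OF sol], rule_format]
    and init = conjunct1[OF conjunct2[OF conjunct2[OF sol]]]
  from conjunct2[OF conjunct2[OF conjunct2[OF sol]]] obtain v where v:
    "(\<lambda>(t, x). v t x) \<in> borel_measurable (lborel \<Otimes>\<^sub>M leb d) \<and>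
        (\<forall>\<delta>>0. (\<integral>\<^sup>+ t \<in> {\<delta><..}. (\<integral>\<^sup>+ x. ennreal ((v t x)\<^sup>2) \<partial>leb d) \<partial>lborel) < \<infinity>) \<and>
        (\<forall>s t. 0 < s \<longrightarrow> s \<le> t \<longrightarrow>
           (AE x in leb d. u t x - u s x = (LINT \<tau>:{s..t}|lborel. v \<tau> x))) \<and>
        (AE t in lborel. t > 0 \<longrightarrow> in_subdiff_TV d (u t) (\<lambda>x. - v t x))"
    by (elim exE)
  note v1 = conjunct1[OF v] and v2 = conjunct1[OF conjunct2[OF v], rule_format]
    and v3 = conjunct1[OF conjunct2[OF conjunct2[OF v]], rule_format] and v4 = conjunct2[OF conjunct2[OF conjunct2[OF v]]]
  interpret flow d u v
    by (rule flow.intro[OF L2u v1 v2 v3 v4])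
  from assms(2) obtain \<sigma> where pol0: "polar d u0 \<nu>0 \<sigma>" unfolding is_TV_measure_iff_polar by (rule exE)
  note p = polarD[OF pol0]
  \<comment> \<open>\<open>u 0\<close> equals \<open>u0\<close> only almost everywhere; pairings
    with test functions do not see the difference.\<close>
  have pol: "polar d (u 0) \<nu>0 \<sigma>"
    unfolding polar_def
  proof (intro conjI allI impI p(2,3,5))
    show "integrable (leb d) (u 0)" by (intro L2_integrable L2u) simp
    show "\<forall>x\<in>space \<nu>0. \<bar>\<sigma> x\<bar> = 1" using p(4,6) by simp
    fix \<phi> \<phi>' assume t: "C1_test d \<phi> \<phi>'"
    have m: "\<phi>' \<in> borel_measurable (leb d)"
      by (rule continuous_measurable_lebesgue_on[OF C1_test_continuous(2)[OF t]])
    have "ip d (u 0) \<phi>' = ip d u0 \<phi>'"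
    proof (rule integral_cong_AE)
      show "AE x in leb d. u 0 x * \<phi>' x = u0 x * \<phi>' x" using init by eventually_elim simp
    qed (use L2u[of 0] p(1) m in \<open>auto simp: L2_def\<close>)
    then show "ip d (u 0) \<phi>' = - (\<integral>x. \<phi> x * \<sigma> x \<partial>\<nu>0)" using p(7)[OF t] by simp
  qed
  have "((\<lambda>s. dist2 d (u s) (u 0)) \<longlongrightarrow> 0) (at 0 within {0..})"
    unfolding ip_self by (rule cont) simp
  note bound = variation_bound[OF assms(1) pol this assms(4)]
  have "integrable (leb d) (u t)" using assms(4) by (intro L2_integrable L2u) simp
  \<comment> \<open>\<nu>0 takes the place of the dominating measure \<rho>, so the total variation
    measure obtained for \<open>u t\<close> lies below it.\<close>
  then interpret dominated_functional d "u t" \<nu>0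
    by (rule dominated_functional.intro[OF assms(1) _ p(2,3) bound])
  from tv_measure_exists obtain \<nu>t where nut: "is_TV_measure d (u t) \<nu>t"
    and le: "\<forall>\<phi>::real \<Rightarrow> real. continuous_on UNIV \<phi> \<and> (\<forall>x. 0 \<le> \<phi> x) \<longrightarrow> (\<integral>x. \<phi> x \<partial>\<nu>t) \<le> (\<integral>x. \<phi> x \<partial>\<nu>0)"
    by (elim exE conjE)
  have "\<forall>\<phi>::real \<Rightarrow> real. Cc_test d \<phi> \<and> (\<forall>x. 0 \<le> \<phi> x) \<longrightarrow> (\<integral>x. \<phi> x \<partial>\<nu>t) \<le> (\<integral>x. \<phi> x \<partial>\<nu>0)"
  proof (intro allI impI)
    fix \<phi> :: rfun assume a: "Cc_test d \<phi> \<and> (\<forall>x. 0 \<le> \<phi> x)"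
    then have "continuous_on UNIV \<phi>" unfolding Cc_test_def by (elim conjE)
    then show "(\<integral>x. \<phi> x \<partial>\<nu>t) \<le> (\<integral>x. \<phi> x \<partial>\<nu>0)" using le[rule_format, of \<phi>] conjunct2[OF a] by simp
  qed
  with nut show ?thesis by (intro exI[of _ \<nu>t] conjI)
qed

end
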